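(* Let $(l,Q,\omega,\varphi)$ be admissible data (see context), let $s\in(0,\infty)$ and $0<m_0<m_1<1$, and let $w_{m,s}$, $\lambda_{m,s}\in(0,\vartheta^{1/2}(m)]$ and $\mathfrak G_s$ be as in the context. Then: 1. If $\lambda_{m,s}\in(0,\vartheta^{1/2}(m))$ for every $m\in(m_0,m_1)$, then $\mathfrak G_s\in C^1((m_0,m_1))$ and $\mathfrak G_s$ is strictly decreasing on $(m_0,m_1)$. Moreover, $m\mapsto\lambda_{m,s}$ belongs to $C^1((m_0,m_1))$ and is strictly increasing. 2. If $\lambda_{m,s}=\vartheta^{1/2}(m)$ for every $m\in(m_0,m_1)$, and $\vartheta\in C^1((m_0,m_1))$ with $\vartheta'(t)>0$ for every $t\in(0,1)$ (in particular $\vartheta$ is differentiable on $(0,1)$), then $\mathfrak G_s\in C^1((m_0,m_1))$ and $\mathfrak G_s$ is increasing (i.e. non-decreasing) on $(m_0,m_1)$. More precisely: (a) if $w_{m,s}\in SBV\setminus W^{1,1}((2m-1,1))$ for every $m\in(m_0,m_1)$, then $\mathfrak G_s$ is strictly increasing on $(m_0,m_1)$; (b) if $w_{m,s}\in W^{1,1}((2m-1,1))$ for some $m\in(m_0,m_1)$, then $\mathfrak G_s'(m)=0$.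
   Context: Convention: $0\cdot\infty=0$. Admissible data: $l,Q\in C^0([0,1],[0,\infty))$ with $l(1)=1$, $l^{-1}(\{0\})=Q^{-1}(\{0\})=\{0\}$, $Q$ increasing in a right neighbourhood of $0$, and $t\mapsto (l(t)/Q(1-t))^{1/2}$ (on $[0,1)$) increasing in a right neighbourhood of $0$; $\omega\in C^0([0,1],[0,\infty))$ with $\omega^{-1}(\{0\})=\{0\}$ such that the limit $\bar\varsigma:=\lim_{t\to0^+}(\omega(t)/Q(t))^{1/2}\in[0,\infty]$ exists; $\varphi\in C^0([0,\infty),[0,\infty))$ non-decreasing with $\lim_{t\to\infty}\varphi(t)\in(0,\infty)$, $\varphi^{-1}(0)=\{0\}$, right-differentiable at $0$ with $\varphi'(0^+)=1$; and the function $\vartheta(t):=\frac{\omega(1-t)}{Q(1-t)}l(t)$ is strictly increasing on $[0,1)$. Then $\vartheta$ is continuous, $\vartheta(0)=0$ and $\vartheta(1^-)=\bar\varsigma^2\in(0,\infty]$; set $\vartheta(1):=\vartheta(1^-)$. For $m\in(0,1)$, $t\in[2m-1,1]$: $\vartheta_m(t):=\vartheta(m+|t-m|)$, $\omega_m(1-t):=\omega(1-m-|t-m|)$. For $w\in BV((2m-1,1))$ $$sc^-G_{m,s}(w):=\int_{2m-1}^1\big(\vartheta_m(t)|w'|^2+\omega_m(1-t)\big)^{1/2}dt+\int_{2m-1}^1\vartheta_m^{1/2}\,d|D^sw|+\vartheta^{1/2}(1^-)|w((2m-1)^+)|+\vartheta^{1/2}(1^-)|w(1^-)-s|,$$ and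 $+\infty$ on $L^1\setminus BV$. This functional has a unique minimizer $w_{m,s}$ on $L^1((2m-1,1))$. It belongs to $SBV((2m-1,1))$, is strictly increasing, satisfies $w_{m,s}(2m-t)=s-w_{m,s}(t)$, $w_{m,s}(2m-1)=0$, $w_{m,s}(1)=s$, has singular derivative at most at $t=m$, and for a unique $\lambda_{m,s}\in(0,\vartheta^{1/2}(m)]$ one has $w_{m,s}'(t)=\Big(\frac{\lambda_{m,s}^2\,\omega_m(1-t)}{\vartheta_m(t)(\vartheta_m(t)-\lambda_{m,s}^2)}\Big)^{1/2}$ for a.e. $t$; if $w_{m,s}\notin W^{1,1}$ then $\lambda_{m,s}=\vartheta^{1/2}(m)$. Set $\mathfrak G_s(m):=sc^-G_{m,s}(w_{m,s})$. *)

theory Defs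
  imports "HOL-Analysis.Analysis"
begin

text \<open>
  Functions are real functions on the line of which only the restriction to \<open>{a<..<b}\<close> matters,
  and that only up to null sets. There are no signed measures in the library; a finite signed
  Borel measure on \<open>{a<..<b}\<close> is written as a difference of two finite positive ones.
\<close>

definition L1_on :: "real \<Rightarrow> real \<Rightarrow> (real \<Rightarrow> real) set" where
  "L1_on a b = {w. set_integrable lborel {a<..<b} w}"

definition test_function :: "real \<Rightarrow> real \<Rightarrow> (real \<Rightarrow> real) \<Rightarrow> bool" where
  "test_function a b f \<longleftrightarrow> f C1_differentiable_on UNIV \<and> closure {x. f x \<noteq> 0} \<subseteq> {a<..<b}"

definition finite_borel_on :: "real \<Rightarrow> real \<Rightarrow> real measure \<Rightarrow> bool" where
  "finite_borel_on a b M \<longleftrightarrow> sets M = sets borel \<and> finite_measure M \<and> emeasure M (- {a<..<b}) = 0"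

definition mutually_singular :: "real measure \<Rightarrow> real measure \<Rightarrow> bool" where
  "mutually_singular M N \<longleftrightarrow> (\<exists>A \<in> sets borel. emeasure M A = 0 \<and> emeasure N (- A) = 0)"

definition BV_on :: "real \<Rightarrow> real \<Rightarrow> (real \<Rightarrow> real) set" where
  "BV_on a b = {w \<in> L1_on a b. \<exists>M N. finite_borel_on a b M \<and> finite_borel_on a b N \<and>
     (\<forall>f. test_function a b f \<longrightarrow>
        (LBINT x:{a<..<b}. w x * deriv f x) = - ((\<integral>x. f x \<partial>M) - (\<integral>x. f x \<partial>N)))}"

definition W11_on :: "real \<Rightarrow> real \<Rightarrow> (real \<Rightarrow> real) set" where
  "W11_on a b = {w \<in> L1_on a b. \<exists>g \<in> L1_on a b.
     \<forall>f. test_function a b f \<longrightarrow>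
        (LBINT x:{a<..<b}. w x * deriv f x) = - (LBINT x:{a<..<b}. g x * f x)}"

text \<open>
  The distributional derivative of \<open>w\<close> is \<open>g dx + P - N\<close>, where \<open>g dx\<close> is its absolutely
  continuous part, and \<open>P\<close>, \<open>N\<close> are the positive and negative part (Jordan decomposition) of its
  singular part. Thus the total variation measure of the singular part is \<open>P + N\<close>.
\<close>

definition derivative_parts ::
  "real \<Rightarrow> real \<Rightarrow> (real \<Rightarrow> real) \<Rightarrow> (real \<Rightarrow> real) \<Rightarrow> real measure \<Rightarrow> real measure \<Rightarrow> bool" where
  "derivative_parts a b w g P N \<longleftrightarrow>
     g \<in> L1_on a b \<and> finite_borel_on a b P \<and> finite_borel_on a b N \<and>
     mutually_singular P N \<and> mutually_singular lborel P \<and> mutually_singular lborel N \<and>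
     (\<forall>f. test_function a b f \<longrightarrow>
        (LBINT x:{a<..<b}. w x * deriv f x)
          = - ((LBINT x:{a<..<b}. g x * f x) + ((\<integral>x. f x \<partial>P) - (\<integral>x. f x \<partial>N))))"

text \<open>
  For \<open>w\<close> in \<open>BV_on a b\<close> the parts are unique, the density up to null sets; the
  choice below therefore only picks a representative of the density.
\<close>

definition ac_density :: "real \<Rightarrow> real \<Rightarrow> (real \<Rightarrow> real) \<Rightarrow> real \<Rightarrow> real" where
  "ac_density a b w = (SOME g. \<exists>P N. derivative_parts a b w g P N)"

definition sing_pos :: "real \<Rightarrow> real \<Rightarrow> (real \<Rightarrow> real) \<Rightarrow> real measure" where
  "sing_pos a b w = (SOME P. \<exists>g N. derivative_parts a b w g P N)"

definition sing_neg :: "real \<Rightarrow> real \<Rightarrow> (real \<Rightarrow> real) \<Rightarrow> real measure" where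
  "sing_neg a b w = (SOME N. \<exists>g P. derivative_parts a b w g P N)"

text \<open>
  In dimension one the jump part of the derivative is its purely atomic part, so a function is
  in SBV (no Cantor part) iff the singular part is carried by a countable set.
\<close>

definition SBV_on :: "real \<Rightarrow> real \<Rightarrow> (real \<Rightarrow> real) set" where
  "SBV_on a b = {w \<in> BV_on a b. \<exists>C. countable C \<and>
     emeasure (sing_pos a b w) (- C) = 0 \<and> emeasure (sing_neg a b w) (- C) = 0}"

text \<open>One-sided traces, i.e. essential one-sided limits (independent of the representative).\<close>

definition right_trace :: "(real \<Rightarrow> real) \<Rightarrow> real \<Rightarrow> real" where
  "right_trace w a = (THE c. \<forall>e>0. \<exists>d>0. AE x in lborel. a < x \<and> x < a + d \<longrightarrow> \<bar>w x - c\<bar> < e)"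

definition left_trace :: "(real \<Rightarrow> real) \<Rightarrow> real \<Rightarrow> real" where
  "left_trace w b = (THE c. \<forall>e>0. \<exists>d>0. AE x in lborel. b - d < x \<and> x < b \<longrightarrow> \<bar>w x - c\<bar> < e)"

definition theta :: "(real \<Rightarrow> real) \<Rightarrow> (real \<Rightarrow> real) \<Rightarrow> (real \<Rightarrow> real) \<Rightarrow> real \<Rightarrow> real" where
  "theta l Q \<omega> t = \<omega> (1 - t) / Q (1 - t) * l t"

locale admissible_data =
  fixes l Q \<omega> \<phi> :: "real \<Rightarrow> real"
  assumes l_cont: "continuous_on {0..1} l"
    and l_nonneg: "\<And>t. t \<in> {0..1} \<Longrightarrow> 0 \<le> l t"
    and l_one: "l 1 = 1"
    and l_zero: "\<And>t. t \<in> {0..1} \<Longrightarrow> l t = 0 \<longleftrightarrow> t = 0"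
    and Q_cont: "continuous_on {0..1} Q"
    and Q_nonneg: "\<And>t. t \<in> {0..1} \<Longrightarrow> 0 \<le> Q t"
    and Q_zero: "\<And>t. t \<in> {0..1} \<Longrightarrow> Q t = 0 \<longleftrightarrow> t = 0"
    and Q_mono: "\<exists>d. 0 < d \<and> d \<le> 1 \<and> mono_on {0..<d} Q"
    and lQ_mono: "\<exists>d. 0 < d \<and> d \<le> 1 \<and> mono_on {0..<d} (\<lambda>t. sqrt (l t / Q (1 - t)))"
    and omega_cont: "continuous_on {0..1} \<omega>"
    and omega_nonneg: "\<And>t. t \<in> {0..1} \<Longrightarrow> 0 \<le> \<omega> t"
    and omega_zero: "\<And>t. t \<in> {0..1} \<Longrightarrow> \<omega> t = 0 \<longleftrightarrow> t = 0"
    and omega_Q_lim: "\<exists>c :: ennreal. ((\<lambda>t. ennreal (sqrt (\<omega> t / Q t))) \<longlongrightarrow> c) (at_right 0)"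
    and phi_cont: "continuous_on {0..} \<phi>"
    and phi_nonneg: "\<And>t. 0 \<le> t \<Longrightarrow> 0 \<le> \<phi> t"
    and phi_mono: "mono_on {0..} \<phi>"
    and phi_lim: "\<exists>L>0. (\<phi> \<longlongrightarrow> L) at_top"
    and phi_zero: "\<And>t. 0 \<le> t \<Longrightarrow> \<phi> t = 0 \<longleftrightarrow> t = 0"
    and phi_deriv: "(\<phi> has_real_derivative 1) (at_right 0)"
    and theta_mono: "strict_mono_on {0..<1} (theta l Q \<omega>)"

text \<open>
  The value of \<^const>\<open>theta\<close> at \<open>1\<close> given by its defining formula is meaningless. It is used nowhere:
  in the interior of the interval only values in \<open>{0<..<1}\<close> occur, and the boundary terms use
  the following limit, which may be infinite (and \<open>\<infinity> * 0 = 0\<close> in \<^typ>\<open>ennreal\<close>).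
\<close>

definition sqrt_theta_end ::
  "(real \<Rightarrow> real) \<Rightarrow> (real \<Rightarrow> real) \<Rightarrow> (real \<Rightarrow> real) \<Rightarrow> ennreal" where
  "sqrt_theta_end l Q \<omega> = Lim (at_left 1) (\<lambda>t. ennreal (sqrt (theta l Q \<omega> t)))"

definition theta_m ::
  "(real \<Rightarrow> real) \<Rightarrow> (real \<Rightarrow> real) \<Rightarrow> (real \<Rightarrow> real) \<Rightarrow> real \<Rightarrow> real \<Rightarrow> real" where
  "theta_m l Q \<omega> m t = theta l Q \<omega> (m + \<bar>t - m\<bar>)"

text \<open>This is \<open>\<omega>\<^sub>m(1 - t)\<close> as a function of \<open>t\<close>.\<close>

definition omega_m :: "(real \<Rightarrow> real) \<Rightarrow> real \<Rightarrow> real \<Rightarrow> real" where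
  "omega_m \<omega> m t = \<omega> (1 - m - \<bar>t - m\<bar>)"

definition scG ::
  "(real \<Rightarrow> real) \<Rightarrow> (real \<Rightarrow> real) \<Rightarrow> (real \<Rightarrow> real) \<Rightarrow> real \<Rightarrow> real \<Rightarrow> (real \<Rightarrow> real) \<Rightarrow> ennreal" where
  "scG l Q \<omega> m s w =
     (let a = 2 * m - 1; \<theta> = theta_m l Q \<omega> m in
      if w \<in> BV_on a 1 then
        (\<integral>\<^sup>+ t \<in> {a<..<1}. ennreal (sqrt (\<theta> t * \<bar>ac_density a 1 w t\<bar>\<^sup>2 + omega_m \<omega> m t)) \<partial>lborel)
        + ((\<integral>\<^sup>+ t \<in> {a<..<1}. ennreal (sqrt (\<theta> t)) \<partial>sing_pos a 1 w)
           + (\<integral>\<^sup>+ t \<in> {a<..<1}. ennreal (sqrt (\<theta> t)) \<partial>sing_neg a 1 w))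
        + sqrt_theta_end l Q \<omega> * ennreal \<bar>right_trace w a\<bar>
        + sqrt_theta_end l Q \<omega> * ennreal \<bar>left_trace w 1 - s\<bar>
      else \<infinity>)"

definition is_minimizer ::
  "(real \<Rightarrow> real) \<Rightarrow> (real \<Rightarrow> real) \<Rightarrow> (real \<Rightarrow> real) \<Rightarrow> real \<Rightarrow> real \<Rightarrow> (real \<Rightarrow> real) \<Rightarrow> bool" where
  "is_minimizer l Q \<omega> m s w \<longleftrightarrow> w \<in> L1_on (2 * m - 1) 1 \<and>
     (\<forall>v \<in> L1_on (2 * m - 1) 1. scG l Q \<omega> m s w \<le> scG l Q \<omega> m s v)"

text \<open>
  The minimizer is unique as an element of \<open>L\<^sup>1\<close>, i.e. up to null sets; the choice is that of a
  representative.
\<close>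

definition w_min ::
  "(real \<Rightarrow> real) \<Rightarrow> (real \<Rightarrow> real) \<Rightarrow> (real \<Rightarrow> real) \<Rightarrow> real \<Rightarrow> real \<Rightarrow> real \<Rightarrow> real" where
  "w_min l Q \<omega> m s = (SOME w. is_minimizer l Q \<omega> m s w)"

definition lam ::
  "(real \<Rightarrow> real) \<Rightarrow> (real \<Rightarrow> real) \<Rightarrow> (real \<Rightarrow> real) \<Rightarrow> real \<Rightarrow> real \<Rightarrow> real" where
  "lam l Q \<omega> m s = (THE r. r \<in> {0<..sqrt (theta l Q \<omega> m)} \<and>
     (AE t in lborel. t \<in> {2 * m - 1<..<1} \<longrightarrow>
        ac_density (2 * m - 1) 1 (w_min l Q \<omega> m s) t =
          sqrt (r\<^sup>2 * omega_m \<omega> m t / (theta_m l Q \<omega> m t * (theta_m l Q \<omega> m t - r\<^sup>2)))))"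

definition frakG ::
  "(real \<Rightarrow> real) \<Rightarrow> (real \<Rightarrow> real) \<Rightarrow> (real \<Rightarrow> real) \<Rightarrow> real \<Rightarrow> real \<Rightarrow> ennreal" where
  "frakG l Q \<omega> s m = scG l Q \<omega> m s (w_min l Q \<omega> m s)"

text \<open>
  Continuous differentiability of an extended-valued function includes its finiteness, so that
  passing to \<^const>\<open>enn2real\<close> loses nothing.
\<close>

definition ennreal_C1_on :: "(real \<Rightarrow> ennreal) \<Rightarrow> real set \<Rightarrow> bool" where
  "ennreal_C1_on F S \<longleftrightarrow> (\<forall>x \<in> S. F x < \<infinity>) \<and> (\<lambda>x. enn2real (F x)) C1_differentiable_on S"

end

theory Submission
  imports Defs
begin

text \<open>
  Write \<open>\<theta>\<close> and \<open>\<omega>\<close> for \<open>\<theta>\<^sub>m\<close> and \<open>\<omega>\<^sub>m(1 - t)\<close>. For every \<open>0 < \<mu> \<le> sqrt (\<theta> m)\<close> the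
  Cauchy--Schwarz inequality gives \<open>sqrt (\<theta> g\<^sup>2 + \<omega>) \<ge> \<mu> g + sqrt (\<omega> (1 - \<mu>\<^sup>2 / \<theta>))\<close>. Since the jumps of a
  function of bounded variation add up with its density to the difference of its boundary traces, the
  energy of every competitor is at least \<open>\<mu> s + 2 \<integral>\<^sub>m\<^sup>1 sqrt (\<omega> (1 - \<mu>\<^sup>2 / \<theta>))\<close>. Equality forces the density
  to be the slope \<open>sqrt (\<mu>\<^sup>2 \<omega> / (\<theta> (\<theta> - \<mu>\<^sup>2)))\<close>, and the singular part to be a jump at \<open>m\<close>, which can only
  occur if \<open>\<mu>\<^sup>2 = \<theta> m\<close>. If \<open>\<mu>\<close> is chosen such that the slopes have total mass \<open>s\<close>, or \<open>\<mu>\<^sup>2 = \<theta> m\<close> and the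
  mass is at most \<open>s\<close>, this bound is attained; so \<open>\<mu>\<close> is the multiplier of the minimizer.

  Differentiating \<open>\<mu> s + 2 \<integral>\<^sub>m\<^sup>1 sqrt (\<omega> (1 - \<mu>\<^sup>2 / \<theta>))\<close> along the curve \<open>\<mu>(m)\<close> of multipliers yields
  \<open>\<mu>' (s - 2 J) - 2 sqrt (\<omega> (1 - \<mu>\<^sup>2 / \<theta>))\<close>, evaluated at \<open>m\<close>, where \<open>2 J\<close> is the mass of the slopes.
  In the first case \<open>2 J = s\<close> and the second term is negative; in the second case the second term
  vanishes and \<open>\<mu> = sqrt \<theta>\<close> is increasing.
\<close>

section \<open>Test functions\<close>

text \<open>The parts of a derivative, the traces, the minimizer and the multiplier are all fixed by
  \<open>SOME\<close> or \<open>THE\<close>; existence, and as much uniqueness as is needed, must be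
  proved before any of them can be evaluated. For derivatives this is done by writing Lebesgue
  measure and all singular parts as densities with respect to one sigma-finite measure, where mutual
  singularity becomes disjointness of supports. The obstacle to differentiating in \<open>m\<close>
  is that the slopes may blow up at the lower end of integration, which itself moves, and that in
  the first case \<open>\<theta>\<close> is merely continuous. Two parameters \<open>x < w\<close>
  are therefore compared by exact identities: the integral over \<open>{x<..<1}\<close> is cut at
  \<open>w\<close>, and on \<open>{w<..<1}\<close> both multipliers are admissible because
  \<open>\<theta>\<close> increases, so only an algebraic difference quotient is integrated there.
  The limits in \<open>x\<close> and \<open>w\<close> then need just a majorant in the distance
  \<open>u\<close> from the end point, either a constant or a multiple of
  \<open>1 / sqrt u\<close>.\<close>

lemma has_real_derivative_pos_part_power2:
  "((\<lambda>x::real. (max 0 x)\<^sup>2) has_real_derivative 2 * max 0 x) (at x)"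
proof -
  consider "x < 0" | "x = 0" | "x > 0" by linarith
  then show ?thesis
  proof cases
    case 1
    have "((\<lambda>x::real. 0) has_real_derivative 0) (at x)" by simp
    then show ?thesis
      using has_field_derivative_transform_within_open[of "\<lambda>x. 0" 0 x "{..<0}" "\<lambda>x. (max 0 x)\<^sup>2"] 1
      by auto
  next
    case 2
    have "((\<lambda>h::real. (max 0 h)\<^sup>2 / h) \<longlongrightarrow> 0) (at 0)"
    proof (rule Lim_null_comparison)
      show "\<forall>\<^sub>F h::real in at 0. norm ((max 0 h)\<^sup>2 / h) \<le> \<bar>h\<bar>"
        by (rule always_eventually) (auto simp: max_def power2_eq_square)
      show "((\<lambda>h::real. \<bar>h\<bar>) \<longlongrightarrow> 0) (at 0)"
        using tendsto_rabs[OF tendsto_ident_at, of "0::real" UNIV] by simp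
    qed
    then show ?thesis using 2 by (simp add: DERIV_def)
  next
    case 3
    have "((\<lambda>x::real. x\<^sup>2) has_real_derivative 2 * x) (at x)"
      by (auto intro!: derivative_eq_intros)
    then show ?thesis
      using has_field_derivative_transform_within_open[of "\<lambda>x. x\<^sup>2" "2 * x" x "{0<..}" "\<lambda>x. (max 0 x)\<^sup>2"] 3
      by auto
  qed
qed

lemma C1_differentiable_on_I:
  fixes f :: "real \<Rightarrow> real"
  assumes "\<And>x. x \<in> S \<Longrightarrow> (f has_real_derivative g x) (at x)" "continuous_on S g"
  shows "f C1_differentiable_on S"
  using assms unfolding C1_differentiable_on_def
  by (auto simp: has_real_derivative_iff_has_vector_derivative)

text \<open>Squares of positive parts are C1, which is all that \<open>test_function\<close>
  demands. The quotient \<open>k * v / (1 + k * v)\<close> keeps the values in the unit interval and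
  tends to 1 wherever \<open>v > 0\<close> as \<open>k\<close> grows.\<close>

definition bump :: "real \<Rightarrow> real \<Rightarrow> real \<Rightarrow> real \<Rightarrow> real" where
  "bump p q k x = (let v = (max 0 (x - p))\<^sup>2 * (max 0 (q - x))\<^sup>2 in k * v / (1 + k * v))"

lemma bump_eq_0: "bump p q k x = 0" if "x \<notin> {p<..<q}"
  using that by (auto simp: bump_def)

lemma bump_range: assumes "0 \<le> k" shows "0 \<le> bump p q k x" "bump p q k x \<le> 1"
proof -
  have "0 \<le> k * ((max 0 (x - p))\<^sup>2 * (max 0 (q - x))\<^sup>2)" using assms by simp
  then show "0 \<le> bump p q k x" "bump p q k x \<le> 1" by (simp_all add: bump_def Let_def divide_simps)
qed

lemma bump_pos: "0 < bump p q k x" if "x \<in> {p<..<q}" "0 < k"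
proof -
  have "0 < k * ((max 0 (x - p))\<^sup>2 * (max 0 (q - x))\<^sup>2)" using that by auto
  then show ?thesis by (simp add: bump_def Let_def)
qed

lemma bump_C1: assumes "0 \<le> k" shows "bump p q k C1_differentiable_on UNIV"
proof -
  define v where "v x = (max 0 (x - p))\<^sup>2 * (max 0 (q - x))\<^sup>2" for x
  define v' where "v' x = (2 * max 0 (x - p)) * (max 0 (q - x))\<^sup>2 - (max 0 (x - p))\<^sup>2 * (2 * max 0 (q - x))" for x
  have 1: "((\<lambda>x. (max 0 (x - p))\<^sup>2) has_real_derivative 2 * max 0 (x - p)) (at x)" for x
    using DERIV_chain2[OF has_real_derivative_pos_part_power2, of "\<lambda>x. x - p" 1 x UNIV] by (simp add: DERIV_diff[of "\<lambda>x. x" 1 _ _ "\<lambda>_. p" 0, simplified])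
  have 2: "((\<lambda>x. (max 0 (q - x))\<^sup>2) has_real_derivative - (2 * max 0 (q - x))) (at x)" for x
    using DERIV_chain2[OF has_real_derivative_pos_part_power2, of "\<lambda>x. q - x" "-1" x UNIV] by (simp add: DERIV_diff[of "\<lambda>_. q" 0 _ _ "\<lambda>x. x" 1, simplified])
  have v: "(v has_real_derivative v' x) (at x)" for x
    unfolding v_def v'_def by (rule derivative_eq_intros 1 2 | simp)+
  have v0: "0 \<le> k * v x" for x using assms by (simp add: v_def)
  then have nz: "1 + k * v x \<noteq> 0" for x by (smt (verit))
  have "(bump p q k has_real_derivative k * v' x / (1 + k * v x)\<^sup>2) (at x)" for x
  proof -
    have "((\<lambda>x. k * v x / (1 + k * v x)) has_real_derivative
      ((k * v' x) * (1 + k * v x) - (k * v x) * (k * v' x)) / ((1 + k * v x) * (1 + k * v x))) (at x)"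
      by (rule derivative_eq_intros v refl nz | simp)+
    moreover have "((k * v' x) * (1 + k * v x) - (k * v x) * (k * v' x)) / ((1 + k * v x) * (1 + k * v x))
       = k * v' x / (1 + k * v x)\<^sup>2" by (simp add: power2_eq_square algebra_simps)
    ultimately show ?thesis by (simp add: bump_def[abs_def] v_def Let_def)
  qed
  moreover have "continuous_on UNIV (\<lambda>x. k * v' x / (1 + k * v x)\<^sup>2)"
    using nz unfolding v_def v'_def by (intro continuous_intros) auto
  ultimately show ?thesis by (intro C1_differentiable_on_I)
qed

lemma test_function_I:
  assumes "f C1_differentiable_on UNIV" "\<And>x. x \<notin> {p..q} \<Longrightarrow> f x = 0" "a < p" "q < b"
  shows "test_function a b f"
proof -
  have "{x. f x \<noteq> 0} \<subseteq> {p..q}" using assms(2) by blast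
  then have "closure {x. f x \<noteq> 0} \<subseteq> {p..q}" by (simp add: closure_minimal)
  then show ?thesis using assms by (auto simp: test_function_def)
qed

lemma test_function_bump: "0 \<le> k \<Longrightarrow> a < p \<Longrightarrow> q < b \<Longrightarrow> test_function a b (bump p q k)"
  by (rule test_function_I[OF bump_C1, of k p q]) (auto intro!: bump_eq_0)

text \<open>The end points move inwards by \<open>1 / Suc n\<close> so that the support stays
  compactly inside \<open>{c<..<d}\<close>, while the sharpness \<open>n\<close> tends to infinity.
  For small \<open>n\<close> the end points may cross; the bump is then identically zero.\<close>

lemma bump_tendsto_indicator:
  assumes "c < d"
  shows "(\<lambda>n. bump (c + 1 / Suc n) (d - 1 / Suc n) (real n) x) \<longlonglongrightarrow> indicator {c<..<d} x"
proof (cases "x \<in> {c<..<d}")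
  case False
  then have "bump (c + 1 / Suc n) (d - 1 / Suc n) (real n) x = 0" for n
  proof -
    have "0 < 1 / real (Suc n)" by simp
    then show ?thesis using False by (intro bump_eq_0) (smt (verit) greaterThanLessThan_iff)
  qed
  then show ?thesis using False by simp
next
  case True
  define v where "v n = (max 0 (x - (c + 1 / Suc n)))\<^sup>2 * (max 0 (d - 1 / Suc n - x))\<^sup>2" for n
  have inv: "(\<lambda>n. 1 / real (Suc n)) \<longlonglongrightarrow> 0"
    using LIMSEQ_Suc[OF lim_1_over_n] by simp
  have "v \<longlonglongrightarrow> (max 0 (x - (c + 0)))\<^sup>2 * (max 0 (d - 0 - x))\<^sup>2"
    unfolding v_def by (intro tendsto_intros inv)
  moreover have "0 < (max 0 (x - (c + 0)))\<^sup>2 * (max 0 (d - 0 - x))\<^sup>2" using True by auto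
  ultimately have lim: "filterlim (\<lambda>n. v n * real n) at_top sequentially"
    by (intro filterlim_tendsto_pos_mult_at_top filterlim_real_sequentially)
  then have "filterlim (\<lambda>n. 1 + v n * real n) at_top sequentially"
    by (intro filterlim_tendsto_add_at_top[OF tendsto_const])
  then have "(\<lambda>n. 1 - 1 / (1 + v n * real n)) \<longlonglongrightarrow> 1 - 0"
    by (intro tendsto_intros tendsto_divide_0[OF tendsto_const] filterlim_at_top_imp_at_infinity)
  moreover have "bump (c + 1 / Suc n) (d - 1 / Suc n) (real n) x = 1 - 1 / (1 + v n * real n)" for n
  proof -
    have "0 \<le> v n * real n" by (simp add: v_def)
    then have "1 + v n * real n \<noteq> 0" by linarith
    then have "1 - 1 / (1 + v n * real n) = v n * real n / (1 + v n * real n)" by (simp add: diff_divide_eq_iff)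
    then show ?thesis by (simp add: bump_def v_def Let_def mult.commute)
  qed
  ultimately show ?thesis using True by simp
qed

lemma test_function_facts:
  assumes "test_function a b f"
  shows "(f has_real_derivative deriv f x) (at x)" "continuous_on UNIV (deriv f)" "continuous_on UNIV f"
    "x \<notin> {a<..<b} \<Longrightarrow> f x = 0" "x \<notin> {a<..<b} \<Longrightarrow> deriv f x = 0"
proof -
  obtain D where D: "\<And>x. (f has_real_derivative D x) (at x)" "continuous_on UNIV D"
    using assms by (auto simp: test_function_def C1_differentiable_on_def has_real_derivative_iff_has_vector_derivative)
  have d: "deriv f x = D x" for x using D(1) by (rule DERIV_imp_deriv)
  then show 1: "(f has_real_derivative deriv f x) (at x)" "continuous_on UNIV (deriv f)" using D by auto
  show "continuous_on UNIV f" using D(1) by (meson DERIV_isCont continuous_at_imp_continuous_on)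
  assume x: "x \<notin> {a<..<b}"
  have cl: "closure {x. f x \<noteq> 0} \<subseteq> {a<..<b}" using assms by (simp add: test_function_def)
  then show "f x = 0" using x closure_subset[of "{x. f x \<noteq> 0}"] by auto
  have "((\<lambda>x. 0) has_real_derivative D x) (at x)"
    by (rule has_field_derivative_transform_within_open[OF D(1)[of x], where S = "- closure {x. f x \<noteq> 0}"])
      (use x cl closure_subset[of "{x. f x \<noteq> 0}"] in auto)
  then show "deriv f x = 0" using DERIV_unique[OF _ DERIV_const] d by metis
qed

lemma test_function_bounded:
  assumes "test_function a b f" shows "\<exists>B. \<forall>x. \<bar>f x\<bar> \<le> B" "\<exists>B. \<forall>x. \<bar>deriv f x\<bar> \<le> B"
proof -
  have *: "\<exists>B. \<forall>x. \<bar>g x\<bar> \<le> B" if "continuous_on UNIV g" "\<And>x. x \<notin> {a<..<b} \<Longrightarrow> g x = 0" for g :: "real \<Rightarrow> real"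
  proof -
    have "compact (g ` {a..b})"
      by (rule compact_continuous_image[OF continuous_on_subset[OF that(1)]]) auto
    then obtain B where B: "\<And>x. x \<in> {a..b} \<Longrightarrow> \<bar>g x\<bar> \<le> B"
      using compact_imp_bounded[of "g ` {a..b}"] unfolding bounded_iff by (metis imageI real_norm_def)
    have "\<bar>g x\<bar> \<le> max 0 B" for x
      using B[of x] that(2)[of x] by (cases "x \<in> {a..b}") (auto simp: max_def)
    then show ?thesis by blast
  qed
  show "\<exists>B. \<forall>x. \<bar>f x\<bar> \<le> B" "\<exists>B. \<forall>x. \<bar>deriv f x\<bar> \<le> B"
    using test_function_facts[OF assms] by (auto intro!: *)
qed

lemma test_function_measurable:
  assumes "test_function a b f" shows "f \<in> borel_measurable borel" "deriv f \<in> borel_measurable borel"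
  using test_function_facts[OF assms] by (auto intro!: borel_measurable_continuous_onI)

lemma integrable_mult_test_function:
  assumes "test_function a b f" "integrable R u" "sets R = sets borel"
  shows "integrable R (\<lambda>x. f x * u x)" "integrable R (\<lambda>x. deriv f x * u x)"
proof -
  have *: "integrable R (\<lambda>x. g x * u x)" if "g \<in> borel_measurable borel" "\<forall>x. \<bar>g x\<bar> \<le> B" for g :: "real \<Rightarrow> real" and B
  proof (rule Bochner_Integration.integrable_bound[of _ "\<lambda>x. B * u x"])
    have [measurable_cong]: "sets R = sets borel" by fact
    have [measurable]: "g \<in> borel_measurable borel" "u \<in> borel_measurable R" using that assms by auto
    show "(\<lambda>x. g x * u x) \<in> borel_measurable R" by measurable
    show "AE x in R. norm (g x * u x) \<le> norm (B * u x)"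
    proof (rule AE_I2)
      fix x have "\<bar>g x\<bar> \<le> \<bar>B\<bar>" using that(2)[rule_format, of x] by linarith
      then show "norm (g x * u x) \<le> norm (B * u x)" by (simp add: abs_mult mult_right_mono)
    qed
  qed (use assms in auto)
  obtain B B' where "\<forall>x. \<bar>f x\<bar> \<le> B" "\<forall>x. \<bar>deriv f x\<bar> \<le> B'" using test_function_bounded[OF assms(1)] by auto
  then show "integrable R (\<lambda>x. f x * u x)" "integrable R (\<lambda>x. deriv f x * u x)"
    using * test_function_measurable[OF assms(1)] by blast+
qed

text \<open>The fundamental lemma of the calculus of variations for a general sigma-finite Borel
  measure. Bumps converge boundedly to the indicator of \<open>{c<..<b}\<close>, so the positive and
  the negative part of \<open>u\<close> have equal mass on every half-line. Finite measures that
  agree on half-lines coincide, and densities are unique almost everywhere.\<close>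

lemma AE_eq_0_if_test_function_integral_0:
  fixes u :: "real \<Rightarrow> real"
  assumes R: "sigma_finite_measure R" "sets R = sets borel" and u: "integrable R u"
    and off: "\<And>x. x \<notin> {a<..<b} \<Longrightarrow> u x = 0"
    and zero: "\<And>f. test_function a b f \<Longrightarrow> (\<integral>x. f x * u x \<partial>R) = 0"
  shows "AE x in R. u x = 0"
proof -
  interpret sigma_finite_measure R by fact
  have [measurable_cong]: "sets R = sets borel" by fact
  have [measurable]: "u \<in> borel_measurable R" using u by auto
  have I: "(\<integral>x. indicator {c<..<b} x * u x \<partial>R) = 0" if "a \<le> c" "c < b" for c
  proof -
    define f where "f n = bump (c + 1 / Suc n) (b - 1 / Suc n) (real n)" for n
    have f: "test_function a b (f n)" for n
    proof -
      have "0 < 1 / real (Suc n)" by simp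
      then show ?thesis unfolding f_def using that by (intro test_function_bump) linarith+
    qed
    have [measurable]: "f n \<in> borel_measurable borel" for n using test_function_measurable[OF f] by auto
    have "(\<lambda>n. (\<integral>x. f n x * u x \<partial>R)) \<longlonglongrightarrow> (\<integral>x. indicator {c<..<b} x * u x \<partial>R)"
    proof (rule integral_dominated_convergence[where w="\<lambda>x. \<bar>u x\<bar>"])
      show "AE x in R. (\<lambda>n. f n x * u x) \<longlonglongrightarrow> indicator {c<..<b} x * u x"
        using bump_tendsto_indicator[OF that(2)] unfolding f_def by (auto intro!: tendsto_mult)
      show "AE x in R. norm (f n x * u x) \<le> \<bar>u x\<bar>" for n
        using bump_range[of "real n"] unfolding f_def by (auto simp: abs_mult mult_left_le_one_le)
    qed (use u in auto)
    then show ?thesis using zero[OF f] by (simp add: LIMSEQ_const_iff)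
  qed
  have I': "(\<integral>x. indicator {c<..} x * u x \<partial>R) = 0" for c
  proof (cases "max a c < b")
    case True
    have "(\<integral>x. indicator {c<..} x * u x \<partial>R) = (\<integral>x. indicator {max a c<..<b} x * u x \<partial>R)"
      using off by (intro Bochner_Integration.integral_cong) (auto simp: indicator_def)
    then show ?thesis using I[of "max a c"] True by simp
  next
    case False
    then have "(\<integral>x. indicator {c<..} x * u x \<partial>R) = (\<integral>x. 0 \<partial>R)"
      using off by (intro Bochner_Integration.integral_cong) (auto simp: indicator_def)
    then show ?thesis by simp
  qed
  define p n where "p x = max 0 (u x)" and "n x = max 0 (- u x)" for x
  have pn: "integrable R p" "integrable R n" unfolding p_def n_def using u by auto
  have [measurable]: "p \<in> borel_measurable R" "n \<in> borel_measurable R" using pn by auto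
  have pn0: "0 \<le> p x" "0 \<le> n x" "u x = p x - n x" for x by (auto simp: p_def n_def)
  have em: "emeasure (density R (\<lambda>x. ennreal (g x))) A = ennreal (\<integral>x. indicator A x * g x \<partial>R)"
    if "integrable R g" "\<And>x. 0 \<le> g x" "A \<in> sets borel" for g A
  proof -
    have [measurable]: "A \<in> sets R" using that R by simp
    have [measurable]: "g \<in> borel_measurable R" using that by auto
    have "emeasure (density R (\<lambda>x. ennreal (g x))) A = (\<integral>\<^sup>+x. ennreal (indicator A x * g x) \<partial>R)"
      by (subst emeasure_density) (auto intro!: nn_integral_cong split: split_indicator)
    also have "\<dots> = ennreal (\<integral>x. indicator A x * g x \<partial>R)"
      by (rule nn_integral_eq_integral)
        (use that integrable_real_mult_indicator[of A R g] in \<open>auto simp: mult.commute\<close>)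
    finally show ?thesis .
  qed
  have "density R (\<lambda>x. ennreal (p x)) = density R (\<lambda>x. ennreal (n x))"
  proof (rule measure_eqI_lessThan)
    fix c :: real
    have 1: "integrable R (\<lambda>x. indicator {c<..} x * g x)" if "integrable R g" for g :: "real \<Rightarrow> real"
      using integrable_real_mult_indicator[OF _ that, of "{c<..}"] by (simp add: mult.commute)
    have "(\<integral>x. indicator {c<..} x * p x \<partial>R) - (\<integral>x. indicator {c<..} x * n x \<partial>R) = 0"
      using I'[of c] 1[OF pn(1)] 1[OF pn(2)] by (simp add: pn0(3) right_diff_distrib)
    then show "emeasure (density R (\<lambda>x. ennreal (p x))) {c<..} = emeasure (density R (\<lambda>x. ennreal (n x))) {c<..}"
      using em[OF pn(1)] em[OF pn(2)] pn0 by simp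
    show "emeasure (density R (\<lambda>x. ennreal (p x))) {c<..} < \<infinity>"
      using em[OF pn(1)] pn0 by simp
  qed (use R in auto)
  then have "AE x in R. ennreal (p x) = ennreal (n x)"
    by (subst (asm) density_unique_iff) auto
  then show ?thesis
    by (rule AE_mp) (rule AE_I2, use pn0 in \<open>auto\<close>)
qed

section \<open>Primitives of signed measures and their distributional derivatives\<close>

lemma (in pair_sigma_finite) integrable_product:
  fixes f g :: "_ \<Rightarrow> real"
  assumes f: "integrable M1 f" and g: "integrable M2 g"
  shows "integrable (M1 \<Otimes>\<^sub>M M2) (\<lambda>(x, y). f x * g y)"
proof (rule Fubini_integrable)
  have [measurable]: "f \<in> borel_measurable M1" "g \<in> borel_measurable M2" using f g by auto
  show "(\<lambda>(x, y). f x * g y) \<in> borel_measurable (M1 \<Otimes>\<^sub>M M2)" by measurable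
qed (use f g in \<open>simp_all add: abs_mult\<close>)

text \<open>\<open>F\<close> is the distribution function of the signed measure with density
  \<open>u\<close>. Exchanging the integrals leaves, for each \<open>y\<close>, the integral of
  \<open>deriv f\<close> over \<open>{y..b}\<close>, which is \<open>- f y\<close> because
  \<open>f b = 0\<close>.\<close>

lemma integral_primitive_deriv_test_function:
  fixes u :: "real \<Rightarrow> real"
  assumes R: "sigma_finite_measure R" "sets R = sets borel" and u: "integrable R u"
    and off: "\<And>x. x \<notin> {a<..<b} \<Longrightarrow> u x = 0" and f: "test_function a b f"
  defines "F \<equiv> \<lambda>x. \<integral>y. indicator {..x} y * u y \<partial>R"
  shows "set_integrable lborel {a<..<b} F"
    "(LBINT x:{a<..<b}. F x * deriv f x) = - (\<integral>x. f x * u x \<partial>R)"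
proof -
  interpret R: sigma_finite_measure R by fact
  interpret pair_sigma_finite lborel R ..
  note [measurable_cong] = R(2)
  have [measurable]: "u \<in> borel_measurable R" using u by auto
  note test_function_measurable[OF f, measurable]
  \<comment> \<open>The bounded factor \<open>g\<close> is kept general: \<open>1\<close> yields the
    integrability of \<open>F\<close>, and \<open>deriv f\<close> justifies the exchange of
    integrals.\<close>
  have *: "integrable (lborel \<Otimes>\<^sub>M R) (\<lambda>(x, y). indicator {a<..<b} x * (g x * (indicator {..x} y * u y)))"
    if [measurable]: "g \<in> borel_measurable borel" and B: "\<And>x. \<bar>g x\<bar> \<le> B" for g B
  proof (rule Bochner_Integration.integrable_bound)
    have "integrable lborel (\<lambda>x. indicator {a<..<b} x * B)"
      by (intro integrable_mult_left integrable_real_indicator) (cases "a \<le> b"; simp)+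
    then show "integrable (lborel \<Otimes>\<^sub>M R) (\<lambda>(x, y). indicator {a<..<b} x * B * u y)"
      by (rule integrable_product[OF _ u])
    have "(\<lambda>z::real \<times> real. indicator {..fst z} (snd z) :: real) = indicator {z. snd z \<le> fst z}"
      by (auto simp: indicator_def)
    moreover have "{z::real \<times> real. snd z \<le> fst z} \<in> sets (borel \<Otimes>\<^sub>M borel)"
      unfolding borel_prod by (intro borel_closed closed_Collect_le continuous_intros)
    ultimately have [measurable]: "(\<lambda>z::real \<times> real. indicator {..fst z} (snd z) :: real) \<in> borel_measurable (borel \<Otimes>\<^sub>M borel)"
      by simp
    show "(\<lambda>(x, y). indicator {a<..<b} x * (g x * (indicator {..x} y * u y))) \<in> borel_measurable (lborel \<Otimes>\<^sub>M R)"
      unfolding case_prod_beta by measurable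
    have "\<bar>g x\<bar> \<le> \<bar>B\<bar>" for x using B[of x] by linarith
    then show "AE z in lborel \<Otimes>\<^sub>M R. norm (case z of (x, y) \<Rightarrow> indicator {a<..<b} x * (g x * (indicator {..x} y * u y)))
        \<le> norm (case z of (x, y) \<Rightarrow> indicator {a<..<b} x * B * u y)"
      by (auto simp: indicator_def abs_mult intro!: AE_I2 mult_right_mono)
  qed
  have "integrable lborel (\<lambda>x. \<integral>y. indicator {a<..<b} x * (1 * (indicator {..x} y * u y)) \<partial>R)"
    using integrable_fst'[OF *[of "\<lambda>_. 1" 1]] by simp
  then show "set_integrable lborel {a<..<b} F" by (simp add: F_def set_integrable_def)
  obtain B where B: "\<And>x. \<bar>deriv f x\<bar> \<le> B" using test_function_bounded[OF f] by auto
  have "(LBINT x:{a<..<b}. F x * deriv f x) =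
      (\<integral>x. (\<integral>y. indicator {a<..<b} x * (deriv f x * (indicator {..x} y * u y)) \<partial>R) \<partial>lborel)"
    unfolding F_def set_lebesgue_integral_def
    by (intro Bochner_Integration.integral_cong refl) (simp add: mult.commute)
  also have "\<dots> = (\<integral>y. (\<integral>x. indicator {a<..<b} x * (deriv f x * (indicator {..x} y * u y)) \<partial>lborel) \<partial>R)"
    by (rule Fubini_integral[symmetric, OF *]) (use B in auto)
  also have "\<dots> = (\<integral>y. - (f y * u y) \<partial>R)"
  proof (rule Bochner_Integration.integral_cong[OF refl])
    fix y
    show "(\<integral>x. indicator {a<..<b} x * (deriv f x * (indicator {..x} y * u y)) \<partial>lborel) = - (f y * u y)"
    proof (cases "y \<in> {a<..<b}")
      case False then show ?thesis using off by simp
    next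
      case True
      have "(\<integral>x. indicator {a<..<b} x * (deriv f x * (indicator {..x} y * u y)) \<partial>lborel)
        = (\<integral>x. (deriv f x * indicator {y..b} x) * u y \<partial>lborel)"
        using True test_function_facts(5)[OF f, of b]
        by (intro Bochner_Integration.integral_cong) (auto simp: indicator_def)
      also have "\<dots> = (\<integral>x. deriv f x * indicator {y..b} x \<partial>lborel) * u y" by simp
      also have "(\<integral>x. deriv f x * indicator {y..b} x \<partial>lborel) = f b - f y"
        using True test_function_facts(1,2)[OF f]
        by (intro integral_FTC_Icc_real) (auto simp: continuous_on_eq_continuous_at)
      finally show ?thesis using test_function_facts(4)[OF f, of b] by simp
    qed
  qed
  finally show "(LBINT x:{a<..<b}. F x * deriv f x) = - (\<integral>x. f x * u x \<partial>R)" by simp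
qed

section \<open>Primitives and traces\<close>

lemma AE_lborel_interval_witness:
  assumes "AE x in lborel. P x" "c < (d::real)" shows "\<exists>x. c < x \<and> x < d \<and> P x"
proof (rule ccontr)
  assume "\<not> ?thesis"
  then have *: "\<And>x. P x \<Longrightarrow> x \<notin> {c<..<d}" by auto
  from assms(1) have "AE x in lborel. x \<notin> {c<..<d}" by (rule AE_mp) (use * in \<open>auto intro!: AE_I2\<close>)
  then have "emeasure lborel {c<..<d} = 0" by (subst (asm) AE_iff_measurable[of "{c<..<d}"]) auto
  then show False using assms(2) by simp
qed

lemma test_function_support:
  assumes "test_function a b f" "a < b"
  obtains p q where "a < p" "q < b" "\<And>x. x \<notin> {p..q} \<Longrightarrow> f x = 0"
proof (cases "{x. f x \<noteq> 0} = {}")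
  case True
  then show ?thesis using that[of "(a+b)/2" "(a+b)/2"] assms by auto
next
  case False
  define S where "S = closure {x. f x \<noteq> 0}"
  have S: "S \<subseteq> {a<..<b}" "S \<noteq> {}" using assms False by (auto simp: test_function_def S_def)
  have "S \<subseteq> {a..b}" using S(1) by auto
  then have "bounded S" by (rule bounded_subset[OF bounded_closed_interval])
  then have "compact S" by (simp add: S_def compact_eq_bounded_closed)
  from compact_attains_inf[OF this S(2)] compact_attains_sup[OF this S(2)]
  obtain p q where pq: "p \<in> S" "q \<in> S" "\<And>x. x \<in> S \<Longrightarrow> p \<le> x" "\<And>x. x \<in> S \<Longrightarrow> x \<le> q"
    by metis
  have "f x = 0" if "x \<notin> {p..q}" for x
    using that pq(3,4)[of x] closure_subset[of "{x. f x \<noteq> 0}"] unfolding S_def by auto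
  then show ?thesis using that[of p q] pq(1,2) S(1) by (meson greaterThanLessThan_iff subsetD)
qed

lemma continuous_on_UNIV_antiderivative:
  fixes g :: "real \<Rightarrow> real"
  assumes "continuous_on UNIV g"
  obtains F where "\<And>x. (F has_real_derivative g x) (at x)"
  using einterval_antiderivative[of "-\<infinity>" \<infinity> g] assms
  by (auto simp: continuous_on_eq_continuous_at has_real_derivative_iff_has_vector_derivative)

text \<open>The primitive that vanishes at \<open>a\<close> is constant on both sides of the
  support. The constant on the right is the total integral, so its vanishing is what keeps the
  support compact.\<close>

lemma test_function_primitive:
  assumes \<phi>: "test_function a b \<phi>" and ab: "a < b" and 0: "(LBINT x. \<phi> x) = 0"
  obtains f where "test_function a b f" "deriv f = \<phi>"
proof -
  obtain p q where pq: "a < p" "q < b" "\<And>x. x \<notin> {p..q} \<Longrightarrow> \<phi> x = 0"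
    using test_function_support[OF \<phi> ab] by blast
  note c = test_function_facts(3)[OF \<phi>]
  obtain F where F: "\<And>x. (F has_real_derivative \<phi> x) (at x)"
    using continuous_on_UNIV_antiderivative[OF c] by blast
  have FTC: "F y - F x = (LBINT t. \<phi> t * indicator {x..y} t)" if "x \<le> y" for x y
    using F that c by (intro integral_FTC_Icc_real[symmetric]) (auto simp: continuous_on_eq_continuous_at)
  define f where "f x = F x - F a" for x
  have f': "(f has_real_derivative \<phi> x) (at x)" for x
    unfolding f_def by (rule derivative_eq_intros F refl | simp)+
  have C1: "f C1_differentiable_on UNIV" by (rule C1_differentiable_on_I[OF f' c])
  have zero: "f x = 0" if "x \<notin> {p..q}" for x
  proof -
    consider "x < p" | "q < x" "p \<le> x" using \<open>x \<notin> {p..q}\<close> by force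
    then show ?thesis
    proof cases
      case 1
      have "(LBINT t. \<phi> t * indicator {x..a} t) = 0" "(LBINT t. \<phi> t * indicator {a..x} t) = 0"
        using pq 1 by (auto intro!: integral_eq_zero_AE AE_I2 simp: indicator_def)
      then show ?thesis using FTC[of x a] FTC[of a x] by (cases "x \<le> a") (auto simp: f_def)
    next
      case 2
      have "(LBINT t. \<phi> t * indicator {a..x} t) = (LBINT t. \<phi> t)"
      proof (intro Bochner_Integration.integral_cong refl)
        fix t show "\<phi> t * indicator {a..x} t = \<phi> t"
          using pq 2 by (cases "t \<in> {p..q}") (auto simp: indicator_def)
      qed
      then show ?thesis using FTC[of a x] 2 pq 0 by (auto simp: f_def)
    qed
  qed
  have "test_function a b f" by (rule test_function_I[OF C1 zero pq(1,2)])
  moreover have "deriv f = \<phi>" using DERIV_imp_deriv[OF f'] by auto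
  ultimately show ?thesis using that by blast
qed

lemma test_function_integrable:
  assumes "test_function a b f" "a < b" shows "integrable lborel f"
proof -
  have "set_integrable lborel {a..b} f"
    by (intro borel_integrable_atLeastAtMost' continuous_on_subset[OF test_function_facts(3)[OF assms(1)]]) auto
  moreover have "(\<lambda>x. indicator {a..b} x *\<^sub>R f x) = f"
  proof
    fix x show "indicator {a..b} x *\<^sub>R f x = f x"
      using test_function_facts(4)[OF assms(1), of x] by (cases "x \<in> {a<..<b}") (auto simp: indicator_def)
  qed
  ultimately show ?thesis by (simp add: set_integrable_def)
qed

text \<open>The du Bois-Reymond lemma. Every test function becomes a derivative of a test function
  after subtracting a multiple of one fixed bump \<open>\<psi>\<close>; hence \<open>h\<close> minus
  a suitable constant is orthogonal to all test functions.\<close>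

lemma AE_const_if_deriv_test_function_integral_0:
  fixes h :: "real \<Rightarrow> real"
  assumes ab: "a < b" and h: "set_integrable lborel {a<..<b} h"
    and zero: "\<And>f. test_function a b f \<Longrightarrow> (LBINT x:{a<..<b}. h x * deriv f x) = 0"
  shows "\<exists>C. AE x in lborel. x \<in> {a<..<b} \<longrightarrow> h x = C"
proof -
  define h0 where "h0 x = indicator {a<..<b} x * h x" for x
  have h0: "integrable lborel h0" using h by (simp add: set_integrable_def h0_def[abs_def])
  define \<psi> where "\<psi> = bump (a + (b-a)/3) (b - (b-a)/3) 1"
  have \<psi>: "test_function a b \<psi>" unfolding \<psi>_def using ab by (intro test_function_bump) auto
  note \<psi>i = test_function_integrable[OF \<psi> ab]
  define K where "K = (LBINT x. \<psi> x)"
  have "K \<noteq> 0"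
  proof
    assume "K = 0"
    then have "AE x in lborel. \<psi> x = 0"
      using integral_nonneg_eq_0_iff_AE[OF \<psi>i] bump_range[of 1] by (auto simp: K_def \<psi>_def)
    moreover have "a + (b-a)/3 < b - (b-a)/3" using ab by (simp add: field_simps)
    ultimately obtain x where "a + (b-a)/3 < x" "x < b - (b-a)/3" "\<psi> x = 0"
      using AE_lborel_interval_witness by blast
    then show False using bump_pos[of x _ _ 1] unfolding \<psi>_def by force
  qed
  \<comment> \<open>The mean of \<open>h\<close> with weight \<open>\<psi>\<close>, the only
    constant for which \<open>h - C\<close> is orthogonal to \<open>\<psi>\<close>.\<close>
  define C where "C = (LBINT x. \<psi> x * h0 x) / K"
  define u where "u x = indicator {a<..<b} x * (h x - C)" for x
  have ui: "integrable lborel u"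
    using h0 ab Bochner_Integration.integrable_diff[of lborel h0 "\<lambda>x. indicator {a<..<b} x * C"] unfolding u_def h0_def
    by (simp add: right_diff_distrib)
  have "AE x in lborel. u x = 0"
  proof (rule AE_eq_0_if_test_function_integral_0[where a=a and b=b])
    fix \<phi> assume \<phi>: "test_function a b \<phi>"
    note \<phi>i = test_function_integrable[OF \<phi> ab]
    \<comment> \<open>This multiple of \<open>\<psi>\<close> has the same integral as
      \<open>\<phi>\<close>, so that \<open>g\<close> has integral zero.\<close>
    define k where "k = (LBINT x. \<phi> x) / K"
    define g where "g x = \<phi> x - k * \<psi> x" for x
    have g: "test_function a b g"
    proof -
      obtain p q where 1: "a < p" "q < b" "\<And>x. x \<notin> {p..q} \<Longrightarrow> \<phi> x = 0"
        using test_function_support[OF \<phi> ab] by blast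
      obtain p' q' where 2: "a < p'" "q' < b" "\<And>x. x \<notin> {p'..q'} \<Longrightarrow> \<psi> x = 0"
        using test_function_support[OF \<psi> ab] by blast
      show ?thesis
      proof (rule test_function_I[where p="min p p'" and q="max q q'"])
        show "g C1_differentiable_on UNIV" unfolding g_def
          using \<phi> \<psi> by (intro C1_differentiable_on_diff C1_differentiable_on_mult C1_differentiable_on_const)
             (auto simp: test_function_def)
        show "g x = 0" if "x \<notin> {min p p'..max q q'}" for x
        proof -
          have "x \<notin> {p..q}" "x \<notin> {p'..q'}" using that by auto
          then show ?thesis using 1(3) 2(3) by (simp add: g_def)
        qed
      qed (use 1 2 in auto)
    qed
    have "(LBINT x. g x) = 0" using \<open>K \<noteq> 0\<close> \<phi>i \<psi>i by (simp add: g_def k_def K_def)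
    then obtain f where f: "test_function a b f" "deriv f = g"
      using test_function_primitive[OF g ab] by blast
    have 1: "integrable lborel (\<lambda>x. \<phi> x * h0 x)" "integrable lborel (\<lambda>x. \<psi> x * h0 x)"
      using integrable_mult_test_function(1)[OF _ h0] \<phi> \<psi> by auto
    have "0 = (LBINT x. g x * h0 x)"
      using zero[OF f(1)] by (simp add: f(2) set_lebesgue_integral_def h0_def mult_ac)
    also have "\<dots> = (LBINT x. \<phi> x * h0 x) - k * (LBINT x. \<psi> x * h0 x)"
      using 1 by (simp add: g_def left_diff_distrib mult.assoc)
    also have "k * (LBINT x. \<psi> x * h0 x) = (LBINT x. \<phi> x * C)"
      using \<open>K \<noteq> 0\<close> \<phi>i by (simp add: k_def C_def)
    also have "(LBINT x. \<phi> x * h0 x) - (LBINT x. \<phi> x * C) = (LBINT x. \<phi> x * h0 x - \<phi> x * C)"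
      using 1 \<phi>i by simp
    also have "\<dots> = (LBINT x. \<phi> x * u x)"
      using test_function_facts(4)[OF \<phi>]
      by (intro Bochner_Integration.integral_cong) (auto simp: u_def h0_def indicator_def algebra_simps)
    finally show "(LBINT x. \<phi> x * u x) = 0" by simp
  next
    show "integrable lborel u" by (rule ui)
    show "u x = 0" if "x \<notin> {a<..<b}" for x using that by (simp add: u_def)
  qed (simp_all add: lborel.sigma_finite_measure_axioms)
  then have "AE x in lborel. x \<in> {a<..<b} \<longrightarrow> h x = C"
    by (rule AE_mp) (rule AE_I2, auto simp: u_def)
  then show ?thesis by blast
qed

text \<open>The whole derivative of \<open>w\<close> as one signed density with respect to an
  arbitrary measure, so that absolutely continuous and singular parts are treated as a single
  function. The condition outside the interval holds everywhere, which keeps atoms away from the end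
  points.\<close>

definition deriv_density :: "real \<Rightarrow> real \<Rightarrow> (real \<Rightarrow> real) \<Rightarrow> real measure \<Rightarrow> (real \<Rightarrow> real) \<Rightarrow> bool" where
  "deriv_density a b w R u \<longleftrightarrow> sigma_finite_measure R \<and> sets R = sets borel \<and> integrable R u \<and>
     (\<forall>x. x \<notin> {a<..<b} \<longrightarrow> u x = 0) \<and>
     (\<forall>f. test_function a b f \<longrightarrow> (LBINT x:{a<..<b}. w x * deriv f x) = - (\<integral>x. f x * u x \<partial>R))"

text \<open>Dominated convergence: at each point the cut-off indicator is eventually constant,
  except at the end points, where \<open>u\<close> vanishes.\<close>

lemma primitive_tendsto:
  fixes u :: "real \<Rightarrow> real"
  assumes R: "sets R = sets borel" and u: "integrable R u"
    and off: "\<And>x. x \<notin> {a<..<b} \<Longrightarrow> u x = 0" and ab: "a < b"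
  defines "F \<equiv> \<lambda>x. \<integral>y. indicator {..x} y * u y \<partial>R"
  shows "(F \<longlongrightarrow> 0) (at_right a)" "(F \<longlongrightarrow> (\<integral>x. u x \<partial>R)) (at_left b)"
proof -
  note [measurable_cong] = R
  have [measurable]: "u \<in> borel_measurable R" using u by auto
  have b: "AE y in R. norm (indicator {..x} y * u y) \<le> \<bar>u y\<bar>" for x
    by (auto split: split_indicator)
  show "(F \<longlongrightarrow> 0) (at_right a)"
  proof (rule tendsto_at_right_sequentially[OF ab])
    fix S :: "nat \<Rightarrow> real" assume S: "\<And>n. a < S n" "S \<longlonglongrightarrow> a"
    have "(\<lambda>n. F (S n)) \<longlonglongrightarrow> (\<integral>y. 0 \<partial>R)" unfolding F_def
    proof (rule integral_dominated_convergence[where w="\<lambda>x. \<bar>u x\<bar>"])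
      show "AE y in R. (\<lambda>n. indicator {..S n} y * u y) \<longlonglongrightarrow> 0"
      proof (rule AE_I2)
        fix y show "(\<lambda>n. indicator {..S n} y * u y) \<longlonglongrightarrow> 0"
        proof (cases "a < y")
          case True
          then have "\<forall>\<^sub>F n in sequentially. S n < y" using S(2) by (simp add: order_tendstoD(2))
          then show ?thesis by (intro tendsto_eventually) (auto elim!: eventually_mono)
        qed (use off in auto)
      qed
    qed (use u b in auto)
    then show "(\<lambda>n. F (S n)) \<longlonglongrightarrow> 0" by simp
  qed
  show "(F \<longlongrightarrow> (\<integral>x. u x \<partial>R)) (at_left b)"
  proof (rule tendsto_at_left_sequentially[OF ab])
    fix S :: "nat \<Rightarrow> real" assume S: "\<And>n. S n < b" "S \<longlonglongrightarrow> b"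
    show "(\<lambda>n. F (S n)) \<longlonglongrightarrow> (\<integral>x. u x \<partial>R)" unfolding F_def
    proof (rule integral_dominated_convergence[where w="\<lambda>x. \<bar>u x\<bar>"])
      show "AE y in R. (\<lambda>n. indicator {..S n} y * u y) \<longlonglongrightarrow> u y"
      proof (rule AE_I2)
        fix y show "(\<lambda>n. indicator {..S n} y * u y) \<longlonglongrightarrow> u y"
        proof (cases "y < b")
          case True
          then have "\<forall>\<^sub>F n in sequentially. y < S n" using S(2) by (simp add: order_tendstoD(1))
          then have "\<forall>\<^sub>F n in sequentially. indicator {..S n} y * u y = u y" by (rule eventually_mono) simp
          then show ?thesis by (rule tendsto_eventually)
        qed (use off in auto)
      qed
    qed (use u b in auto)
  qed
qed

text \<open>\<open>J d\<close> is a one-sided neighbourhood of size \<open>d\<close>, on either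
  side, so that one argument serves both traces. Two essential limits agree because two
  almost-everywhere statements share a point of any interval inside the smaller
  neighbourhood.\<close>

lemma essential_limit_eq:
  fixes J :: "real \<Rightarrow> real set" and F w :: "real \<Rightarrow> real"
  assumes mono: "\<And>d d'. d \<le> d' \<Longrightarrow> J d \<subseteq> J d'" and ne: "\<And>d. 0 < d \<Longrightarrow> \<exists>p q. p < q \<and> {p<..<q} \<subseteq> J d"
    and lim: "\<And>e. 0 < e \<Longrightarrow> \<exists>d>0. \<forall>x\<in>J d. \<bar>F x - c\<bar> < e"
    and w: "AE x in lborel. x \<in> J d0 \<longrightarrow> w x = F x" "0 < d0"
  shows "(THE c. \<forall>e>0. \<exists>d>0. AE x in lborel. x \<in> J d \<longrightarrow> \<bar>w x - c\<bar> < e) = c"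
proof (rule the_equality)
  show c: "\<forall>e>0. \<exists>d>0. AE x in lborel. x \<in> J d \<longrightarrow> \<bar>w x - c\<bar> < e"
  proof (intro allI impI)
    fix e :: real assume "0 < e"
    then obtain d where d: "0 < d" "\<forall>x\<in>J d. \<bar>F x - c\<bar> < e" using lim by blast
    have sub: "J (min d d0) \<subseteq> J d" "J (min d d0) \<subseteq> J d0" using mono by auto
    from w(1) have "AE x in lborel. x \<in> J (min d d0) \<longrightarrow> \<bar>w x - c\<bar> < e"
      by eventually_elim (use d sub in auto)
    then show "\<exists>d>0. AE x in lborel. x \<in> J d \<longrightarrow> \<bar>w x - c\<bar> < e" using d(1) w(2) by (intro exI[of _ "min d d0"]) auto
  qed
  fix c' assume c': "\<forall>e>0. \<exists>d>0. AE x in lborel. x \<in> J d \<longrightarrow> \<bar>w x - c'\<bar> < e"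
  show "c' = c"
  proof (rule ccontr)
    assume "c' \<noteq> c"
    then have e: "0 < \<bar>c' - c\<bar> / 2" by simp
    obtain d where d: "d > 0" "AE x in lborel. x \<in> J d \<longrightarrow> \<bar>w x - c\<bar> < \<bar>c' - c\<bar> / 2"
      using c e by blast
    obtain d' where d': "d' > 0" "AE x in lborel. x \<in> J d' \<longrightarrow> \<bar>w x - c'\<bar> < \<bar>c' - c\<bar> / 2"
      using c' e by blast
    obtain p q where pq: "p < q" "{p<..<q} \<subseteq> J (min d d')" using ne[of "min d d'"] d(1) d'(1) by auto
    have sub: "J (min d d') \<subseteq> J d" "J (min d d') \<subseteq> J d'" using mono by auto
    from d(2) d'(2) have "AE x in lborel. x \<in> {p<..<q} \<longrightarrow> \<bar>w x - c\<bar> < \<bar>c' - c\<bar> / 2 \<and> \<bar>w x - c'\<bar> < \<bar>c' - c\<bar> / 2"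
      by eventually_elim (use pq(2) sub in blast)
    from AE_lborel_interval_witness[OF this pq(1)]
    show False by (auto simp: abs_if split: if_splits)
  qed
qed

lemma right_trace_eq:
  assumes "(F \<longlongrightarrow> c) (at_right a)" "AE x in lborel. x \<in> {a<..<b} \<longrightarrow> w x = F x" "a < b"
  shows "right_trace w a = c"
proof -
  have "\<exists>d>0. \<forall>x\<in>{a<..<a + d}. \<bar>F x - c\<bar> < e" if "0 < e" for e
  proof -
    have "\<forall>\<^sub>F x in at_right a. \<bar>F x - c\<bar> < e" using assms(1) that by (auto simp: tendsto_iff dist_real_def)
    then obtain d where "d > a" "\<And>x. a < x \<Longrightarrow> x < d \<Longrightarrow> \<bar>F x - c\<bar> < e" by (auto simp: eventually_at_right_field)
    then show ?thesis by (intro exI[of _ "d - a"]) auto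
  qed
  moreover have "\<exists>p q. p < q \<and> {p<..<q} \<subseteq> {a<..<a + d}" if "0 < d" for d
    using that by (intro exI[of _ a] exI[of _ "a + d"]) simp
  ultimately have "(THE c. \<forall>e>0. \<exists>d>0. AE x in lborel. x \<in> {a<..<a + d} \<longrightarrow> \<bar>w x - c\<bar> < e) = c"
    using assms(2,3) by (intro essential_limit_eq[where F=F and ?d0.0="b - a"]) auto
  then show ?thesis by (simp add: right_trace_def)
qed

lemma left_trace_eq:
  assumes "(F \<longlongrightarrow> c) (at_left b)" "AE x in lborel. x \<in> {a<..<b} \<longrightarrow> w x = F x" "a < b"
  shows "left_trace w b = c"
proof -
  have "\<exists>d>0. \<forall>x\<in>{b - d<..<b}. \<bar>F x - c\<bar> < e" if "0 < e" for e
  proof -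
    have "\<forall>\<^sub>F x in at_left b. \<bar>F x - c\<bar> < e" using assms(1) that by (auto simp: tendsto_iff dist_real_def)
    then obtain d where "d < b" "\<And>x. d < x \<Longrightarrow> x < b \<Longrightarrow> \<bar>F x - c\<bar> < e" by (auto simp: eventually_at_left_field)
    then show ?thesis by (intro exI[of _ "b - d"]) auto
  qed
  moreover have "\<exists>p q. p < q \<and> {p<..<q} \<subseteq> {b - d<..<b}" if "0 < d" for d
    using that by (intro exI[of _ "b - d"] exI[of _ b]) simp
  ultimately have "(THE c. \<forall>e>0. \<exists>d>0. AE x in lborel. x \<in> {b - d<..<b} \<longrightarrow> \<bar>w x - c\<bar> < e) = c"
    using assms(2,3) by (intro essential_limit_eq[where F=F and ?d0.0="b - a"]) auto
  then show ?thesis by (simp add: left_trace_def)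
qed

text \<open>The function \<open>w\<close> and the primitive \<open>F\<close> of its derivative
  differ by a constant, which cancels in the difference of the traces; those of \<open>F\<close> are
  \<open>0\<close> and the total mass.\<close>

lemma deriv_density_traces:
  assumes ab: "a < b" and w: "w \<in> L1_on a b" and D: "deriv_density a b w R u"
  shows "left_trace w b - right_trace w a = (\<integral>x. u x \<partial>R)"
proof -
  define F where "F x = (\<integral>y. indicator {..x} y * u y \<partial>R)" for x
  have R: "sigma_finite_measure R" "sets R = sets borel" "integrable R u" 
    and off: "\<And>x. x \<notin> {a<..<b} \<Longrightarrow> u x = 0" using D by (auto simp: deriv_density_def)
  have "\<exists>C. AE x in lborel. x \<in> {a<..<b} \<longrightarrow> w x - F x = C"
  proof (rule AE_const_if_deriv_test_function_integral_0[OF ab])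
    have Fi: "set_integrable lborel {a<..<b} F"
      using integral_primitive_deriv_test_function(1)[OF R off test_function_bump[of 1 a "(a+b)/2" "(a+b)/2" b]] ab
      by (simp add: F_def[abs_def])
    have wi: "set_integrable lborel {a<..<b} w" using w by (simp add: L1_on_def)
    show "set_integrable lborel {a<..<b} (\<lambda>x. w x - F x)" by (rule set_integral_diff(1)[OF wi Fi])
    fix f assume f: "test_function a b f"
    have *: "set_integrable lborel {a<..<b} (\<lambda>x. g x * deriv f x)" if "set_integrable lborel {a<..<b} g" for g
      using integrable_mult_test_function(2)[OF f that[unfolded set_integrable_def]]
      by (simp add: set_integrable_def mult_ac)
    have "(LBINT x:{a<..<b}. (w x - F x) * deriv f x) = (LBINT x:{a<..<b}. w x * deriv f x) - (LBINT x:{a<..<b}. F x * deriv f x)"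
      unfolding left_diff_distrib by (rule set_integral_diff(2)[OF *[OF wi] *[OF Fi]])
    then show "(LBINT x:{a<..<b}. (w x - F x) * deriv f x) = 0"
      using D f integral_primitive_deriv_test_function(2)[OF R off f] by (simp add: deriv_density_def F_def)
  qed
  then obtain C where "AE x in lborel. x \<in> {a<..<b} \<longrightarrow> w x - F x = C" by blast
  then have w: "AE x in lborel. x \<in> {a<..<b} \<longrightarrow> w x = C + F x" by (rule AE_mp) (rule AE_I2, auto)
  have "((\<lambda>x. C + F x) \<longlongrightarrow> C + 0) (at_right a)" "((\<lambda>x. C + F x) \<longlongrightarrow> C + (\<integral>x. u x \<partial>R)) (at_left b)"
    unfolding F_def by (intro tendsto_add tendsto_const primitive_tendsto[OF R(2,3) off ab]; simp)+
  from right_trace_eq[OF this(1) w ab] left_trace_eq[OF this(2) w ab]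
  show ?thesis by simp
qed

section \<open>Decomposition of derivatives\<close>

definition add_measure :: "'a measure \<Rightarrow> 'a measure \<Rightarrow> 'a measure" where
  "add_measure M N = measure_of (space M) (sets M) (\<lambda>A. emeasure M A + emeasure N A)"

lemma space_add_measure [simp]: "space (add_measure M N) = space M"
  and sets_add_measure [simp]: "sets (add_measure M N) = sets M"
  by (simp_all add: add_measure_def sets.space_measure_of_eq sets.sets_measure_of_eq)

lemma emeasure_add_measure:
  assumes "sets N = sets M" "A \<in> sets M"
  shows "emeasure (add_measure M N) A = emeasure M A + emeasure N A"
  unfolding add_measure_def
proof (rule emeasure_measure_of_sigma)
  show "sigma_algebra (space M) (sets M)" by (rule sets.sigma_algebra_axioms)
  show "positive (sets M) (\<lambda>A. emeasure M A + emeasure N A)" by (simp add: positive_def)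
  show "countably_additive (sets M) (\<lambda>A. emeasure M A + emeasure N A)"
  proof (rule countably_additiveI)
    fix A :: "nat \<Rightarrow> 'a set" assume A: "range A \<subseteq> sets M" "disjoint_family A"
    show "(\<Sum>i. emeasure M (A i) + emeasure N (A i)) = emeasure M (\<Union>i. A i) + emeasure N (\<Union>i. A i)"
      using suminf_emeasure[OF A] suminf_emeasure[of A N] A assms(1)
      by (subst suminf_add[symmetric]) auto
  qed
qed fact

lemma sigma_finite_add_measure:
  assumes "finite_measure M" "sigma_finite_measure N" "sets N = sets M"
  shows "sigma_finite_measure (add_measure M N)"
proof -
  interpret M: finite_measure M by fact
  interpret N: sigma_finite_measure N by fact
  obtain A :: "nat \<Rightarrow> _ set" where A: "range A \<subseteq> sets N" "(\<Union>i. A i) = space N" "\<And>i. emeasure N (A i) \<noteq> \<infinity>"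
    by (rule N.sigma_finite) auto
  have "space N = space M" using sets_eq_imp_space_eq[OF assms(3)] .
  then show ?thesis
    using A assms(3) M.emeasure_finite
    by unfold_locales (auto intro!: exI[of _ "range A"] simp: emeasure_add_measure subset_iff)
qed

text \<open>Sigma-finiteness of \<open>M\<close> makes its Radon-Nikodym derivative finite almost
  everywhere, so a real function may replace it without changing the measure.\<close>

lemma real_Radon_Nikodym:
  assumes R: "sigma_finite_measure R" and M: "sigma_finite_measure M" "sets M = sets R" "absolutely_continuous R M"
  obtains h where "h \<in> borel_measurable R" "\<And>x. 0 \<le> (h x :: real)" "M = density R (\<lambda>x. ennreal (h x))"
proof -
  interpret R: sigma_finite_measure R by fact
  have d: "density R (RN_deriv R M) = M" by (rule R.density_RN_deriv[OF M(3,2)])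
  have "AE x in R. RN_deriv R M x \<noteq> \<infinity>" by (rule R.RN_deriv_finite[OF M(1,3,2)])
  then have "AE x in R. RN_deriv R M x = ennreal (enn2real (RN_deriv R M x))"
    by (rule AE_mp) (auto intro!: AE_I2 simp: less_top)
  then have "density R (RN_deriv R M) = density R (\<lambda>x. ennreal (enn2real (RN_deriv R M x)))"
    by (rule density_cong[rotated 2]) auto
  then show ?thesis using that[of "\<lambda>x. enn2real (RN_deriv R M x)"] d by auto
qed

definition has_real_density :: "real measure \<Rightarrow> real measure \<Rightarrow> (real \<Rightarrow> real) \<Rightarrow> bool" where
  "has_real_density R M h \<longleftrightarrow> h \<in> borel_measurable borel \<and> (\<forall>x. 0 \<le> h x) \<and> M = density R (\<lambda>x. ennreal (h x))"

text \<open>The sum of the given finite measures and \<open>lborel\<close> is sigma-finite and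
  dominates each summand. Including \<open>lborel\<close> matters: the zero set of its density will
  locate the singular parts.\<close>

lemma common_dominating_measure:
  fixes Ms :: "real measure list"
  assumes "\<And>M. M \<in> set Ms \<Longrightarrow> finite_measure M \<and> sets M = sets borel"
  obtains R where "sigma_finite_measure R" "sets R = sets borel" "\<exists>h. has_real_density R lborel h"
    "\<And>M. M \<in> set Ms \<Longrightarrow> \<exists>h. has_real_density R M h"
proof -
  define R where "R = foldr add_measure Ms lborel"
  have *: "sigma_finite_measure R \<and> sets R = sets borel \<and>
    (\<forall>M\<in>insert lborel (set Ms). \<forall>A\<in>sets borel. emeasure M A \<le> emeasure R A)"
    using assms unfolding R_def
  proof (induction Ms)
    case Nil then show ?case by (simp add: lborel.sigma_finite_measure_axioms)
  next
    case (Cons M Ms)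
    have IH: "sigma_finite_measure (foldr add_measure Ms lborel)" "sets (foldr add_measure Ms lborel) = sets borel"
       "\<And>M A. M \<in> insert lborel (set Ms) \<Longrightarrow> A \<in> sets borel \<Longrightarrow> emeasure M A \<le> emeasure (foldr add_measure Ms lborel) A"
      using Cons by auto
    have M: "finite_measure M" "sets M = sets borel" using Cons.prems by auto
    have e: "emeasure (foldr add_measure (M # Ms) lborel) A = emeasure M A + emeasure (foldr add_measure Ms lborel) A"
      if "A \<in> sets borel" for A
      using emeasure_add_measure[of "foldr add_measure Ms lborel" M A] IH(2) M that by simp
    have "sigma_finite_measure (foldr add_measure (M # Ms) lborel)"
      using sigma_finite_add_measure[OF M(1) IH(1)] IH(2) M by simp
    moreover have "emeasure L A \<le> emeasure (foldr add_measure (M # Ms) lborel) A"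
      if "L \<in> insert lborel (set (M # Ms))" "A \<in> sets borel" for L A
    proof (cases "L = M")
      case True then show ?thesis using e[OF that(2)] by simp
    next
      case False
      then have "emeasure L A \<le> emeasure (foldr add_measure Ms lborel) A" using that IH(3) by auto
      also have "\<dots> \<le> emeasure (foldr add_measure (M # Ms) lborel) A" using e[OF that(2)] by simp
      finally show ?thesis .
    qed
    ultimately show ?case using M(2) by auto
  qed
  have "\<exists>h. has_real_density R M h" if M: "M \<in> insert lborel (set Ms)" for M
  proof -
    have s: "sets M = sets R" using M assms * by auto
    have ac: "absolutely_continuous R M"
    proof -
      have "A \<in> null_sets M" if "A \<in> null_sets R" for A
      proof -
        have A: "A \<in> sets borel" "emeasure R A = 0" using that * by auto
        then have "emeasure M A \<le> 0" using * M by metis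
        then show ?thesis using A s * by auto
      qed
      then show ?thesis by (auto simp: absolutely_continuous_def)
    qed
    have sf: "sigma_finite_measure M"
      using M assms by (auto simp: lborel.sigma_finite_measure_axioms dest: finite_measure.axioms(1))
    obtain h where h: "h \<in> borel_measurable R" "\<And>x. 0 \<le> (h x :: real)" "M = density R (\<lambda>x. ennreal (h x))"
      using real_Radon_Nikodym[OF _ sf s ac] * by blast
    have "h \<in> borel_measurable borel" using h(1) * measurable_cong_sets[of R borel borel borel] by auto
    then show ?thesis using h unfolding has_real_density_def by blast
  qed
  then show ?thesis using that * by auto
qed

lemma has_real_density_AE:
  assumes "has_real_density R M h" "sets R = sets borel"
  shows "(AE x in M. P x) \<longleftrightarrow> (AE x in R. 0 < h x \<longrightarrow> P x)"
proof -
  note [measurable_cong] = assms(2)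
  have [measurable]: "h \<in> borel_measurable borel" and M: "M = density R (\<lambda>x. ennreal (h x))"
    using assms by (auto simp: has_real_density_def)
  show ?thesis unfolding M by (subst AE_density) auto
qed

lemma has_real_density_integral:
  assumes "has_real_density R M h" "sets R = sets borel" and f: "f \<in> borel_measurable borel"
  shows "(\<integral>x. f x \<partial>M) = (\<integral>x. h x * (f x :: real) \<partial>R)" "integrable M f \<longleftrightarrow> integrable R (\<lambda>x. h x * f x)"
proof -
  note [measurable_cong] = assms(2)
  have [measurable]: "h \<in> borel_measurable borel" "f \<in> borel_measurable borel" and M: "M = density R (\<lambda>x. ennreal (h x))"
     "\<And>x. 0 \<le> h x" using assms by (auto simp: has_real_density_def)
  show "(\<integral>x. f x \<partial>M) = (\<integral>x. h x * f x \<partial>R)" unfolding M(1) by (subst integral_density) (auto simp: M(2))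
  show "integrable M f \<longleftrightarrow> integrable R (\<lambda>x. h x * f x)"
    unfolding M(1) by (subst integrable_density) (auto simp: M(2))
qed

lemma has_real_density_finite_measure:
  assumes h: "has_real_density R M h" and R: "sets R = sets borel" and M: "finite_measure M"
  shows "integrable R h" "(\<integral>x. h x \<partial>R) = measure M UNIV"
proof -
  interpret M: finite_measure M by fact
  have sM: "space M = UNIV"
    using h sets_eq_imp_space_eq[OF R] unfolding has_real_density_def by (metis space_density space_borel)
  have 1: "integrable M (\<lambda>x. 1::real)" by simp
  have c: "(\<lambda>x. 1::real) \<in> borel_measurable borel" by simp
  have "integrable R (\<lambda>x. h x * 1)" using has_real_density_integral(2)[OF h R c] 1 by blast
  then show "integrable R h" by (simp only: mult_1_right)
  have "(\<integral>x. h x \<partial>R) = (\<integral>x. 1 \<partial>M)"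
    unfolding has_real_density_integral(1)[OF h R c] by (simp only: mult_1_right)
  then show "(\<integral>x. h x \<partial>R) = measure M UNIV" by (simp add: sM)
qed

text \<open>Singularity becomes a pointwise statement: some set is null for \<open>M\<close> while
  its complement is null for \<open>N\<close>, so almost nowhere are both densities
  positive.\<close>

lemma mutually_singular_density_AE:
  assumes "mutually_singular M N" "has_real_density R M p" "has_real_density R N q" "sets R = sets borel"
  shows "AE x in R. p x = 0 \<or> q x = 0"
proof -
  obtain A where A: "A \<in> sets borel" "emeasure M A = 0" "emeasure N (- A) = 0"
    using assms(1) by (auto simp: mutually_singular_def)
  have s: "sets M = sets borel" "sets N = sets borel" using assms by (auto simp: has_real_density_def)
  have "AE x in M. x \<notin> A" using A s by (intro AE_not_in) auto
  moreover have "AE x in N. x \<notin> - A" using A s by (intro AE_not_in) auto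
  ultimately have "AE x in R. 0 < p x \<longrightarrow> x \<notin> A" "AE x in R. 0 < q x \<longrightarrow> x \<notin> - A"
    unfolding has_real_density_AE[OF assms(2,4)] has_real_density_AE[OF assms(3,4)] .
  then show ?thesis
  proof eventually_elim
    case (elim x)
    have "0 \<le> p x" "0 \<le> q x" using assms by (auto simp: has_real_density_def)
    then show ?case using elim by (auto simp: less_le)
  qed
qed

lemma finite_borel_on_density_AE:
  assumes "finite_borel_on a b M" "has_real_density R M p" "sets R = sets borel"
  shows "AE x in R. x \<notin> {a<..<b} \<longrightarrow> p x = 0"
proof -
  have "AE x in M. x \<notin> - {a<..<b}"
    using assms(1) by (intro AE_not_in) (auto simp: finite_borel_on_def)
  then have "AE x in R. 0 < p x \<longrightarrow> x \<notin> - {a<..<b}"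
    unfolding has_real_density_AE[OF assms(2,3)] .
  then show ?thesis
  proof eventually_elim
    case (elim x)
    have "0 \<le> p x" using assms by (auto simp: has_real_density_def)
    then show ?case using elim by (auto simp: less_le)
  qed
qed

text \<open>The indicator makes \<open>u\<close> vanish everywhere outside the interval, as
  \<open>deriv_density\<close> demands. No mass is lost, since \<open>P\<close> and \<open>N\<close>
  do not charge the complement and \<open>g\<close> enters only through its restriction.\<close>

lemma has_real_density_signed:
  assumes R: "sets R = sets borel" "sigma_finite_measure R" and h: "has_real_density R lborel h"
    and P: "has_real_density R P p" "finite_borel_on a b P" and N: "has_real_density R N n" "finite_borel_on a b N"
    and g: "g \<in> L1_on a b"
  defines "u \<equiv> \<lambda>x. indicator {a<..<b} x * (g x * h x + p x - n x)"
  shows "integrable R u" "(\<integral>x. u x \<partial>R) = (LBINT x:{a<..<b}. g x) + (measure P UNIV - measure N UNIV)"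
    "test_function a b f \<Longrightarrow> (\<integral>x. f x * u x \<partial>R) = (LBINT x:{a<..<b}. g x * f x) + ((\<integral>x. f x \<partial>P) - (\<integral>x. f x \<partial>N))"
proof -
  note [measurable_cong] = R(1)
  define g0 where "g0 x = indicator {a<..<b} x * g x" for x
  have g0: "integrable lborel g0" using g by (simp add: L1_on_def set_integrable_def g0_def[abs_def])
  have [measurable]: "g0 \<in> borel_measurable borel" using g0 by auto
  have [measurable]: "h \<in> borel_measurable borel" "p \<in> borel_measurable borel" "n \<in> borel_measurable borel"
    using h P N by (auto simp: has_real_density_def)
  have fin: "finite_measure P" "finite_measure N" using P N by (auto simp: finite_borel_on_def)
  note p = has_real_density_finite_measure[OF P(1) R(1) fin(1)]
  note n = has_real_density_finite_measure[OF N(1) R(1) fin(2)]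
  have gi: "integrable R (\<lambda>x. g0 x * h x)"
    using has_real_density_integral(2)[OF h R(1), of g0] g0 by (simp add: mult.commute)
  have u: "AE x in R. u x = g0 x * h x + p x - n x"
    using finite_borel_on_density_AE[OF P(2,1) R(1)] finite_borel_on_density_AE[OF N(2,1) R(1)]
    by eventually_elim (auto simp: u_def g0_def indicator_def)
  have u': "u = (\<lambda>x. g0 x * h x + indicator {a<..<b} x * p x - indicator {a<..<b} x * n x)"
    by (auto simp: u_def g0_def indicator_def)
  have um[measurable]: "u \<in> borel_measurable R" unfolding u' by measurable
  have "integrable R (\<lambda>x. g0 x * h x + p x - n x)" using gi p(1) n(1) by simp
  then show "integrable R u" using u by (subst integrable_cong_AE[OF _ _ u]) auto
  have "(\<integral>x. u x \<partial>R) = (\<integral>x. g0 x * h x + p x - n x \<partial>R)"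
    by (rule integral_cong_AE[OF _ _ u]) auto
  also have "\<dots> = (\<integral>x. g0 x * h x \<partial>R) + (\<integral>x. p x \<partial>R) - (\<integral>x. n x \<partial>R)" using gi p(1) n(1) by simp
  also have "(\<integral>x. g0 x * h x \<partial>R) = (LBINT x:{a<..<b}. g x)"
  proof -
    have m: "g0 \<in> borel_measurable borel" by measurable
    show ?thesis
      using has_real_density_integral(1)[OF h R(1) m] by (simp add: set_lebesgue_integral_def g0_def mult_ac)
  qed
  finally show "(\<integral>x. u x \<partial>R) = (LBINT x:{a<..<b}. g x) + (measure P UNIV - measure N UNIV)"
    using p(2) n(2) by simp
  assume f: "test_function a b f"
  note [measurable] = test_function_measurable[OF f]
  have i: "integrable R (\<lambda>x. f x * (g0 x * h x))" "integrable R (\<lambda>x. f x * p x)" "integrable R (\<lambda>x. f x * n x)"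
    using integrable_mult_test_function(1)[OF f _ R(1)] gi p(1) n(1) by auto
  have "(\<integral>x. f x * u x \<partial>R) = (\<integral>x. f x * (g0 x * h x) + f x * p x - f x * n x \<partial>R)"
  proof (rule integral_cong_AE)
    show "AE x in R. f x * u x = f x * (g0 x * h x) + f x * p x - f x * n x"
      using u
    proof eventually_elim
      case (elim x)
      show ?case unfolding elim by (simp add: algebra_simps)
    qed
  qed auto
  also have "\<dots> = (\<integral>x. f x * (g0 x * h x) \<partial>R) + (\<integral>x. f x * p x \<partial>R) - (\<integral>x. f x * n x \<partial>R)"
    using i by simp
  also have "(\<integral>x. f x * (g0 x * h x) \<partial>R) = (LBINT x:{a<..<b}. g x * f x)"
  proof -
    have m: "(\<lambda>x. g0 x * f x) \<in> borel_measurable borel" by measurable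
    show ?thesis
      using has_real_density_integral(1)[OF h R(1) m] by (simp add: set_lebesgue_integral_def g0_def mult_ac)
  qed
  also have "(\<integral>x. f x * p x \<partial>R) = (\<integral>x. f x \<partial>P)"
    using has_real_density_integral(1)[OF P(1) R(1), of f] by (simp add: mult.commute)
  also have "(\<integral>x. f x * n x \<partial>R) = (\<integral>x. f x \<partial>N)"
    using has_real_density_integral(1)[OF N(1) R(1), of f] by (simp add: mult.commute)
  finally show "(\<integral>x. f x * u x \<partial>R) = (LBINT x:{a<..<b}. g x * f x) + ((\<integral>x. f x \<partial>P) - (\<integral>x. f x \<partial>N))"
    by simp
qed

lemma derivative_parts_deriv_density:
  assumes D: "derivative_parts a b w g P N"
    and R: "sets R = sets borel" "sigma_finite_measure R" and h: "has_real_density R lborel h"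
    and P: "has_real_density R P p" and N: "has_real_density R N n"
  shows "deriv_density a b w R (\<lambda>x. indicator {a<..<b} x * (g x * h x + p x - n x))"
  using D R has_real_density_signed[OF R h P _ N] unfolding deriv_density_def derivative_parts_def
  by auto

lemma derivative_parts_obtain_deriv_density:
  assumes D: "derivative_parts a b w g P N"
  obtains R u where "deriv_density a b w R u"
    "(\<integral>x. u x \<partial>R) = (LBINT x:{a<..<b}. g x) + (measure P UNIV - measure N UNIV)"
proof -
  have fb: "finite_borel_on a b P" "finite_borel_on a b N" and g: "g \<in> L1_on a b"
    using D by (auto simp: derivative_parts_def)
  then have "\<And>M. M \<in> set [P, N] \<Longrightarrow> finite_measure M \<and> sets M = sets borel" by (auto simp: finite_borel_on_def)
  from common_dominating_measure[OF this] obtain R h p n where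
    R: "sets R = sets borel" "sigma_finite_measure R" and h: "has_real_density R lborel h"
    and P: "has_real_density R P p" and N: "has_real_density R N n" by (metis list.set_intros)
  show ?thesis
    by (rule that[OF derivative_parts_deriv_density[OF D R h P N] has_real_density_signed(2)[OF R h P fb(1) N fb(2) g]])
qed

text \<open>The fundamental theorem of calculus for functions of bounded variation. It ties the
  derivative of a competitor to its boundary values in the calibration.\<close>

lemma derivative_parts_mass:
  assumes "a < b" "w \<in> L1_on a b" "derivative_parts a b w g P N"
  shows "left_trace w b - right_trace w a = (LBINT x:{a<..<b}. g x) + (measure P UNIV - measure N UNIV)"
  using derivative_parts_obtain_deriv_density[OF assms(3)] deriv_density_traces[OF assms(1,2)] by metis

lemma finite_borel_on_density:
  assumes R: "sets R = sets borel" and q: "integrable R q" "\<And>x. 0 \<le> q x" and off: "\<And>x. x \<notin> {a<..<b} \<Longrightarrow> q x = 0"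
  shows "finite_borel_on a b (density R (\<lambda>x. ennreal (q x)))" "has_real_density R (density R (\<lambda>x. ennreal (q x))) q"
proof -
  note [measurable_cong] = R
  have [measurable]: "q \<in> borel_measurable borel" using q(1) R measurable_cong_sets[of R borel borel borel] by auto
  have sR: "space R = UNIV" using sets_eq_imp_space_eq[OF R] by simp
  have "emeasure (density R (\<lambda>x. ennreal (q x))) UNIV = (\<integral>\<^sup>+x. ennreal (q x) \<partial>R)"
    using sR by (subst emeasure_density) (auto simp: R)
  also have "\<dots> < \<infinity>" using q nn_integral_eq_integral[of R q] by simp
  finally have "finite_measure (density R (\<lambda>x. ennreal (q x)))" by (intro finite_measureI) (simp add: sR)
  moreover have "emeasure (density R (\<lambda>x. ennreal (q x))) (- {a<..<b}) = (\<integral>\<^sup>+x. 0 \<partial>R)"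
  proof (subst emeasure_density, (auto simp: R)[2], intro nn_integral_cong)
    fix x show "ennreal (q x) * indicator (- {a<..<b}) x = 0"
      using off[of x] by (cases "x \<in> {a<..<b}") auto
  qed
  ultimately show "finite_borel_on a b (density R (\<lambda>x. ennreal (q x)))" by (simp add: finite_borel_on_def R)
  show "has_real_density R (density R (\<lambda>x. ennreal (q x))) q" using q by (simp add: has_real_density_def)
qed

lemma emeasure_density_eq_0:
  assumes "has_real_density R M p" "sets R = sets borel" "A \<in> sets borel" "\<And>x. x \<in> A \<Longrightarrow> p x = 0"
  shows "emeasure M A = 0"
proof -
  note [measurable_cong] = assms(2)
  have [measurable]: "p \<in> borel_measurable borel" using assms by (auto simp: has_real_density_def)
  have "emeasure M A = (\<integral>\<^sup>+x. ennreal (p x) * indicator A x \<partial>R)"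
    using assms by (auto simp: has_real_density_def emeasure_density)
  also have "\<dots> = (\<integral>\<^sup>+x. 0 \<partial>R)" using assms(4) by (intro nn_integral_cong) (auto split: split_indicator)
  finally show ?thesis by simp
qed

text \<open>Jordan and Lebesgue decomposition at once: both are read off a signed density with respect to
  a measure that dominates Lebesgue measure.\<close>

lemma deriv_density_imp_derivative_parts:
  assumes D: "deriv_density a b w R u" and h: "has_real_density R lborel h"
  shows "\<exists>g P N. derivative_parts a b w g P N"
proof -
  have R: "sets R = sets borel" "sigma_finite_measure R" and u: "integrable R u" 
    and off: "\<And>x. x \<notin> {a<..<b} \<Longrightarrow> u x = 0"
    and eq: "\<And>f. test_function a b f \<Longrightarrow> (LBINT x:{a<..<b}. w x * deriv f x) = - (\<integral>x. f x * u x \<partial>R)"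
    using D by (auto simp: deriv_density_def)
  note [measurable_cong] = R(1)
  have [measurable]: "h \<in> borel_measurable borel" and h0: "\<And>x. 0 \<le> h x" using h by (auto simp: has_real_density_def)
  have [measurable]: "u \<in> borel_measurable borel" using u R measurable_cong_sets[of R borel borel borel] by auto
  \<comment> \<open>As \<open>lborel\<close> has density \<open>h\<close>, the set
    \<open>h = 0\<close> is a Lebesgue null set and carries the whole singular part. Off this set,
    \<open>u\<close> times \<open>R\<close> is \<open>u / h\<close> times Lebesgue measure.\<close>
  define g where "g x = (if h x = 0 then 0 else u x / h x)" for x
  define p where "p x = (if h x = 0 then max 0 (u x) else 0)" for x
  define n where "n x = (if h x = 0 then max 0 (- u x) else 0)" for x
  have [measurable]: "g \<in> borel_measurable borel" "p \<in> borel_measurable borel" "n \<in> borel_measurable borel"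
    unfolding g_def p_def n_def by measurable
  have gh: "integrable R (\<lambda>x. h x * g x)" "integrable R p" "integrable R n"
    by (rule Bochner_Integration.integrable_bound[OF u]; force simp: g_def p_def n_def)+
  have pn: "0 \<le> p x" "0 \<le> n x" "x \<notin> {a<..<b} \<Longrightarrow> p x = 0" "x \<notin> {a<..<b} \<Longrightarrow> n x = 0" for x
    using off by (auto simp: p_def n_def)
  define P N where "P = density R (\<lambda>x. ennreal (p x))" and "N = density R (\<lambda>x. ennreal (n x))"
  note P = finite_borel_on_density[OF R(1) gh(2), of a b, OF pn(1) pn(3), folded P_def]
  note N = finite_borel_on_density[OF R(1) gh(3), of a b, OF pn(2) pn(4), folded N_def]
  have g: "g \<in> L1_on a b"
  proof -
    have "integrable lborel g" using has_real_density_integral(2)[OF h R(1), of g] gh by simp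
    then show ?thesis
      using integrable_mult_indicator[of "{a<..<b}" lborel g] by (simp add: L1_on_def set_integrable_def)
  qed
  have ueq: "u = (\<lambda>x. indicator {a<..<b} x * (g x * h x + p x - n x))"
    using off by (auto simp: g_def p_def n_def fun_eq_iff indicator_def max_def)
  have sing: "mutually_singular lborel M" if "has_real_density R M q" "\<And>x. h x \<noteq> 0 \<Longrightarrow> q x = 0" for M q
    unfolding mutually_singular_def using that h R
    by (intro bexI[of _ "{x. h x = 0}"] conjI emeasure_density_eq_0[OF h R(1)] emeasure_density_eq_0[OF that(1) R(1)]) auto
  have "mutually_singular P N" unfolding mutually_singular_def
    by (intro bexI[of _ "{x. u x \<le> 0}"] conjI emeasure_density_eq_0[OF P(2) R(1)] emeasure_density_eq_0[OF N(2) R(1)])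
      (auto simp: p_def n_def)
  moreover have "mutually_singular lborel P" "mutually_singular lborel N"
    using sing P(2) N(2) by (auto simp: p_def n_def)
  ultimately have "derivative_parts a b w g P N"
    unfolding derivative_parts_def using g P(1) N(1) eq has_real_density_signed(3)[OF R h P(2,1) N(2,1) g] ueq by simp
  then show ?thesis by blast
qed

text \<open>The two measures in \<open>BV_on\<close> may overlap and may contain absolutely
  continuous mass. They are merged into one signed density, with Lebesgue part \<open>0\<close>, and
  decomposed afresh.\<close>

lemma BV_on_imp_derivative_parts:
  assumes "w \<in> BV_on a b"
  shows "\<exists>g P N. derivative_parts a b w g P N"
proof -
  obtain M N where MN: "finite_borel_on a b M" "finite_borel_on a b N"
    "\<And>f. test_function a b f \<Longrightarrow> (LBINT x:{a<..<b}. w x * deriv f x) = - ((\<integral>x. f x \<partial>M) - (\<integral>x. f x \<partial>N))"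
    using assms by (auto simp: BV_on_def)
  then have "\<And>L. L \<in> set [M, N] \<Longrightarrow> finite_measure L \<and> sets L = sets borel" by (auto simp: finite_borel_on_def)
  from common_dominating_measure[OF this] obtain R h p n where
    R: "sets R = sets borel" "sigma_finite_measure R" and h: "has_real_density R lborel h"
    and P: "has_real_density R M p" and N: "has_real_density R N n" by (metis list.set_intros)
  have 0: "(\<lambda>x. 0) \<in> L1_on a b" by (simp add: L1_on_def set_integrable_def)
  note s = has_real_density_signed[OF R h P MN(1) N MN(2) 0]
  have "deriv_density a b w R (\<lambda>x. indicator {a<..<b} x * (0 * h x + p x - n x))"
    unfolding deriv_density_def using R s MN(3) by (auto simp: set_lebesgue_integral_def)
  from deriv_density_imp_derivative_parts[OF this h] show ?thesis .
qed

text \<open>The positive and the negative part of the full density \<open>u\<close>, with the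
  absolutely continuous part included, serve as the two measures of \<open>BV_on\<close>.\<close>

lemma derivative_parts_imp_BV_on:
  assumes w: "w \<in> L1_on a b" and D: "derivative_parts a b w g P N"
  shows "w \<in> BV_on a b"
proof -
  obtain R u where dd: "deriv_density a b w R u" using derivative_parts_obtain_deriv_density[OF D] .
  then have R: "sets R = sets borel" by (simp add: deriv_density_def)
  have u: "integrable R u" "\<And>x. x \<notin> {a<..<b} \<Longrightarrow> u x = 0" using dd by (auto simp: deriv_density_def)
  have i: "integrable R (\<lambda>x. max 0 (u x))" "integrable R (\<lambda>x. max 0 (- u x))" using u by auto
  have c: "finite_borel_on a b (density R (\<lambda>x. ennreal (max 0 (u x))))" "has_real_density R (density R (\<lambda>x. ennreal (max 0 (u x)))) (\<lambda>x. max 0 (u x))"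
    "finite_borel_on a b (density R (\<lambda>x. ennreal (max 0 (- u x))))" "has_real_density R (density R (\<lambda>x. ennreal (max 0 (- u x)))) (\<lambda>x. max 0 (- u x))"
    by (rule finite_borel_on_density[OF R i(1), of a b] finite_borel_on_density[OF R i(2), of a b]; simp add: u(2))+
  have "(LBINT x:{a<..<b}. w x * deriv f x) = - ((\<integral>x. f x \<partial>density R (\<lambda>x. ennreal (max 0 (u x)))) - (\<integral>x. f x \<partial>density R (\<lambda>x. ennreal (max 0 (- u x)))))"
    if f: "test_function a b f" for f
  proof -
    note [measurable] = test_function_measurable[OF f]
    have "(\<integral>x. f x \<partial>density R (\<lambda>x. ennreal (max 0 (u x)))) - (\<integral>x. f x \<partial>density R (\<lambda>x. ennreal (max 0 (- u x))))
      = (\<integral>x. f x * max 0 (u x) \<partial>R) - (\<integral>x. f x * max 0 (- u x) \<partial>R)"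
      by (simp add: has_real_density_integral(1)[OF c(2) R] has_real_density_integral(1)[OF c(4) R] mult.commute)
    also have "\<dots> = (\<integral>x. f x * max 0 (u x) - f x * max 0 (- u x) \<partial>R)"
      using integrable_mult_test_function(1)[OF f i(1) R] integrable_mult_test_function(1)[OF f i(2) R] by simp
    also have "\<dots> = (\<integral>x. f x * u x \<partial>R)"
      by (intro Bochner_Integration.integral_cong refl) (auto simp: max_def)
    finally show ?thesis using dd f by (simp add: deriv_density_def)
  qed
  then show ?thesis unfolding BV_on_def using w c(1,3) by blast
qed

text \<open>All measures are compared through densities with respect to one \<open>R\<close>. Test
  functions determine the signed density almost everywhere, and \<open>h\<close>, \<open>p\<close>
  and \<open>n\<close> have pairwise disjoint supports, so the signed density determines its three
  parts.\<close>

lemma derivative_parts_unique: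
  assumes D: "derivative_parts a b w g P N" and D': "derivative_parts a b w g' P' N'"
  shows "P = P'" "N = N'" "AE x in lborel. x \<in> {a<..<b} \<longrightarrow> g x = g' x"
proof -
  have fb: "finite_borel_on a b P" "finite_borel_on a b N" "finite_borel_on a b P'" "finite_borel_on a b N'"
    using D D' by (auto simp: derivative_parts_def)
  then have "\<And>M. M \<in> set [P, N, P', N'] \<Longrightarrow> finite_measure M \<and> sets M = sets borel" by (auto simp: finite_borel_on_def)
  from common_dominating_measure[OF this] obtain R where
    R: "sets R = sets borel" "sigma_finite_measure R" and Rh: "\<exists>h. has_real_density R lborel h"
    "\<And>M. M \<in> set [P, N, P', N'] \<Longrightarrow> \<exists>h. has_real_density R M h" by metis
  obtain h p n p' n' where h: "has_real_density R lborel h" and P: "has_real_density R P p" and N: "has_real_density R N n"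
    and P': "has_real_density R P' p'" and N': "has_real_density R N' n'"
    using Rh by (metis list.set_intros)
  define u where "u x = indicator {a<..<b} x * (g x * h x + p x - n x)" for x
  define u' where "u' x = indicator {a<..<b} x * (g' x * h x + p' x - n' x)" for x
  have dd: "deriv_density a b w R u" "deriv_density a b w R u'"
    using derivative_parts_deriv_density[OF D R h P N] derivative_parts_deriv_density[OF D' R h P' N']
    by (simp_all add: u_def[abs_def] u'_def[abs_def])
  have ui: "integrable R u" "integrable R u'" using dd by (auto simp: deriv_density_def)
  have "AE x in R. u x - u' x = 0"
  proof (rule AE_eq_0_if_test_function_integral_0[OF R(2,1)])
    show "integrable R (\<lambda>x. u x - u' x)" using ui by simp
    show "\<And>x. x \<notin> {a<..<b} \<Longrightarrow> u x - u' x = 0" using dd by (auto simp: deriv_density_def)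
    fix f assume f: "test_function a b f"
    have "(\<integral>x. f x * (u x - u' x) \<partial>R) = (\<integral>x. f x * u x \<partial>R) - (\<integral>x. f x * u' x \<partial>R)"
      using integrable_mult_test_function(1)[OF f ui(1) R(1)] integrable_mult_test_function(1)[OF f ui(2) R(1)]
      by (simp add: right_diff_distrib)
    then show "(\<integral>x. f x * (u x - u' x) \<partial>R) = 0" using dd f by (simp add: deriv_density_def)
  qed
  moreover have "AE x in R. x \<notin> {a<..<b} \<longrightarrow> p x = 0" "AE x in R. x \<notin> {a<..<b} \<longrightarrow> n x = 0"
     "AE x in R. x \<notin> {a<..<b} \<longrightarrow> p' x = 0" "AE x in R. x \<notin> {a<..<b} \<longrightarrow> n' x = 0"
    using finite_borel_on_density_AE R(1) fb P N P' N' by blast+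
  moreover have "AE x in R. h x = 0 \<or> p x = 0" "AE x in R. h x = 0 \<or> n x = 0" "AE x in R. h x = 0 \<or> p' x = 0" "AE x in R. h x = 0 \<or> n' x = 0"
    "AE x in R. p x = 0 \<or> n x = 0" "AE x in R. p' x = 0 \<or> n' x = 0"
    using mutually_singular_density_AE[OF _ _ _ R(1)] D D' h P N P' N' unfolding derivative_parts_def by blast+
  ultimately have *: "AE x in R. p x = p' x \<and> n x = n' x \<and> (x \<in> {a<..<b} \<longrightarrow> g x * h x = g' x * h x)"
  proof eventually_elim
    case (elim x)
    have "0 \<le> p x" "0 \<le> n x" "0 \<le> p' x" "0 \<le> n' x" using P N P' N' by (auto simp: has_real_density_def)
    then show ?case using elim by (cases "x \<in> {a<..<b}") (auto simp: u_def u'_def)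
  qed
  have m: "p \<in> borel_measurable R" "n \<in> borel_measurable R" "p' \<in> borel_measurable R" "n' \<in> borel_measurable R"
    using P N P' N' R(1) measurable_cong_sets[of R borel borel borel] by (auto simp: has_real_density_def)
  have "density R (\<lambda>x. ennreal (p x)) = density R (\<lambda>x. ennreal (p' x))"
    using * m by (intro density_cong) auto
  then show "P = P'" using P P' by (simp add: has_real_density_def)
  have "density R (\<lambda>x. ennreal (n x)) = density R (\<lambda>x. ennreal (n' x))"
    using * m by (intro density_cong) auto
  then show "N = N'" using N N' by (simp add: has_real_density_def)
  show "AE x in lborel. x \<in> {a<..<b} \<longrightarrow> g x = g' x"
    unfolding has_real_density_AE[OF h R(1)] using * by eventually_elim auto
qed

text \<open>The three choices are made independently of each other; uniqueness makes them parts of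
  one and the same decomposition.\<close>

lemma BV_on_canonical_parts:
  assumes "w \<in> BV_on a b"
  shows "derivative_parts a b w (ac_density a b w) (sing_pos a b w) (sing_neg a b w)"
proof -
  obtain g P N where D: "derivative_parts a b w g P N" using BV_on_imp_derivative_parts[OF assms] by blast

  have "sing_pos a b w = P" 
    using someI_ex[of "\<lambda>P. \<exists>g N. derivative_parts a b w g P N"] D derivative_parts_unique(1)
    unfolding sing_pos_def by metis
  moreover have "sing_neg a b w = N" 
    using someI_ex[of "\<lambda>N. \<exists>g P. derivative_parts a b w g P N"] D derivative_parts_unique(2)
    unfolding sing_neg_def by metis
  moreover have "\<exists>P N. derivative_parts a b w (ac_density a b w) P N"
    unfolding ac_density_def by (rule someI_ex[of "\<lambda>g. \<exists>P N. derivative_parts a b w g P N"]) (use D in blast)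
  ultimately show ?thesis using D derivative_parts_unique by metis
qed

section \<open>Calibration\<close>

text \<open>A weak derivative in \<open>L1_on\<close> is a decomposition with null singular
  measures, and uniqueness transfers this to any other decomposition.\<close>

lemma derivative_parts_null_iff_W11:
  assumes w: "w \<in> L1_on a b" and D: "derivative_parts a b w g P N"
  shows "w \<in> W11_on a b \<longleftrightarrow> emeasure P UNIV = 0 \<and> emeasure N UNIV = 0"
proof
  assume "w \<in> W11_on a b"
  then obtain g' where g': "g' \<in> L1_on a b"
    "\<And>f. test_function a b f \<Longrightarrow> (LBINT x:{a<..<b}. w x * deriv f x) = - (LBINT x:{a<..<b}. g' x * f x)"
    by (auto simp: W11_on_def)
  let ?O = "null_measure borel :: real measure"
  have fm: "finite_measure ?O" by (rule finite_measureI) simp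
  have "derivative_parts a b w g' ?O ?O" using g' fm
    by (auto simp: derivative_parts_def finite_borel_on_def mutually_singular_def integral_null_measure intro!: bexI[of _ "{}"])
  from derivative_parts_unique[OF D this] show "emeasure P UNIV = 0 \<and> emeasure N UNIV = 0" by simp
next
  assume 0: "emeasure P UNIV = 0 \<and> emeasure N UNIV = 0"
  have "(\<integral>x. f x \<partial>P) = 0" "(\<integral>x. f x \<partial>N) = 0" for f :: "real \<Rightarrow> real"
  proof -
    have "space P = UNIV" "space N = UNIV" 
      using D sets_eq_imp_space_eq[of P borel] sets_eq_imp_space_eq[of N borel] by (auto simp: derivative_parts_def finite_borel_on_def)
    then have "AE x in P. f x = 0" "AE x in N. f x = 0"
      using 0 by (auto intro!: AE_I[where N=UNIV] simp: sets.top[of P, simplified] sets.top[of N, simplified])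
        (metis sets.top)+
    then show "(\<integral>x. f x \<partial>P) = 0" "(\<integral>x. f x \<partial>N) = 0" by (auto intro: integral_eq_zero_AE)
  qed
  then show "w \<in> W11_on a b" using w D by (auto simp: W11_on_def derivative_parts_def)
qed

text \<open>The Cauchy--Schwarz inequality for \<open>(sqrt \<theta> * g, sqrt \<omega>)\<close> and the unit vector
  \<open>(\<mu> / sqrt \<theta>, sqrt (1 - \<mu>\<^sup>2 / \<theta>))\<close>.\<close>

lemma calibration_ineq:
  fixes \<mu> \<theta> \<omega> g :: real
  assumes "0 < \<mu>" "\<mu>\<^sup>2 < \<theta>" "0 \<le> \<omega>"
  defines "p \<equiv> sqrt (\<mu>\<^sup>2 * \<omega> / (\<theta> * (\<theta> - \<mu>\<^sup>2)))" and "e \<equiv> sqrt (\<omega> * (1 - \<mu>\<^sup>2 / \<theta>))"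
  shows "\<mu> * g + e \<le> sqrt (\<theta> * \<bar>g\<bar>\<^sup>2 + \<omega>)" "\<mu> * g + e = sqrt (\<theta> * \<bar>g\<bar>\<^sup>2 + \<omega>) \<longleftrightarrow> g = p"
proof -
  have \<theta>: "0 < \<theta>" using assms by (smt (verit) zero_le_power2)
  define A B x y where "A = sqrt \<theta> * g" and "B = sqrt \<omega>" and "x = \<mu> / sqrt \<theta>" and "y = sqrt (1 - \<mu>\<^sup>2 / \<theta>)"
  have x: "0 < x" "x\<^sup>2 = \<mu>\<^sup>2 / \<theta>" using assms \<theta> by (auto simp: x_def power_divide)
  have "\<mu>\<^sup>2 / \<theta> < 1" using assms \<theta> by simp
  then have y: "0 < y" "y\<^sup>2 = 1 - \<mu>\<^sup>2 / \<theta>" by (auto simp: y_def)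
  have xy: "x\<^sup>2 + y\<^sup>2 = 1" using x y by simp
  have B: "0 \<le> B" "B\<^sup>2 = \<omega>" using assms by (auto simp: B_def)
  have L: "\<mu> * g + e = A * x + B * y"
    using \<theta> by (simp add: A_def B_def x_def y_def e_def real_sqrt_mult)
  have Rt: "\<theta> * \<bar>g\<bar>\<^sup>2 + \<omega> = A\<^sup>2 + B\<^sup>2" using \<theta> B by (simp add: A_def power_mult_distrib)
  \<comment> \<open>Lagrange's identity: the defect in the Cauchy-Schwarz inequality is a square,
    whose vanishing is the equality case \<open>A * y = B * x\<close>.\<close>
  have id: "A\<^sup>2 + B\<^sup>2 = (A * x + B * y)\<^sup>2 + (A * y - B * x)\<^sup>2"
  proof -
    have "(A * x + B * y)\<^sup>2 + (A * y - B * x)\<^sup>2 = (A\<^sup>2 + B\<^sup>2) * (x\<^sup>2 + y\<^sup>2)" by algebra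
    then show ?thesis using xy by simp
  qed
  show le: "\<mu> * g + e \<le> sqrt (\<theta> * \<bar>g\<bar>\<^sup>2 + \<omega>)" unfolding L Rt id by (rule real_le_rsqrt) simp
  have "p = sqrt (x\<^sup>2 * B\<^sup>2 / (\<theta> * y\<^sup>2))"
    unfolding p_def x(2) y(2) B(2) using \<theta> assms by (simp add: field_simps)
  then have p: "p = x * B / (sqrt \<theta> * y)" using x(1) y(1) B(1) by (simp add: real_sqrt_divide real_sqrt_mult)
  show "\<mu> * g + e = sqrt (\<theta> * \<bar>g\<bar>\<^sup>2 + \<omega>) \<longleftrightarrow> g = p"
  proof
    assume "\<mu> * g + e = sqrt (\<theta> * \<bar>g\<bar>\<^sup>2 + \<omega>)"
    then have "(A * x + B * y)\<^sup>2 = A\<^sup>2 + B\<^sup>2" unfolding L Rt by simp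
    then have "A * y = B * x" using id by simp
    then show "g = p" using \<theta> y(1) by (simp add: p A_def field_simps)
  next
    assume "g = p"
    then have "A * y = B * x" "0 \<le> A" using \<theta> y(1) x(1) B(1) by (simp_all add: p A_def)
    then have "A\<^sup>2 + B\<^sup>2 = (A * x + B * y)\<^sup>2" using id by simp
    \<comment> \<open>Proportional vectors give equality only up to sign; the sign has to be
      checked.\<close>
    moreover have "0 \<le> A * x + B * y" using \<open>0 \<le> A\<close> x(1) y(1) B(1) by simp
    ultimately show "\<mu> * g + e = sqrt (\<theta> * \<bar>g\<bar>\<^sup>2 + \<omega>)" unfolding L Rt by simp
  qed
qed

text \<open>The bounded-variation branch of \<open>scG\<close>, with interval, coefficients and
  boundary weight as parameters, so that the calibration can be carried out without the reflected
  data.\<close>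

definition energy :: "real \<Rightarrow> real \<Rightarrow> (real \<Rightarrow> real) \<Rightarrow> (real \<Rightarrow> real) \<Rightarrow> ennreal \<Rightarrow> real \<Rightarrow> (real \<Rightarrow> real) \<Rightarrow> ennreal" where
  "energy a b \<theta> \<omega> \<sigma> s w =
    (\<integral>\<^sup>+ t \<in> {a<..<b}. ennreal (sqrt (\<theta> t * \<bar>ac_density a b w t\<bar>\<^sup>2 + \<omega> t)) \<partial>lborel)
     + ((\<integral>\<^sup>+ t \<in> {a<..<b}. ennreal (sqrt (\<theta> t)) \<partial>sing_pos a b w)
        + (\<integral>\<^sup>+ t \<in> {a<..<b}. ennreal (sqrt (\<theta> t)) \<partial>sing_neg a b w))
     + \<sigma> * ennreal \<bar>right_trace w a\<bar> + \<sigma> * ennreal \<bar>left_trace w b - s\<bar>"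

text \<open>The weight may be infinite, in which case finite energy already forces
  \<open>x = 0\<close>. For a finite weight, its strict excess over \<open>\<mu>\<close> excludes
  equality at \<open>x \<noteq> 0\<close>.\<close>

lemma boundary_energy_bound:
  assumes "ennreal \<mu> < \<sigma>" "0 < \<mu>" "\<sigma> * ennreal \<bar>x\<bar> \<noteq> \<infinity>"
  obtains e where "\<sigma> * ennreal \<bar>x\<bar> = ennreal e" "\<mu> * \<bar>x\<bar> \<le> e" "e = \<mu> * \<bar>x\<bar> \<Longrightarrow> x = 0"
proof (cases "x = 0")
  case True then show ?thesis using that[of 0] by simp
next
  case False
  have "\<sigma> \<noteq> \<infinity>"
  proof
    assume "\<sigma> = \<infinity>"
    then have "\<sigma> * ennreal \<bar>x\<bar> = \<infinity>" using False by (simp add: ennreal_top_mult)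
    then show False using assms by simp
  qed
  then obtain r where r: "\<sigma> = ennreal r" "0 \<le> r" by (cases \<sigma>) auto
  then have "\<mu> < r" using assms(1,2) by (simp add: ennreal_less_iff)
  then show ?thesis using that[of "r * \<bar>x\<bar>"] r False by (simp add: ennreal_mult mult_right_mono)
qed

text \<open>\<open>c\<close> is the height of the jump at \<open>m\<close>: \<open>mass\<close>
  fixes it as what the slopes lack to reach \<open>s\<close>, and \<open>c_pos\<close> permits it
  only where \<open>sqrt \<theta>\<close> touches \<open>\<mu>\<close>. The strict inequalities
  \<open>\<theta>_gt\<close> and \<open>\<sigma>\<close> make jumps elsewhere, and at the boundary,
  cost more than \<open>\<mu>\<close> per unit height.\<close>

locale calibration =
  fixes a b m s \<mu> c :: real and \<theta> \<omega> :: "real \<Rightarrow> real" and \<sigma> :: ennreal and B :: real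
  assumes am: "a < m" and mb: "m < b" and lam0: "0 < \<mu>"
    and \<theta>_cont: "continuous_on {a<..<b} \<theta>" and \<omega>_cont: "continuous_on {a<..<b} \<omega>"
    and \<theta>_m: "\<mu>\<^sup>2 \<le> \<theta> m" and \<theta>_gt: "\<And>t. t \<in> {a<..<b} \<Longrightarrow> t \<noteq> m \<Longrightarrow> \<mu>\<^sup>2 < \<theta> t"
    and \<omega>_bd: "\<And>t. t \<in> {a<..<b} \<Longrightarrow> 0 \<le> \<omega> t \<and> \<omega> t \<le> B"
    and \<sigma>: "ennreal \<mu> < \<sigma>"
    and p_int: "set_integrable lborel {a<..<b} (\<lambda>t. sqrt (\<mu>\<^sup>2 * \<omega> t / (\<theta> t * (\<theta> t - \<mu>\<^sup>2))))"
    and mass: "(LBINT t:{a<..<b}. sqrt (\<mu>\<^sup>2 * \<omega> t / (\<theta> t * (\<theta> t - \<mu>\<^sup>2)))) + c = s"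
    and c0: "0 \<le> c" and c_pos: "0 < c \<Longrightarrow> \<theta> m = \<mu>\<^sup>2"
begin

definition p :: "real \<Rightarrow> real" where "p t = sqrt (\<mu>\<^sup>2 * \<omega> t / (\<theta> t * (\<theta> t - \<mu>\<^sup>2)))"
definition e :: "real \<Rightarrow> real" where "e t = sqrt (\<omega> t * (1 - \<mu>\<^sup>2 / \<theta> t))"
definition minval :: real where "minval = \<mu> * s + (LBINT t:{a<..<b}. e t)"

abbreviation "I \<equiv> {a<..<b}"
abbreviation "ac_part g \<equiv> \<integral>\<^sup>+ t \<in> I. ennreal (sqrt (\<theta> t * \<bar>g t\<bar>\<^sup>2 + \<omega> t)) \<partial>lborel"
abbreviation "sing_part M \<equiv> \<integral>\<^sup>+ t \<in> I. ennreal (sqrt (\<theta> t)) \<partial>M"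

lemma ab: "a < b" using am mb by simp

lemma \<theta>_ge: "t \<in> I \<Longrightarrow> \<mu>\<^sup>2 \<le> \<theta> t" using \<theta>_gt[of t] \<theta>_m by (cases "t = m") auto

lemma \<theta>_pos: "t \<in> I \<Longrightarrow> 0 < \<theta> t" using \<theta>_ge[of t] lam0 by (smt (verit) zero_less_power)

lemma lam_le_sqrt: "t \<in> I \<Longrightarrow> \<mu> \<le> sqrt (\<theta> t)" using \<theta>_ge[of t] lam0 by (intro real_le_rsqrt) auto

lemma meas_\<theta> [measurable]: "(\<lambda>t. indicator I t * \<theta> t) \<in> borel_measurable borel"
  using borel_measurable_continuous_on_indicator[OF _ \<theta>_cont] by simp

lemma meas_\<omega> [measurable]: "(\<lambda>t. indicator I t * \<omega> t) \<in> borel_measurable borel"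
  using borel_measurable_continuous_on_indicator[OF _ \<omega>_cont] by simp

lemma e_nonneg: "t \<in> I \<Longrightarrow> 0 \<le> e t"
  using \<theta>_ge[of t] \<theta>_pos[of t] \<omega>_bd[of t] by (auto simp: e_def)

lemma p_nonneg: "t \<in> I \<Longrightarrow> 0 \<le> p t"
  using \<theta>_ge[of t] \<theta>_pos[of t] \<omega>_bd[of t] by (auto simp: p_def)

lemma e_int: "set_integrable lborel I e"
proof -
  have 1: "indicator I t * e t = indicator I t * sqrt ((indicator I t * \<omega> t) * (1 - \<mu>\<^sup>2 / (indicator I t * \<theta> t)))" for t
    by (auto simp: e_def indicator_def)
  have [measurable]: "(\<lambda>t. indicator I t * e t) \<in> borel_measurable borel" unfolding 1 by measurable
  have "integrable lborel (\<lambda>t. indicator I t * e t)"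
  proof (rule Bochner_Integration.integrable_bound)
    show "integrable lborel (\<lambda>t. indicator I t * sqrt B)" using ab by (intro integrable_mult_left integrable_real_indicator) auto
    show "AE t in lborel. norm (indicator I t * e t) \<le> norm (indicator I t * sqrt B)"
    proof (rule AE_I2)
      fix t show "norm (indicator I t * e t) \<le> norm (indicator I t * sqrt B)"
      proof (cases "t \<in> I")
        case True
        have "1 - \<mu>\<^sup>2 / \<theta> t \<le> 1" "0 \<le> 1 - \<mu>\<^sup>2 / \<theta> t" using \<theta>_pos[OF True] \<theta>_ge[OF True] by auto
        then have "\<omega> t * (1 - \<mu>\<^sup>2 / \<theta> t) \<le> B * 1" using \<omega>_bd[OF True] by (intro mult_mono) auto
        then show ?thesis using True e_nonneg[OF True] \<omega>_bd[OF True] by (simp add: e_def)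
      qed simp
    qed
  qed measurable
  then show ?thesis by (simp add: set_integrable_def)
qed

lemma p_int': "set_integrable lborel I p"
  using p_int unfolding p_def[abs_def] .

lemma integrand_ge:
  assumes "t \<in> I" "t \<noteq> m"
  shows "\<mu> * g + e t \<le> sqrt (\<theta> t * \<bar>g\<bar>\<^sup>2 + \<omega> t)" "\<mu> * g + e t = sqrt (\<theta> t * \<bar>g\<bar>\<^sup>2 + \<omega> t) \<longleftrightarrow> g = p t"
  using calibration_ineq[OF lam0 \<theta>_gt[OF assms], of "\<omega> t" g] \<omega>_bd[OF assms(1)] by (auto simp: p_def e_def)

lemma AE_neq_m: "AE t in lborel. t \<noteq> m" by (rule AE_lborel_singleton)

text \<open>The excess \<open>r\<close> of the integrand over its calibrated lower bound is
  nonnegative off the null set \<open>{m}\<close>. Its integral is the gap in the inequality, so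
  without a gap it vanishes almost everywhere.\<close>

lemma ac_energy:
  assumes g: "g \<in> L1_on a b"
    and fin: "ac_part g \<noteq> \<infinity>" (is "?E \<noteq> _")
  obtains x where "?E = ennreal x" "\<mu> * (LBINT t:I. g t) + (LBINT t:I. e t) \<le> x"
    "x = \<mu> * (LBINT t:I. g t) + (LBINT t:I. e t) \<Longrightarrow> AE t in lborel. t \<in> I \<longrightarrow> g t = p t"
proof -
  have gi: "integrable lborel (\<lambda>t. indicator I t * g t)" using g by (simp add: L1_on_def set_integrable_def)
  then have [measurable]: "(\<lambda>t. indicator I t * g t) \<in> borel_measurable borel" by auto
  have ei: "integrable lborel (\<lambda>t. indicator I t * e t)" using e_int by (simp add: set_integrable_def)
  define F where "F t = indicator I t * sqrt (\<theta> t * \<bar>g t\<bar>\<^sup>2 + \<omega> t)" for t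
  have 1: "F t = indicator I t * sqrt ((indicator I t * \<theta> t) * \<bar>indicator I t * g t\<bar>\<^sup>2 + indicator I t * \<omega> t)" for t
    by (auto simp: F_def indicator_def)
  have Fm [measurable]: "F \<in> borel_measurable borel" unfolding 1[abs_def] by measurable
  have F0: "0 \<le> F t" for t
    using \<theta>_pos[of t] \<omega>_bd[of t] by (cases "t \<in> I") (auto simp: F_def)
  have E: "?E = (\<integral>\<^sup>+t. ennreal (F t) \<partial>lborel)"
    by (intro nn_integral_cong) (auto simp: F_def indicator_def)
  have Fi: "integrable lborel F"
    using fin E F0 by (intro integrableI_nonneg) (auto simp: less_top)
  define x where "x = (\<integral>t. F t \<partial>lborel)"
  have Ex: "?E = ennreal x" unfolding E x_def using Fi F0 by (intro nn_integral_eq_integral) auto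
  define r where "r t = F t - (\<mu> * (indicator I t * g t) + indicator I t * e t)" for t
  have ri: "integrable lborel r" unfolding r_def using Fi gi ei by simp
  have r0: "AE t in lborel. 0 \<le> r t"
    using AE_neq_m
  proof eventually_elim
    case (elim t)
    then show ?case using integrand_ge(1)[of t "g t"] by (cases "t \<in> I") (auto simp: r_def F_def)
  qed
  have xr: "x = \<mu> * (LBINT t:I. g t) + (LBINT t:I. e t) + (\<integral>t. r t \<partial>lborel)"
    unfolding r_def x_def using Fi gi ei by (simp add: set_lebesgue_integral_def)
  have "0 \<le> (\<integral>t. r t \<partial>lborel)" by (rule integral_nonneg_AE[OF r0])
  then have 2: "\<mu> * (LBINT t:I. g t) + (LBINT t:I. e t) \<le> x" using xr by simp
  have 3: "AE t in lborel. t \<in> I \<longrightarrow> g t = p t" if "x = \<mu> * (LBINT t:I. g t) + (LBINT t:I. e t)"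
  proof -
    have "AE t in lborel. r t = 0"
      using integral_nonneg_eq_0_iff_AE[OF ri r0] xr that by simp
    then show ?thesis using AE_neq_m
    proof eventually_elim
      case (elim t)
      then show ?case using integrand_ge(2)[of t "g t"] by (auto simp: r_def F_def)
    qed
  qed
  show ?thesis using that[OF Ex 2 3] .
qed

text \<open>\<open>sqrt \<theta>\<close> is at least \<open>\<mu>\<close> and equals it at most at
  \<open>m\<close>. The set in the last conclusion is the complement of \<open>{m}\<close> if
  \<open>\<theta> m = \<mu>\<^sup>2\<close>, and the whole line otherwise.\<close>

lemma singular_energy:
  assumes M: "finite_borel_on a b M"
    and fin: "sing_part M \<noteq> \<infinity>" (is "?E \<noteq> _")
  obtains x where "?E = ennreal x" "\<mu> * measure M UNIV \<le> x"
    "x = \<mu> * measure M UNIV \<Longrightarrow> emeasure M {t. t \<noteq> m \<or> \<mu>\<^sup>2 < \<theta> m} = 0"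
proof -
  interpret finite_measure M using M by (simp add: finite_borel_on_def)
  have [measurable_cong]: "sets M = sets borel" using M by (simp add: finite_borel_on_def)
  have sM: "space M = UNIV" using sets_eq_imp_space_eq[of M borel] M by (simp add: finite_borel_on_def)
  define F where "F t = indicator I t * sqrt (\<theta> t)" for t
  have 1: "F t = sqrt (indicator I t * \<theta> t)" for t by (auto simp: F_def indicator_def)
  have Fm [measurable]: "F \<in> borel_measurable M" unfolding 1[abs_def] by measurable
  have F0: "0 \<le> F t" for t using \<theta>_pos[of t] by (cases "t \<in> I") (auto simp: F_def)
  have E: "?E = (\<integral>\<^sup>+t. ennreal (F t) \<partial>M)" by (intro nn_integral_cong) (auto simp: F_def indicator_def)
  have Fi: "integrable M F" using fin E F0 by (intro integrableI_nonneg) (auto simp: less_top)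
  define x where "x = (\<integral>t. F t \<partial>M)"
  have Ex: "?E = ennreal x" unfolding E x_def using Fi F0 by (intro nn_integral_eq_integral) auto
  have inI: "AE t in M. t \<in> I"
    using M by (intro AE_I[where N="- I"]) (auto simp: finite_borel_on_def)
  have r0: "AE t in M. 0 \<le> F t - \<mu>"
    using inI by eventually_elim (use lam_le_sqrt in \<open>auto simp: F_def\<close>)
  have xr: "x = \<mu> * measure M UNIV + (\<integral>t. F t - \<mu> \<partial>M)"
    unfolding x_def using Fi by (simp add: sM)
  have "0 \<le> (\<integral>t. F t - \<mu> \<partial>M)" by (rule integral_nonneg_AE[OF r0])
  then have 2: "\<mu> * measure M UNIV \<le> x" using xr by simp
  have 3: "emeasure M {t. t \<noteq> m \<or> \<mu>\<^sup>2 < \<theta> m} = 0" if "x = \<mu> * measure M UNIV"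
  proof -
    have "integrable M (\<lambda>t. F t - \<mu>)" using Fi by simp
    then have "AE t in M. F t - \<mu> = 0"
      using integral_nonneg_eq_0_iff_AE[OF _ r0] xr that by simp
    then have "AE t in M. \<not> (t \<noteq> m \<or> \<mu>\<^sup>2 < \<theta> m)" using inI
    proof eventually_elim
      case (elim t)
      have "\<theta> t = \<mu>\<^sup>2" using elim \<theta>_pos[of t] by (auto simp: F_def)
      then show ?case using \<theta>_gt[of t] elim by fastforce
    qed
    moreover have "{t. t \<noteq> m \<or> \<mu>\<^sup>2 < \<theta> m} \<in> sets M"
    proof -
      have "{t. t \<noteq> m \<or> \<mu>\<^sup>2 < \<theta> m} = (if \<mu>\<^sup>2 < \<theta> m then UNIV else - {m})" by auto
      then show ?thesis using M by (auto simp: finite_borel_on_def)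
    qed
    ultimately show ?thesis by (subst (asm) AE_iff_measurable[OF _ refl]) (auto simp: sM)
  qed
  show ?thesis using that[OF Ex 2 3] .
qed

text \<open>Summing the bounds for the five terms, the mass identity turns \<open>\<mu>\<close>
  times the derivative into \<open>\<mu>\<close> times the difference of the traces, and the
  boundary terms pay for the deviation of the traces from \<open>0\<close> and \<open>s\<close>.
  Minimal energy forces equality in each bound separately.\<close>

lemma energy_lower_bound:
  assumes w: "w \<in> BV_on a b"
  shows "ennreal minval \<le> energy a b \<theta> \<omega> \<sigma> s w"
    and "energy a b \<theta> \<omega> \<sigma> s w \<le> ennreal minval \<Longrightarrow>
      (AE t in lborel. t \<in> I \<longrightarrow> ac_density a b w t = p t) \<and> (w \<in> W11_on a b \<longleftrightarrow> c = 0)"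
proof -
  have wL: "w \<in> L1_on a b" using w by (simp add: BV_on_def)
  note D = BV_on_canonical_parts[OF w]
  let ?g = "ac_density a b w" let ?P = "sing_pos a b w" let ?N = "sing_neg a b w"
  let ?\<alpha> = "right_trace w a" let ?\<beta> = "left_trace w b"
  have g: "?g \<in> L1_on a b" and fb: "finite_borel_on a b ?P" "finite_borel_on a b ?N"
    using D by (auto simp: derivative_parts_def)
  note mass_eq = derivative_parts_mass[OF ab wL D]
  have "ennreal minval \<le> energy a b \<theta> \<omega> \<sigma> s w \<and> (energy a b \<theta> \<omega> \<sigma> s w \<le> ennreal minval \<longrightarrow>
      (AE t in lborel. t \<in> I \<longrightarrow> ac_density a b w t = p t) \<and> (w \<in> W11_on a b \<longleftrightarrow> c = 0))"
  proof (cases "energy a b \<theta> \<omega> \<sigma> s w = \<infinity>")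
    case True then show ?thesis by (simp add: top_unique)
  next
    case False
    then have fin: "ac_part ?g \<noteq> \<infinity>"
      "sing_part ?P \<noteq> \<infinity>" "sing_part ?N \<noteq> \<infinity>"
      "\<sigma> * ennreal \<bar>?\<alpha>\<bar> \<noteq> \<infinity>" "\<sigma> * ennreal \<bar>?\<beta> - s\<bar> \<noteq> \<infinity>"
      unfolding energy_def by auto
    obtain x1 where x1: "ac_part ?g = ennreal x1"
      "\<mu> * (LBINT t:I. ?g t) + (LBINT t:I. e t) \<le> x1"
      "x1 = \<mu> * (LBINT t:I. ?g t) + (LBINT t:I. e t) \<Longrightarrow> AE t in lborel. t \<in> I \<longrightarrow> ?g t = p t"
      using ac_energy[OF g fin(1)] by blast
    obtain x2 where x2: "sing_part ?P = ennreal x2" "\<mu> * measure ?P UNIV \<le> x2"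
      "x2 = \<mu> * measure ?P UNIV \<Longrightarrow> emeasure ?P {t. t \<noteq> m \<or> \<mu>\<^sup>2 < \<theta> m} = 0"
      using singular_energy[OF fb(1) fin(2)] by blast
    obtain x3 where x3: "sing_part ?N = ennreal x3" "\<mu> * measure ?N UNIV \<le> x3"
      using singular_energy[OF fb(2) fin(3)] by blast
    obtain x4 where x4: "\<sigma> * ennreal \<bar>?\<alpha>\<bar> = ennreal x4" "\<mu> * \<bar>?\<alpha>\<bar> \<le> x4" "x4 = \<mu> * \<bar>?\<alpha>\<bar> \<Longrightarrow> ?\<alpha> = 0"
      using boundary_energy_bound[OF \<sigma> lam0 fin(4)] by blast
    obtain x5 where x5: "\<sigma> * ennreal \<bar>?\<beta> - s\<bar> = ennreal x5" "\<mu> * \<bar>?\<beta> - s\<bar> \<le> x5" "x5 = \<mu> * \<bar>?\<beta> - s\<bar> \<Longrightarrow> ?\<beta> - s = 0"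
      using boundary_energy_bound[OF \<sigma> lam0 fin(5)] by blast
    have x1': "energy a b \<theta> \<omega> \<sigma> s w = ennreal x1 + (ennreal x2 + ennreal x3) + ennreal x4 + ennreal x5"
      unfolding energy_def x1 x2 x3 x4 x5 ..
    have nn: "0 \<le> \<mu> * measure ?P UNIV" "0 \<le> \<mu> * measure ?N UNIV" "0 \<le> \<mu> * \<bar>?\<alpha>\<bar>" "0 \<le> \<mu> * \<bar>?\<beta> - s\<bar>"
      using lam0 by auto
    then have pos: "0 \<le> x2" "0 \<le> x3" "0 \<le> x4" "0 \<le> x5" using x2 x3 x4 x5 by linarith+
    \<comment> \<open>At this point \<open>x1\<close> is not known to be nonnegative, and
      \<open>ennreal\<close> sends negative numbers to \<open>0\<close>; hence
      \<open>max 0 x1\<close>.\<close>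
    define X where "X = max 0 x1 + x2 + x3 + x4 + x5"
    have X: "energy a b \<theta> \<omega> \<sigma> s w = ennreal X" "0 \<le> X"
    proof -
      have "ennreal x1 = ennreal (max 0 x1)" by (cases "0 \<le> x1") (auto simp: ennreal_neg)
      then show "energy a b \<theta> \<omega> \<sigma> s w = ennreal X" "0 \<le> X"
        unfolding x1' X_def using pos by (simp_all add: add.assoc)
    qed
    have mass': "\<mu> * ?\<beta> - \<mu> * ?\<alpha> = \<mu> * (LBINT x:I. ?g x) + (\<mu> * measure ?P UNIV - \<mu> * measure ?N UNIV)"
      using arg_cong[OF mass_eq, of "\<lambda>x. \<mu> * x"] by (simp add: algebra_simps)
    have tr: "\<mu> * ?\<alpha> \<le> \<mu> * \<bar>?\<alpha>\<bar>" "\<mu> * s - \<mu> * ?\<beta> \<le> \<mu> * \<bar>?\<beta> - s\<bar>"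
      using lam0 by (simp_all add: right_diff_distrib[symmetric] mult_left_mono)
    have "minval \<le> X" unfolding minval_def X_def using x1(2) x2(2) x3(2) x4(2) x5(2) mass' tr nn by linarith
    then have 1: "ennreal minval \<le> energy a b \<theta> \<omega> \<sigma> s w" using X by (simp add: ennreal_leI)
    have 2: "(AE t in lborel. t \<in> I \<longrightarrow> ac_density a b w t = p t) \<and> (w \<in> W11_on a b \<longleftrightarrow> c = 0)"
      if "energy a b \<theta> \<omega> \<sigma> s w \<le> ennreal minval"
    proof -
      have "0 \<le> minval"
      proof -
        have "0 \<le> (LBINT t:I. p t)" "0 \<le> (LBINT t:I. e t)"
          unfolding set_lebesgue_integral_def using p_nonneg e_nonneg
          by (auto intro!: Bochner_Integration.integral_nonneg simp: indicator_def)
        then show ?thesis unfolding minval_def using mass c0 lam0 by (simp add: p_def[symmetric])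
      qed
      then have le: "X \<le> minval" using that X by simp
      \<comment> \<open>The mass of the negative part is added in the energy but subtracted in the
        mass identity, so it counts twice in the excess and must vanish.\<close>
      have eqs: "x1 = \<mu> * (LBINT t:I. ?g t) + (LBINT t:I. e t)" "x2 = \<mu> * measure ?P UNIV" "\<mu> * measure ?N UNIV = 0"
         "x4 = \<mu> * \<bar>?\<alpha>\<bar>" "x5 = \<mu> * \<bar>?\<beta> - s\<bar>"
        using le x1(2) x2(2) x3(2) x4(2) x5(2) mass' tr nn unfolding minval_def X_def by linarith+
      have AE: "AE t in lborel. t \<in> I \<longrightarrow> ?g t = p t" by (rule x1(3)[OF eqs(1)])
      have gp: "(LBINT t:I. ?g t) = (LBINT t:I. p t)"
        unfolding set_lebesgue_integral_def
      proof (rule integral_cong_AE)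
        show "AE t in lborel. indicator I t *\<^sub>R ?g t = indicator I t *\<^sub>R p t"
          using AE by eventually_elim (auto simp: indicator_def)
      qed (use g p_int' in \<open>auto simp: L1_on_def set_integrable_def\<close>)
      have \<alpha>\<beta>: "?\<alpha> = 0" "?\<beta> = s" using x4(3)[OF eqs(4)] x5(3)[OF eqs(5)] by auto
      have N0: "measure ?N UNIV = 0" using eqs(3) lam0 by simp
      \<comment> \<open>The slopes account for all of \<open>s\<close> except \<open>c\<close>, and
        only the positive singular part is left to carry it.\<close>
      have "measure ?P UNIV = c" using mass_eq gp \<alpha>\<beta> N0 mass by (simp add: p_def)
      moreover have "emeasure M UNIV = ennreal (measure M UNIV)" if "finite_borel_on a b M" for M
        using that finite_measure.emeasure_eq_measure by (auto simp: finite_borel_on_def)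
      ultimately have "w \<in> W11_on a b \<longleftrightarrow> c = 0"
        using derivative_parts_null_iff_W11[OF wL D] fb N0 c0 by simp
      then show ?thesis using AE by blast
    qed
    show ?thesis using 1 2 by blast
  qed
  then show "ennreal minval \<le> energy a b \<theta> \<omega> \<sigma> s w"
    and "energy a b \<theta> \<omega> \<sigma> s w \<le> ennreal minval \<Longrightarrow>
      (AE t in lborel. t \<in> I \<longrightarrow> ac_density a b w t = p t) \<and> (w \<in> W11_on a b \<longleftrightarrow> c = 0)" by auto
qed

text \<open>The competitor is the primitive of the slopes plus a jump of height \<open>c\<close> at
  \<open>m\<close>. By \<open>mass\<close> its traces are \<open>0\<close> and \<open>s\<close>, so
  the boundary terms disappear and every calibration inequality is an equality.\<close>

lemma energy_attained: "\<exists>w \<in> BV_on a b. energy a b \<theta> \<omega> \<sigma> s w = ennreal minval"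
proof -
  define u1 where "u1 x = indicator I x * p x" for x
  define u2 where "u2 x = (if x = m then c else 0)" for x
  \<comment> \<open>The Dirac measure at \<open>m\<close>, against which the jump has the density
    \<open>u2\<close>.\<close>
  define R where "R = distr (count_space {()}) borel (\<lambda>_. m)"
  have fR: "finite_measure R" unfolding R_def by (intro finite_measure.finite_measure_distr finite_measure_count_space) auto
  then have R: "sigma_finite_measure R" "sets R = sets borel" by (auto simp: R_def finite_measure_def)
  have Rint: "integrable R f" "(\<integral>x. f x \<partial>R) = f m" if "f \<in> borel_measurable borel" for f :: "real \<Rightarrow> real"
    using that by (simp_all add: R_def integral_distr integrable_distr_eq lebesgue_integral_count_space_finite integrable_count_space)
  have u1: "integrable lborel u1" "x \<notin> I \<Longrightarrow> u1 x = 0" for x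
    using p_int' by (auto simp: set_integrable_def u1_def[abs_def])
  have [measurable]: "u2 \<in> borel_measurable borel" unfolding u2_def by measurable
  have u2: "integrable R u2" "0 \<le> u2 x" "x \<notin> I \<Longrightarrow> u2 x = 0" for x
    using c0 am mb Rint(1)[of u2] by (auto simp: u2_def)
  define F1 where "F1 x = (\<integral>y. indicator {..x} y * u1 y \<partial>lborel)" for x
  define F2 where "F2 x = (\<integral>y. indicator {..x} y * u2 y \<partial>R)" for x
  define w where "w x = F1 x + F2 x" for x
  have bump: "test_function a b (bump ((a+b)/2) ((a+b)/2) 1)" using ab by (intro test_function_bump) auto
  have ls: "sigma_finite_measure lborel" "sets lborel = sets borel" by (simp_all add: lborel.sigma_finite_measure_axioms)
  note F1 = integral_primitive_deriv_test_function[OF ls u1, folded F1_def]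
  note F2 = integral_primitive_deriv_test_function[OF R u2(1,3), folded F2_def]
  have F1i: "set_integrable lborel I F1" using F1(1)[OF _ bump] by (simp add: F1_def[abs_def])
  have F2i: "set_integrable lborel I F2" using F2(1)[OF _ bump] by (simp add: F2_def[abs_def])
  have wL: "w \<in> L1_on a b" unfolding L1_on_def w_def using set_integral_add(1)[OF F1i F2i] by simp
  define P where "P = density R (\<lambda>x. ennreal (u2 x))"
  have P: "finite_borel_on a b P" "has_real_density R P u2"
    unfolding P_def by (rule finite_borel_on_density[OF R(2) u2(1,2), of a b]; simp add: u2)+
  have Pint: "(\<integral>x. f x \<partial>P) = c * f m" if "f \<in> borel_measurable borel" for f :: "real \<Rightarrow> real"
    using has_real_density_integral(1)[OF P(2) R(2) that] that Rint(2)[of "\<lambda>x. u2 x * f x"] by (simp add: u2_def)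
  have Pm: "emeasure P (- {m}) = 0"
    by (rule emeasure_density_eq_0[OF P(2) R(2)]) (auto simp: u2_def)
  let ?O = "null_measure borel :: real measure"
  have O: "finite_borel_on a b ?O" by (simp add: finite_borel_on_def finite_measureI)
  have D: "derivative_parts a b w p P ?O"
    unfolding derivative_parts_def
  proof (intro conjI allI impI)
    show "p \<in> L1_on a b" using p_int' by (simp add: L1_on_def)
    show "mutually_singular P ?O" "mutually_singular lborel ?O"
      unfolding mutually_singular_def by (auto intro!: bexI[of _ "{}"])
    show "mutually_singular lborel P" unfolding mutually_singular_def using Pm by (intro bexI[of _ "{m}"]) auto
    fix f assume f: "test_function a b f"
    note [measurable] = test_function_measurable[OF f]
    have i: "set_integrable lborel I (\<lambda>x. g x * deriv f x)" if "set_integrable lborel I g" for g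
      using integrable_mult_test_function(2)[OF f that[unfolded set_integrable_def]]
      by (simp add: set_integrable_def mult_ac)
    have "(LBINT x:I. w x * deriv f x) = (LBINT x:I. F1 x * deriv f x) + (LBINT x:I. F2 x * deriv f x)"
      unfolding w_def distrib_right by (rule set_integral_add(2)[OF i[OF F1i] i[OF F2i]])
    also have "(LBINT x:I. F1 x * deriv f x) = - (LBINT x:I. p x * f x)"
      using F1(2)[OF _ f] by (simp add: F1_def set_lebesgue_integral_def u1_def mult_ac)
    also have "(LBINT x:I. F2 x * deriv f x) = - (\<integral>x. f x * u2 x \<partial>R)"
      using F2(2)[OF _ f] by (simp add: F2_def)
    also have "(\<integral>x. f x * u2 x \<partial>R) = (\<integral>x. f x \<partial>P)"
      using Pint[of f] Rint(2)[of "\<lambda>x. f x * u2 x"] by (simp add: u2_def)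
    finally show "(LBINT x:I. w x * deriv f x) = - ((LBINT x:I. p x * f x) + ((\<integral>x. f x \<partial>P) - (\<integral>x. f x \<partial>?O)))"
      by (simp add: integral_null_measure)
  qed (use P O in auto)
  have BV: "w \<in> BV_on a b" by (rule derivative_parts_imp_BV_on[OF wL D])
  note U = derivative_parts_unique[OF BV_on_canonical_parts[OF BV] D]
  have lim: "(w \<longlongrightarrow> 0 + 0) (at_right a)" "(w \<longlongrightarrow> (\<integral>x. u1 x \<partial>lborel) + (\<integral>x. u2 x \<partial>R)) (at_left b)"
    unfolding w_def F1_def F2_def
    by (intro tendsto_add primitive_tendsto[OF ls(2) u1 ab] primitive_tendsto[OF R(2) u2(1,3) ab]; simp)+
  have tr: "right_trace w a = 0" "left_trace w b = s"
    using right_trace_eq[OF lim(1) _ ab, of w] left_trace_eq[OF lim(2) _ ab, of w] mass Rint(2)[of u2]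
    by (auto simp: u1_def set_lebesgue_integral_def p_def u2_def)
  have E1: "ac_part (ac_density a b w)
      = ennreal (\<mu> * (LBINT t:I. p t) + (LBINT t:I. e t))"
  proof -
    have pi: "integrable lborel (\<lambda>t. indicator I t * p t)" "integrable lborel (\<lambda>t. indicator I t * e t)"
      using p_int' e_int by (auto simp: set_integrable_def)
    have "ac_part (ac_density a b w)
       = (\<integral>\<^sup>+ t. ennreal (\<mu> * (indicator I t * p t) + indicator I t * e t) \<partial>lborel)"
    proof (rule nn_integral_cong_AE)
      show "AE t in lborel. ennreal (sqrt (\<theta> t * \<bar>ac_density a b w t\<bar>\<^sup>2 + \<omega> t)) * indicator I t =
          ennreal (\<mu> * (indicator I t * p t) + indicator I t * e t)"
        using U(3) AE_neq_m
      proof eventually_elim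
        case (elim t)
        then show ?case using integrand_ge(2)[of t "p t"] by (cases "t \<in> I") auto
      qed
    qed
    also have "\<dots> = ennreal (\<integral>t. \<mu> * (indicator I t * p t) + indicator I t * e t \<partial>lborel)"
      using pi lam0 p_nonneg e_nonneg by (intro nn_integral_eq_integral) (auto simp: indicator_def)
    also have "(\<integral>t. \<mu> * (indicator I t * p t) + indicator I t * e t \<partial>lborel) = \<mu> * (LBINT t:I. p t) + (LBINT t:I. e t)"
      using pi by (simp add: set_lebesgue_integral_def)
    finally show ?thesis .
  qed
  have E2: "sing_part P = ennreal (\<mu> * c)"
  proof -
    note [measurable_cong] = R(2)
    have "(\<lambda>t. sqrt (indicator I t * \<theta> t)) = (\<lambda>t. indicator I t * sqrt (\<theta> t))" by (auto simp: indicator_def)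
    moreover have "(\<lambda>t. sqrt (indicator I t * \<theta> t)) \<in> borel_measurable borel" by measurable
    ultimately have m0: "(\<lambda>t. indicator I t * sqrt (\<theta> t)) \<in> borel_measurable borel" by simp
    have "sing_part P = (\<integral>\<^sup>+ t. ennreal (indicator I t * sqrt (\<theta> t)) \<partial>P)"
      by (intro nn_integral_cong) (auto simp: indicator_def)
    also have "\<dots> = (\<integral>\<^sup>+ t. ennreal (u2 t) * ennreal (indicator I t * sqrt (\<theta> t)) \<partial>R)"
      unfolding P_def using m0 by (subst nn_integral_density) auto
    also have "\<dots> = ennreal (u2 m) * ennreal (indicator I m * sqrt (\<theta> m))"
      unfolding R_def using m0 by (subst nn_integral_distr) (auto simp: nn_integral_count_space_finite)
    \<comment> \<open>Either there is no jump, or \<open>c_pos\<close> makes it cost exactly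
      \<open>\<mu>\<close> per unit height.\<close>
    also have "\<dots> = ennreal (\<mu> * c)"
      using c_pos c0 am mb lam0 by (cases "c = 0") (auto simp: u2_def ennreal_mult[symmetric] mult.commute)
    finally show ?thesis .
  qed
  have nn: "0 \<le> (LBINT t:I. p t)" "0 \<le> (LBINT t:I. e t)"
    unfolding set_lebesgue_integral_def using p_nonneg e_nonneg
    by (auto intro!: Bochner_Integration.integral_nonneg simp: indicator_def)
  have "energy a b \<theta> \<omega> \<sigma> s w = ennreal (\<mu> * (LBINT t:I. p t) + (LBINT t:I. e t)) + ennreal (\<mu> * c)"
    unfolding energy_def E1 U(1) E2 U(2) tr by (simp add: nn_integral_null_measure)
  also have "\<dots> = ennreal minval"
  proof -
    have s: "s = (LBINT t:I. p t) + c" using mass unfolding p_def by simp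
    have "minval = (\<mu> * (LBINT t:I. p t) + (LBINT t:I. e t)) + \<mu> * c" by (subst minval_def, subst s, simp add: algebra_simps)
    moreover have "0 \<le> \<mu> * (LBINT t:I. p t) + (LBINT t:I. e t)" "0 \<le> \<mu> * c" using nn c0 lam0 by auto
    ultimately show ?thesis by (simp only: ennreal_plus)
  qed
  finally show ?thesis using BV by blast
qed

end

section \<open>The multiplier\<close>

text \<open>Dominated convergence for a continuous parameter, reduced to sequences. The index is
  later a multiplier in an interval or an ordered pair of parameters.\<close>

lemma tendsto_integral_dominated:
  fixes F :: "'a::first_countable_topology \<Rightarrow> 'b \<Rightarrow> real"
  assumes "y \<in> S" and meas: "\<And>z. z \<in> S \<Longrightarrow> F z \<in> borel_measurable M" and w: "integrable M w"
    and bound: "\<And>z. z \<in> S \<Longrightarrow> AE x in M. \<bar>F z x\<bar> \<le> w x"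
    and lim: "AE x in M. ((\<lambda>z. F z x) \<longlongrightarrow> F y x) (at y within S)"
  shows "((\<lambda>z. \<integral>x. F z x \<partial>M) \<longlongrightarrow> (\<integral>x. F y x \<partial>M)) (at y within S)"
proof (unfold tendsto_at_iff_sequentially, intro allI impI)
  fix X :: "nat \<Rightarrow> 'a" assume X: "\<forall>i. X i \<in> S - {y}" "X \<longlonglongrightarrow> y"
  have "(\<lambda>i. \<integral>x. F (X i) x \<partial>M) \<longlonglongrightarrow> (\<integral>x. F y x \<partial>M)"
  proof (rule integral_dominated_convergence[OF _ _ w])
    show "AE x in M. (\<lambda>i. F (X i) x) \<longlonglongrightarrow> F y x"
      using lim by eventually_elim (use X in \<open>auto simp: tendsto_at_iff_sequentially o_def\<close>)
    show "AE x in M. norm (F (X i) x) \<le> w x" for i using bound[of "X i"] X by auto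
  qed (use meas X \<open>y \<in> S\<close> in auto)
  then show "((\<lambda>z. \<integral>x. F z x \<partial>M) \<circ> X) \<longlonglongrightarrow> (\<integral>x. F y x \<partial>M)" by (simp add: o_def)
qed

text \<open>The reflection \<open>2 * m - t\<close> exchanges the two halves, and the point
  \<open>m\<close> is null. For \<open>b = 1\<close> the interval is that of the functional, which
  is the origin of every factor 2 below.\<close>

lemma set_integral_even_reflection:
  fixes H :: "real \<Rightarrow> real"
  assumes "set_integrable lborel {m<..<b} H"
  shows "set_integrable lborel {2 * m - b<..<b} (\<lambda>t. H (m + \<bar>t - m\<bar>))"
    "(LBINT t:{2 * m - b<..<b}. H (m + \<bar>t - m\<bar>)) = 2 * (LBINT t:{m<..<b}. H t)"
proof -
  define h where "h t = indicator {m<..<b} t * H t" for t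
  have h: "integrable lborel h" using assms by (simp add: h_def[abs_def] set_integrable_def)
  then have [measurable]: "h \<in> borel_measurable borel" by auto
  have h': "integrable lborel (\<lambda>t. h (2 * m + (-1) * t))" "(\<integral>t. h (2 * m + (-1) * t) \<partial>lborel) = (\<integral>t. h t \<partial>lborel)"
    using lborel_integrable_real_affine[OF h, of "-1" "2 * m"] lborel_integral_real_affine[of "-1" h "2 * m"] by auto
  have eq: "indicator {2 * m - b<..<b} t *\<^sub>R H (m + \<bar>t - m\<bar>) = h t + h (2 * m + (-1) * t)" if "t \<noteq> m" for t
  proof (cases "m < t")
    case True
    then show ?thesis by (auto simp: h_def indicator_def)
  next
    case False
    then have "m + \<bar>t - m\<bar> = 2 * m - t" using that by simp
    then show ?thesis using False that by (auto simp: h_def indicator_def)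
  qed
  have AE: "AE t in lborel. indicator {2 * m - b<..<b} t *\<^sub>R H (m + \<bar>t - m\<bar>) = h t + h (2 * m + (-1) * t)"
    using AE_lborel_singleton[of m] by eventually_elim (rule eq)
  have sum: "integrable lborel (\<lambda>t. h t + h (2 * m + (-1) * t))" using h h' by simp
  have m0: "(\<lambda>t. indicator {2 * m - b<..<b} t *\<^sub>R H (m + \<bar>t - m\<bar>)) \<in> borel_measurable borel"
  proof -
    have "(\<lambda>t. indicator {2 * m - b<..<b} t *\<^sub>R H (m + \<bar>t - m\<bar>)) =
      (\<lambda>t. if t = m then indicator {2 * m - b<..<b} m *\<^sub>R H m else h t + h (2 * m + (-1) * t))"
      using eq by auto
    also have "\<dots> \<in> borel_measurable borel" by measurable
    finally show ?thesis .
  qed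
  show "set_integrable lborel {2 * m - b<..<b} (\<lambda>t. H (m + \<bar>t - m\<bar>))"
    unfolding set_integrable_def using sum m0 by (subst integrable_cong_AE[OF _ _ AE]) auto
  have "(LBINT t:{2 * m - b<..<b}. H (m + \<bar>t - m\<bar>)) = (\<integral>t. h t + h (2 * m + (-1) * t) \<partial>lborel)"
    unfolding set_lebesgue_integral_def using m0 by (intro integral_cong_AE[OF _ _ AE]) auto
  also have "\<dots> = 2 * (\<integral>t. h t \<partial>lborel)" using h h' by simp
  finally show "(LBINT t:{2 * m - b<..<b}. H (m + \<bar>t - m\<bar>)) = 2 * (LBINT t:{m<..<b}. H t)"
    by (simp add: set_lebesgue_integral_def h_def[abs_def])
qed

lemma set_integrable_continuous_bounded:
  fixes f :: "real \<Rightarrow> real"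
  assumes "continuous_on {x<..<y} f" "\<And>t. t \<in> {x<..<y} \<Longrightarrow> \<bar>f t\<bar> \<le> C"
  shows "set_integrable lborel {x<..<y} f"
  unfolding set_integrable_def
proof (rule Bochner_Integration.integrable_bound)
  show "integrable lborel (\<lambda>t. indicator {x<..<y} t * C)"
    by (intro integrable_mult_left integrable_real_indicator) (cases "x \<le> y"; simp)+
  show "(\<lambda>t. indicator {x<..<y} t *\<^sub>R f t) \<in> borel_measurable lborel"
    using borel_measurable_continuous_on_indicator[OF _ assms(1)] by simp
  have "\<bar>f t\<bar> \<le> \<bar>C\<bar>" if "t \<in> {x<..<y}" for t using assms(2)[OF that] by linarith
  then show "AE t in lborel. norm (indicator {x<..<y} t *\<^sub>R f t) \<le> norm (indicator {x<..<y} t * C)"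
    by (intro AE_I2) (auto simp: indicator_def)
qed

text \<open>The data after folding about \<open>m\<close>, with \<open>\<rho> t\<close> in the role
  of the square root of \<open>\<omega> (1 - t)\<close>. Everything is restricted to the open
  interval, because \<open>\<theta>\<close> vanishes at \<open>0\<close> and may be unbounded near
  \<open>1\<close>.\<close>

locale profile =
  fixes \<theta> \<rho> :: "real \<Rightarrow> real" and B :: real
  assumes \<theta>_cont: "continuous_on {0<..<1} \<theta>" and \<theta>_pos: "\<And>t. t \<in> {0<..<1} \<Longrightarrow> 0 < \<theta> t"
    and \<theta>_mono: "strict_mono_on {0<..<1} \<theta>"
    and \<rho>_cont: "continuous_on {0<..<1} \<rho>" and \<rho>_pos: "\<And>t. t \<in> {0<..<1} \<Longrightarrow> 0 < \<rho> t"
    and \<rho>_le: "\<And>t. t \<in> {0<..<1} \<Longrightarrow> \<rho> t \<le> B"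
begin

text \<open>\<open>\<mu> / sqrt (\<theta> t)\<close> and \<open>cosine \<mu> t\<close> are the
  components of the unit vector in the Cauchy-Schwarz step. All singular behaviour of the slopes as
  \<open>\<mu>\<^sup>2\<close> approaches \<open>\<theta> t\<close> sits in the factor
  \<open>1 / cosine \<mu> t\<close>.\<close>

definition cosine :: "real \<Rightarrow> real \<Rightarrow> real" where "cosine \<mu> t = sqrt (1 - \<mu>\<^sup>2 / \<theta> t)"
definition slope :: "real \<Rightarrow> real \<Rightarrow> real" where "slope \<mu> t = \<rho> t / \<theta> t * (\<mu> / cosine \<mu> t)"
definition dual :: "real \<Rightarrow> real \<Rightarrow> real" where "dual \<mu> t = \<rho> t * cosine \<mu> t"
definition halfmass :: "real \<Rightarrow> real \<Rightarrow> real" where "halfmass m \<mu> = (LBINT t:{m<..<1}. slope \<mu> t)"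
definition optval :: "real \<Rightarrow> real \<Rightarrow> real \<Rightarrow> real" where "optval s m \<mu> = \<mu> * s + 2 * (LBINT t:{m<..<1}. dual \<mu> t)"

lemma \<theta>_less: "0 < x \<Longrightarrow> x < y \<Longrightarrow> y < 1 \<Longrightarrow> \<theta> x < \<theta> y"
  using \<theta>_mono by (auto simp: strict_mono_on_def)

lemma lt_\<theta>: "0 < m \<Longrightarrow> \<mu>\<^sup>2 \<le> \<theta> m \<Longrightarrow> m < t \<Longrightarrow> t < 1 \<Longrightarrow> \<mu>\<^sup>2 < \<theta> t"
  using \<theta>_less[of m t] by simp

lemma B_pos: "0 < B" using \<rho>_pos[of "1/2"] \<rho>_le[of "1/2"] by simp

lemma cosine_pos: "t \<in> {0<..<1} \<Longrightarrow> \<mu>\<^sup>2 < \<theta> t \<Longrightarrow> 0 < cosine \<mu> t"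
  using \<theta>_pos[of t] by (simp add: cosine_def)

lemma cosine_nonneg: "t \<in> {0<..<1} \<Longrightarrow> \<mu>\<^sup>2 \<le> \<theta> t \<Longrightarrow> 0 \<le> cosine \<mu> t"
  using \<theta>_pos[of t] by (simp add: cosine_def)

lemma cosine_le_1: "t \<in> {0<..<1} \<Longrightarrow> cosine \<mu> t \<le> 1"
  using \<theta>_pos[of t] by (simp add: cosine_def)

text \<open>This remains true where the radicand is negative, because \<open>sqrt\<close> is
  increasing on the whole line.\<close>

lemma cosine_antimono: "t \<in> {0<..<1} \<Longrightarrow> 0 \<le> \<mu> \<Longrightarrow> \<mu> \<le> \<nu> \<Longrightarrow> cosine \<nu> t \<le> cosine \<mu> t"
  using \<theta>_pos[of t] by (simp add: cosine_def divide_right_mono power_mono)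

lemma cosine_power2: "t \<in> {0<..<1} \<Longrightarrow> \<mu>\<^sup>2 \<le> \<theta> t \<Longrightarrow> (cosine \<mu> t)\<^sup>2 = 1 - \<mu>\<^sup>2 / \<theta> t"
  using \<theta>_pos[of t] by (simp add: cosine_def)

lemma slope_nonneg: "t \<in> {0<..<1} \<Longrightarrow> \<mu>\<^sup>2 \<le> \<theta> t \<Longrightarrow> 0 \<le> \<mu> \<Longrightarrow> 0 \<le> slope \<mu> t"
  using \<theta>_pos[of t] \<rho>_pos[of t] cosine_nonneg[of t \<mu>] by (simp add: slope_def)

lemma slope_pos: "t \<in> {0<..<1} \<Longrightarrow> \<mu>\<^sup>2 < \<theta> t \<Longrightarrow> 0 < \<mu> \<Longrightarrow> 0 < slope \<mu> t"
  using \<theta>_pos[of t] \<rho>_pos[of t] cosine_pos[of t \<mu>] by (simp add: slope_def)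

lemma slope_mono:
  assumes "t \<in> {0<..<1}" "0 \<le> \<mu>" "\<mu> \<le> \<nu>" "\<nu>\<^sup>2 < \<theta> t" shows "slope \<mu> t \<le> slope \<nu> t"
proof -
  have "\<mu> / cosine \<mu> t \<le> \<nu> / cosine \<nu> t"
    using assms cosine_antimono[of t \<mu> \<nu>] cosine_pos[of t \<nu>] by (intro frac_le) auto
  then show ?thesis unfolding slope_def
    using \<theta>_pos[OF assms(1)] \<rho>_pos[OF assms(1)] by (intro mult_left_mono) auto
qed

lemma slope_eq:
  assumes "t \<in> {0<..<1}" "\<mu>\<^sup>2 < \<theta> t" "0 \<le> \<mu>" "\<rho> t = sqrt w" "0 \<le> w"
  shows "sqrt (\<mu>\<^sup>2 * w / (\<theta> t * (\<theta> t - \<mu>\<^sup>2))) = slope \<mu> t"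
proof (rule real_sqrt_unique)
  have "(slope \<mu> t)\<^sup>2 = w / (\<theta> t)\<^sup>2 * (\<mu>\<^sup>2 / (1 - \<mu>\<^sup>2 / \<theta> t))"
    using assms cosine_power2[of t \<mu>] by (simp add: slope_def power_mult_distrib power_divide)
  also have "\<dots> = \<mu>\<^sup>2 * w / (\<theta> t * (\<theta> t - \<mu>\<^sup>2))"
    using \<theta>_pos[OF assms(1)] assms(2) by (simp add: divide_simps power2_eq_square) 
  finally show "(slope \<mu> t)\<^sup>2 = \<mu>\<^sup>2 * w / (\<theta> t * (\<theta> t - \<mu>\<^sup>2))" .
qed (use slope_nonneg[of t \<mu>] assms in auto)

lemma continuous_on_cosine:
  assumes "0 \<le> m" "b \<le> 1" shows "continuous_on {m<..<b} (cosine \<mu>)"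
proof -
  have "continuous_on {m<..<b} \<theta>" by (rule continuous_on_subset[OF \<theta>_cont]) (use assms in auto)
  moreover have "\<theta> t \<noteq> 0" if "t \<in> {m<..<b}" for t using \<theta>_pos[of t] that assms by auto
  ultimately show ?thesis unfolding cosine_def by (intro continuous_intros) auto
qed

lemma continuous_on_\<theta>_\<rho>:
  assumes "0 \<le> m" "b \<le> 1" shows "continuous_on {m<..<b} \<theta>" "continuous_on {m<..<b} \<rho>"
  by (rule continuous_on_subset[OF \<theta>_cont] continuous_on_subset[OF \<rho>_cont]; use assms in auto)+

lemma continuous_on_slope:
  assumes "0 < m" "b \<le> 1" "\<mu>\<^sup>2 \<le> \<theta> m" shows "continuous_on {m<..<b} (slope \<mu>)"
proof -
  have "\<theta> t \<noteq> 0" "cosine \<mu> t \<noteq> 0" if "t \<in> {m<..<b}" for t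
    using \<theta>_pos[of t] cosine_pos[of t \<mu>] lt_\<theta>[OF assms(1,3)] that assms by force+
  then show ?thesis unfolding slope_def
    using continuous_on_cosine[of m b \<mu>] continuous_on_\<theta>_\<rho>[of m b] assms by (intro continuous_intros) auto
qed

lemma continuous_on_dual: assumes "0 \<le> m" "b \<le> 1" shows "continuous_on {m<..<b} (dual \<mu>)"
  unfolding dual_def using continuous_on_cosine[OF assms] continuous_on_\<theta>_\<rho>[OF assms] by (intro continuous_intros)

lemma measurable_slope: "0 < m \<Longrightarrow> b \<le> 1 \<Longrightarrow> \<mu>\<^sup>2 \<le> \<theta> m \<Longrightarrow> (\<lambda>t. indicator {m<..<b} t * slope \<mu> t) \<in> borel_measurable borel"
  using borel_measurable_continuous_on_indicator[OF _ continuous_on_slope] by simp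

lemma dual_bound: "t \<in> {0<..<1} \<Longrightarrow> \<mu>\<^sup>2 \<le> \<theta> t \<Longrightarrow> \<bar>dual \<mu> t\<bar> \<le> B"
  using mult_mono[OF \<rho>_le[of t] cosine_le_1[of t \<mu>]] \<rho>_pos[of t] cosine_nonneg[of t \<mu>] B_pos by (simp add: dual_def)

lemma dual_integrable: "0 < m \<Longrightarrow> b \<le> 1 \<Longrightarrow> \<mu>\<^sup>2 \<le> \<theta> m \<Longrightarrow> set_integrable lborel {m<..<b} (dual \<mu>)"
  using continuous_on_dual[of m b \<mu>] dual_bound[of _ \<mu>] lt_\<theta>[of m \<mu>]
  by (intro set_integrable_continuous_bounded[where C=B]) (auto simp: less_imp_le)

lemma cosine_lower:
  assumes "0 < m" "\<mu>\<^sup>2 < \<theta> m" "m \<le> t" "t < 1" shows "cosine \<mu> m \<le> cosine \<mu> t"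
proof -
  have "\<theta> m \<le> \<theta> t" using \<theta>_less[of m t] assms by (cases "m = t") auto
  then show ?thesis using \<theta>_pos[of m] assms by (simp add: cosine_def divide_left_mono)
qed

text \<open>Both \<open>\<theta>\<close> and the cosine increase in \<open>t\<close>, so the
  denominators are smallest at the left end. The bound degenerates as the gap between
  \<open>\<mu>\<^sup>2\<close> and \<open>\<theta> m\<close> closes.\<close>

lemma slope_bound:
  assumes "0 < m" "\<mu>\<^sup>2 < \<theta> m" "0 \<le> \<mu>" "m \<le> t" "t < 1"
  shows "\<bar>slope \<mu> t\<bar> \<le> B / \<theta> m * (\<mu> / cosine \<mu> m)"
proof -
  have \<theta>: "\<theta> m \<le> \<theta> t" "0 < \<theta> m" using \<theta>_less[of m t] \<theta>_pos[of m] assms by (cases "m = t"; auto)+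
  have c: "cosine \<mu> m \<le> cosine \<mu> t" "0 < cosine \<mu> m" using cosine_lower[of m \<mu> t] cosine_pos[of m \<mu>] assms by auto
  have t: "t \<in> {0<..<1}" using assms by auto
  have "\<rho> t / \<theta> t * (\<mu> / cosine \<mu> t) \<le> B / \<theta> m * (\<mu> / cosine \<mu> m)"
    using \<theta> c assms \<rho>_le[OF t] \<rho>_pos[OF t] B_pos by (intro mult_mono frac_le divide_nonneg_nonneg) auto
  then show ?thesis using slope_nonneg[OF t, of \<mu>] \<theta> assms by (simp add: slope_def)
qed

lemma slope_integrable:
  assumes "0 < m" "b \<le> 1" "\<mu>\<^sup>2 < \<theta> m" "0 \<le> \<mu>" shows "set_integrable lborel {m<..<b} (slope \<mu>)"
  using continuous_on_slope[of m b \<mu>] slope_bound[of m \<mu>] assms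
  by (intro set_integrable_continuous_bounded[where C="B / \<theta> m * (\<mu> / cosine \<mu> m)"]) auto

text \<open>Slopes increase with the multiplier, so the slope for the largest one,
  \<open>\<nu>\<close>, is an integrable majorant.\<close>

lemma continuous_on_halfmass:
  assumes "0 < m" "m < 1" "\<nu>\<^sup>2 < \<theta> m" "0 \<le> \<nu>"
  shows "continuous_on {0..\<nu>} (halfmass m)"
  unfolding continuous_on_def
proof
  fix \<mu> assume \<mu>: "\<mu> \<in> {0..\<nu>}"
  have sq: "z\<^sup>2 < \<theta> m" if "z \<in> {0..\<nu>}" for z
  proof -
    have "z\<^sup>2 \<le> \<nu>\<^sup>2" using that by (intro power_mono) auto
    then show ?thesis using assms by simp
  qed
  show "(halfmass m \<longlongrightarrow> halfmass m \<mu>) (at \<mu> within {0..\<nu>})"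
    unfolding halfmass_def set_lebesgue_integral_def
  proof (rule tendsto_integral_dominated[OF \<mu>, where w="\<lambda>t. indicator {m<..<1} t *\<^sub>R slope \<nu> t"])
    show "(\<lambda>t. indicator {m<..<1} t *\<^sub>R slope z t) \<in> borel_measurable lborel" if "z \<in> {0..\<nu>}" for z
      using measurable_slope[of m 1 z] assms sq[OF that] by simp
    show "integrable lborel (\<lambda>t. indicator {m<..<1} t *\<^sub>R slope \<nu> t)"
      using slope_integrable[of m 1 \<nu>] assms by (simp add: set_integrable_def)
    show "AE t in lborel. \<bar>indicator {m<..<1} t *\<^sub>R slope z t\<bar> \<le> indicator {m<..<1} t *\<^sub>R slope \<nu> t" if "z \<in> {0..\<nu>}" for z
    proof (rule AE_I2)
      fix t show "\<bar>indicator {m<..<1} t *\<^sub>R slope z t\<bar> \<le> indicator {m<..<1} t *\<^sub>R slope \<nu> t"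
        using slope_mono[of t z \<nu>] slope_nonneg[of t z] lt_\<theta>[of m \<nu> t] lt_\<theta>[of m z t] sq[OF that] that assms
        by (cases "t \<in> {m<..<1}") auto
    qed
    show "AE t in lborel. ((\<lambda>z. indicator {m<..<1} t *\<^sub>R slope z t) \<longlongrightarrow> indicator {m<..<1} t *\<^sub>R slope \<mu> t) (at \<mu> within {0..\<nu>})"
    proof (rule AE_I2)
      fix t show "((\<lambda>z. indicator {m<..<1} t *\<^sub>R slope z t) \<longlongrightarrow> indicator {m<..<1} t *\<^sub>R slope \<mu> t) (at \<mu> within {0..\<nu>})"
      proof (cases "t \<in> {m<..<1}")
        case True
        then have "cosine \<mu> t \<noteq> 0" "\<theta> t \<noteq> 0"
          using cosine_pos[of t \<mu>] \<theta>_pos[of t] lt_\<theta>[of m \<mu> t] sq[OF \<mu>] assms by auto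
        then show ?thesis unfolding slope_def cosine_def by (intro tendsto_intros) auto
      qed simp
    qed
  qed
qed

text \<open>Either the full slope has mass at most \<open>s\<close>, and the rest is a jump, or the intermediate
  value theorem applies; the total slope tends to that for \<open>\<theta> m\<close> by Fatou's lemma.\<close>

lemma ex_multiplier:
  assumes m: "0 < m" "m < 1" and s: "0 < s"
  obtains \<mu> where "0 < \<mu>" "\<mu>\<^sup>2 \<le> \<theta> m" "set_integrable lborel {m<..<1} (slope \<mu>)" "2 * halfmass m \<mu> \<le> s"
    "\<mu>\<^sup>2 < \<theta> m \<Longrightarrow> 2 * halfmass m \<mu> = s"
proof -
  define \<kappa> where "\<kappa> = sqrt (\<theta> m)"
  have \<kappa>: "0 < \<kappa>" "\<kappa>\<^sup>2 = \<theta> m" using \<theta>_pos[of m] m by (auto simp: \<kappa>_def)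
  \<comment> \<open>The mass as an extended integral: at \<open>\<kappa>\<close> the slope need not
    be integrable, and infinite mass then falls under the second case.\<close>
  define N where "N \<mu> = (\<integral>\<^sup>+t. ennreal (indicator {m<..<1} t * slope \<mu> t) \<partial>lborel)" for \<mu>
  have nn: "0 \<le> indicator {m<..<1} t * slope \<mu> t" if "0 \<le> \<mu>" "\<mu>\<^sup>2 \<le> \<theta> m" for \<mu> t
    using slope_nonneg[of t \<mu>] lt_\<theta>[of m \<mu> t] that m by (cases "t \<in> {m<..<1}") auto
  have N: "N \<mu> = ennreal (halfmass m \<mu>)" if "set_integrable lborel {m<..<1} (slope \<mu>)" "0 \<le> \<mu>" "\<mu>\<^sup>2 \<le> \<theta> m" for \<mu>
    unfolding N_def halfmass_def set_lebesgue_integral_def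
    using that nn by (subst nn_integral_eq_integral) (auto simp: set_integrable_def)
  show ?thesis
  proof (cases "N \<kappa> \<le> ennreal (s / 2)")
    case True
    then have "N \<kappa> < \<infinity>" by (simp add: order_le_less_trans)
    then have i: "set_integrable lborel {m<..<1} (slope \<kappa>)"
      unfolding set_integrable_def N_def
      using measurable_slope[of m 1 \<kappa>] nn \<kappa> m by (intro integrableI_nonneg) auto
    then have "2 * halfmass m \<kappa> \<le> s" using N[OF i] \<kappa> True s by (simp add: ennreal_le_iff)
    then show ?thesis using that[of \<kappa>] i \<kappa> by simp
  next
    case False
    \<comment> \<open>Multipliers approaching \<open>\<kappa>\<close> from strictly below, where the
      slopes are integrable. One of them already has mass above \<open>s / 2\<close>, and multiplier
      \<open>0\<close> has mass \<open>0\<close>.\<close>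
    define \<mu> where "\<mu> n = \<kappa> * (1 - 1 / Suc n)" for n
    have \<mu>: "0 \<le> \<mu> n" "(\<mu> n)\<^sup>2 < \<theta> m" for n
    proof -
      have "0 \<le> 1 - 1 / real (Suc n)" "1 - 1 / real (Suc n) < 1" by simp_all
      then have "0 \<le> \<mu> n" "\<mu> n < \<kappa>" using \<kappa> by (simp_all add: \<mu>_def)
      then show "0 \<le> \<mu> n" "(\<mu> n)\<^sup>2 < \<theta> m" using power_strict_mono[of "\<mu> n" \<kappa> 2] \<kappa> by auto
    qed
    have \<mu>lim: "\<mu> \<longlonglongrightarrow> \<kappa>"
    proof -
      have "(\<lambda>n. 1 / real (Suc n)) \<longlonglongrightarrow> 0" using LIMSEQ_Suc[OF lim_1_over_n] by simp
      from tendsto_mult[OF tendsto_const[of \<kappa>] tendsto_diff[OF tendsto_const[of 1] this]] show ?thesis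
        by (simp add: \<mu>_def[abs_def])
    qed
    have "N \<kappa> = (\<integral>\<^sup>+t. liminf (\<lambda>n. ennreal (indicator {m<..<1} t * slope (\<mu> n) t)) \<partial>lborel)"
      unfolding N_def
    proof (rule nn_integral_cong)
      fix t
      have "(\<lambda>n. indicator {m<..<1} t * slope (\<mu> n) t) \<longlonglongrightarrow> indicator {m<..<1} t * slope \<kappa> t"
      proof (cases "t \<in> {m<..<1}")
        case True
        then have "cosine \<kappa> t \<noteq> 0" "\<theta> t \<noteq> 0"
          using cosine_pos[of t \<kappa>] \<theta>_pos[of t] lt_\<theta>[of m \<kappa> t] \<kappa> m by auto
        then show ?thesis unfolding slope_def cosine_def by (intro tendsto_intros \<mu>lim) auto
      qed simp
      then have "(\<lambda>n. ennreal (indicator {m<..<1} t * slope (\<mu> n) t)) \<longlonglongrightarrow> ennreal (indicator {m<..<1} t * slope \<kappa> t)"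
        by (rule tendsto_ennrealI)
      from lim_imp_Liminf[OF _ this]
      show "ennreal (indicator {m<..<1} t * slope \<kappa> t) = liminf (\<lambda>n. ennreal (indicator {m<..<1} t * slope (\<mu> n) t))" by simp
    qed
    also have "\<dots> \<le> liminf (\<lambda>n. N (\<mu> n))"
      unfolding N_def using measurable_slope[of m 1] \<mu> m by (intro nn_integral_liminf) (auto simp: less_imp_le)
    finally have "ennreal (s / 2) < liminf (\<lambda>n. N (\<mu> n))" using False by simp
    then have "\<forall>\<^sub>F n in sequentially. ennreal (s / 2) < N (\<mu> n)" by (rule less_LiminfD)
    then obtain n where n: "ennreal (s / 2) < N (\<mu> n)" by (auto simp: eventually_sequentially)
    have i: "set_integrable lborel {m<..<1} (slope (\<mu> n))" using slope_integrable[of m 1 "\<mu> n"] \<mu> m by simp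
    have "s / 2 < halfmass m (\<mu> n)" using n N[OF i] \<mu> s by (simp add: ennreal_less_iff less_imp_le)
    moreover have "halfmass m 0 = 0" by (simp add: halfmass_def slope_def)
    ultimately obtain \<nu> where \<nu>: "0 \<le> \<nu>" "\<nu> \<le> \<mu> n" "halfmass m \<nu> = s / 2"
      using IVT'[of "halfmass m" 0 "s / 2" "\<mu> n"] continuous_on_halfmass[OF m, of "\<mu> n"] \<mu> s by auto
    have "\<nu>\<^sup>2 < \<theta> m" using power_mono[OF \<nu>(2,1), of 2] \<mu>(2)[of n] by linarith
    moreover have "0 < \<nu>" using \<nu> \<open>halfmass m 0 = 0\<close> s by (cases "\<nu> = 0") auto
    ultimately show ?thesis using that[of \<nu>] slope_integrable[of m 1 \<nu>] \<nu> m by simp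
  qed
qed

end

section \<open>Minimizers for admissible data\<close>

lemma scG_eq_energy:
  "scG l Q \<omega> m s w = (if w \<in> BV_on (2 * m - 1) 1
     then energy (2 * m - 1) 1 (theta_m l Q \<omega> m) (omega_m \<omega> m) (sqrt_theta_end l Q \<omega>) s w else \<infinity>)"
  by (simp add: scG_def energy_def Let_def)

section \<open>Verification of the calibration hypotheses for admissible data\<close>

context admissible_data
begin

abbreviation "\<theta> \<equiv> theta l Q \<omega>"
abbreviation "\<rho> \<equiv> \<lambda>t. sqrt (\<omega> (1 - t))"

lemma theta_continuous: "continuous_on {0..<1} \<theta>"
proof -
  have 1: "continuous_on {0..<1} (\<lambda>t. f (1 - t))" if "continuous_on {0..1} f" for f :: "real \<Rightarrow> real"
    by (rule continuous_on_compose2[OF that]) (auto intro!: continuous_intros)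
  have "Q (1 - t) \<noteq> 0" if "t \<in> {0..<1}" for t using Q_zero[of "1 - t"] that by auto
  then show ?thesis unfolding theta_def
    by (intro continuous_intros 1[OF omega_cont] 1[OF Q_cont] continuous_on_subset[OF l_cont]) auto
qed

lemma theta_positive: "t \<in> {0<..<1} \<Longrightarrow> 0 < \<theta> t"
  using omega_zero[of "1 - t"] omega_nonneg[of "1 - t"] Q_zero[of "1 - t"] Q_nonneg[of "1 - t"]
    l_zero[of t] l_nonneg[of t]
  by (auto simp: theta_def less_le intro!: mult_pos_pos divide_pos_pos)

lemma omega_bounded: obtains K where "\<And>t. t \<in> {0..1} \<Longrightarrow> \<omega> t \<le> K" "0 \<le> K"
proof -
  have "compact (\<omega> ` {0..1})" by (rule compact_continuous_image[OF omega_cont]) simp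
  from compact_attains_sup[OF this] obtain t0 where "t0 \<in> {0..1}" "\<And>t. t \<in> {0..1} \<Longrightarrow> \<omega> t \<le> \<omega> t0" by auto
  then show ?thesis using that[of "\<omega> t0"] omega_nonneg by auto
qed

lemma profile: obtains B where "profile \<theta> \<rho> B"
proof -
  obtain K where K: "\<And>t. t \<in> {0..1} \<Longrightarrow> \<omega> t \<le> K" "0 \<le> K" using omega_bounded by blast
  have "profile \<theta> \<rho> (sqrt K)"
  proof
    show "continuous_on {0<..<1} \<theta>" by (rule continuous_on_subset[OF theta_continuous]) auto
    show "strict_mono_on {0<..<1} \<theta>" using theta_mono by (auto simp: strict_mono_on_def)
    have "continuous_on {0<..<1} (\<lambda>t. \<omega> (1 - t))"
      by (rule continuous_on_compose2[OF omega_cont]) (auto intro!: continuous_intros)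
    then show "continuous_on {0<..<1} \<rho>" by (intro continuous_intros)
    show "0 < \<rho> t" if "t \<in> {0<..<1}" for t
      using omega_zero[of "1 - t"] omega_nonneg[of "1 - t"] that by (auto simp: less_le)
    show "\<rho> t \<le> sqrt K" if "t \<in> {0<..<1}" for t using K(1)[of "1 - t"] that by simp
  qed (rule theta_positive)
  then show ?thesis by (rule that)
qed

text \<open>By monotonicity the limit is the supremum, which is at least the value halfway between
  \<open>m\<close> and \<open>1\<close>; strictness of the growth separates this from the value at
  \<open>m\<close>. This is what excludes jumps at the boundary.\<close>

lemma sqrt_theta_end_gt:
  assumes "0 < m" "m < 1"
  shows "ennreal (sqrt (\<theta> m)) < sqrt_theta_end l Q \<omega>"
proof -
  let ?f = "\<lambda>t. ennreal (sqrt (\<theta> t))"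
  define L where "L = (SUP t\<in>{0..<1}. ?f t)"
  have mono: "?f x \<le> ?f y" if "0 \<le> x" "x \<le> y" "y < 1" for x y
  proof -
    have "\<theta> x \<le> \<theta> y" using that theta_mono by (cases "x = y") (auto simp: strict_mono_on_def intro: less_imp_le)
    then show ?thesis by (intro ennreal_leI) simp
  qed
  have "(?f \<longlongrightarrow> L) (at_left 1)"
  proof (rule increasing_tendsto)
    have "\<forall>\<^sub>F t::real in at_left 1. 0 < t \<and> t < 1"
      by (auto simp: eventually_at_left_field intro!: exI[of _ "0"])
    then show "\<forall>\<^sub>F t in at_left 1. ?f t \<le> L"
      by eventually_elim (auto simp: L_def intro!: SUP_upper)
    fix x assume "x < L"
    then obtain t0 where t0: "t0 \<in> {0..<1}" "x < ?f t0" unfolding L_def less_SUP_iff by blast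
    have "\<forall>\<^sub>F t::real in at_left 1. t0 < t \<and> t < 1"
      using t0 by (auto simp: eventually_at_left_field intro!: exI[of _ t0])
    then show "\<forall>\<^sub>F t in at_left 1. x < ?f t"
    proof eventually_elim
      case (elim t)
      then show ?case using mono[of t0 t] t0 by (simp add: order_less_le_trans)
    qed
  qed
  then have "sqrt_theta_end l Q \<omega> = L"
    unfolding sqrt_theta_end_def by (intro tendsto_Lim) auto
  moreover have "?f ((m + 1) / 2) \<le> L" unfolding L_def using assms by (intro SUP_upper) auto
  moreover have "\<theta> m < \<theta> ((m + 1) / 2)" using assms theta_mono by (auto simp: strict_mono_on_def)
  then have "?f m < ?f ((m + 1) / 2)" using theta_positive[of m] assms by (intro ennreal_lessI) auto
  ultimately show ?thesis by simp
qed

text \<open>\<open>w_min\<close> is an arbitrary minimizer, known only through its energy. Attaining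
  the calibrated bound fixes its density, hence \<open>lam\<close>, and decides whether it has a
  singular part.\<close>

lemma minimizer_structure:
  fixes m s :: real
  assumes m: "0 < m" "m < 1" and s: "0 < s"
  defines "\<mu> \<equiv> lam l Q \<omega> m s"
  shows "0 < \<mu>" "\<mu>\<^sup>2 \<le> \<theta> m" "2 * profile.halfmass \<theta> \<rho> m \<mu> \<le> s"
    "\<mu>\<^sup>2 < \<theta> m \<Longrightarrow> 2 * profile.halfmass \<theta> \<rho> m \<mu> = s"
    "frakG l Q \<omega> s m = ennreal (profile.optval \<theta> \<rho> s m \<mu>)" "0 \<le> profile.optval \<theta> \<rho> s m \<mu>"
    "w_min l Q \<omega> m s \<in> W11_on (2 * m - 1) 1 \<longleftrightarrow> 2 * profile.halfmass \<theta> \<rho> m \<mu> = s"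
proof -
  obtain B where "profile \<theta> \<rho> B" by (rule profile)
  then interpret profile \<theta> \<rho> B .
  obtain K where K: "\<And>t. t \<in> {0..1} \<Longrightarrow> \<omega> t \<le> K" "0 \<le> K" using omega_bounded by blast
  obtain \<nu> where \<nu>: "0 < \<nu>" "\<nu>\<^sup>2 \<le> \<theta> m" "set_integrable lborel {m<..<1} (slope \<nu>)" "2 * halfmass m \<nu> \<le> s"
    "\<nu>\<^sup>2 < \<theta> m \<Longrightarrow> 2 * halfmass m \<nu> = s" using ex_multiplier[OF m s] by blast
  define a where "a = 2 * m - 1"
  let ?\<theta> = "theta_m l Q \<omega> m" let ?\<omega> = "omega_m \<omega> m" let ?\<sigma> = "sqrt_theta_end l Q \<omega>"
  define H where "H r u = sqrt (r\<^sup>2 * \<omega> (1 - u) / (\<theta> u * (\<theta> u - r\<^sup>2)))" for r u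
  define E where "E u = sqrt (\<omega> (1 - u) * (1 - \<nu>\<^sup>2 / \<theta> u))" for u
  \<comment> \<open>Density and dual integrand depend on \<open>t\<close> only through
    \<open>m + \<bar>t - m\<bar>\<close>, so their integrals fold onto
    \<open>{m<..<1}\<close>.\<close>
  have Hm: "sqrt (r\<^sup>2 * ?\<omega> t / (?\<theta> t * (?\<theta> t - r\<^sup>2))) = H r (m + \<bar>t - m\<bar>)" for r t
    by (simp add: H_def theta_m_def omega_m_def diff_diff_eq)
  have Em: "sqrt (?\<omega> t * (1 - \<nu>\<^sup>2 / ?\<theta> t)) = E (m + \<bar>t - m\<bar>)" for t
    by (simp add: E_def theta_m_def omega_m_def diff_diff_eq)
  have HS: "H \<nu> u = slope \<nu> u" if "u \<in> {m<..<1}" for u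
    unfolding H_def using that m \<nu> lt_\<theta>[OF m(1) \<nu>(2)] omega_nonneg[of "1 - u"] by (intro slope_eq) auto
  have ED: "E u = dual \<nu> u" for u by (simp add: E_def dual_def cosine_def real_sqrt_mult)
  have Hi: "set_integrable lborel {m<..<1} (H \<nu>)"
    using \<nu>(3) by (subst set_integrable_cong[OF refl refl HS]) auto
  have Hh: "(LBINT t:{m<..<1}. H \<nu> t) = halfmass m \<nu>"
    unfolding halfmass_def by (intro set_lebesgue_integral_cong) (auto simp: HS)
  have Ei: "set_integrable lborel {m<..<1} E"
    using dual_integrable[OF m(1) _ \<nu>(2), of 1] by (simp add: ED[abs_def])
  have fold: "m + \<bar>t - m\<bar> \<in> {m..<1}" "t \<noteq> m \<Longrightarrow> m + \<bar>t - m\<bar> \<in> {m<..<1}" if "t \<in> {a<..<1}" for t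
    using that by (auto simp: a_def)
  \<comment> \<open>The jump height is the part of \<open>s\<close> left over by the two halves of
    the slopes.\<close>
  interpret C: calibration a 1 m s \<nu> "s - 2 * halfmass m \<nu>" ?\<theta> ?\<omega> ?\<sigma> K
  proof
    show "a < m" "m < 1" "0 < \<nu>" using m \<nu> by (auto simp: a_def)
    show "continuous_on {a<..<1} ?\<theta>" unfolding theta_m_def
      by (rule continuous_on_compose2[OF theta_continuous])
        (use fold(1) m in \<open>force intro!: continuous_intros\<close>)+
    show "continuous_on {a<..<1} ?\<omega>" unfolding omega_m_def
      by (rule continuous_on_compose2[OF omega_cont])
        (use m in \<open>auto intro!: continuous_intros simp: a_def\<close>)
    show "\<nu>\<^sup>2 \<le> ?\<theta> m" using \<nu> by (simp add: theta_m_def)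
    show "\<nu>\<^sup>2 < ?\<theta> t" if "t \<in> {a<..<1}" "t \<noteq> m" for t
      using lt_\<theta>[OF m(1) \<nu>(2)] fold(2)[OF that] by (simp add: theta_m_def)
    show "0 \<le> ?\<omega> t \<and> ?\<omega> t \<le> K" if "t \<in> {a<..<1}" for t
    proof -
      have "1 - m - \<bar>t - m\<bar> \<in> {0..1}" using fold(1)[OF that] m by auto
      then show ?thesis using omega_nonneg K(1) by (auto simp: omega_m_def)
    qed
    have "\<nu> \<le> sqrt (\<theta> m)" using \<nu> by (intro real_le_rsqrt)
    then have "ennreal \<nu> \<le> ennreal (sqrt (\<theta> m))" by (rule ennreal_leI)
    then show "ennreal \<nu> < ?\<sigma>" using sqrt_theta_end_gt[OF m] by (rule order_le_less_trans)
    show "set_integrable lborel {a<..<1} (\<lambda>t. sqrt (\<nu>\<^sup>2 * ?\<omega> t / (?\<theta> t * (?\<theta> t - \<nu>\<^sup>2))))"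
      unfolding Hm a_def by (rule set_integral_even_reflection(1)[OF Hi])
    show "(LBINT t:{a<..<1}. sqrt (\<nu>\<^sup>2 * ?\<omega> t / (?\<theta> t * (?\<theta> t - \<nu>\<^sup>2)))) + (s - 2 * halfmass m \<nu>) = s"
      unfolding Hm a_def set_integral_even_reflection(2)[OF Hi] Hh by simp
    show "0 \<le> s - 2 * halfmass m \<nu>" using \<nu>(4) by simp
    show "?\<theta> m = \<nu>\<^sup>2" if "0 < s - 2 * halfmass m \<nu>" using that \<nu>(2,5) by (force simp: theta_m_def)
  qed
  have minval: "C.minval = optval s m \<nu>"
    unfolding C.minval_def C.e_def optval_def Em
    unfolding a_def set_integral_even_reflection(2)[OF Ei] by (simp add: ED[abs_def])
  obtain w0 where w0: "w0 \<in> BV_on a 1" "energy a 1 ?\<theta> ?\<omega> ?\<sigma> s w0 = ennreal C.minval" using C.energy_attained by blast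
  have low: "ennreal C.minval \<le> scG l Q \<omega> m s v" for v
    using C.energy_lower_bound(1)[of v] by (simp add: scG_eq_energy a_def)
  have G0: "scG l Q \<omega> m s w0 = ennreal C.minval" using w0 by (simp add: scG_eq_energy a_def)
  have w0L: "w0 \<in> L1_on a 1" using w0 by (simp add: BV_on_def)
  have "is_minimizer l Q \<omega> m s w0" using w0L low G0 by (simp add: is_minimizer_def a_def)
  then have "is_minimizer l Q \<omega> m s (w_min l Q \<omega> m s)" unfolding w_min_def by (rule someI[of "is_minimizer l Q \<omega> m s"])
  then have Gw: "scG l Q \<omega> m s (w_min l Q \<omega> m s) \<le> ennreal C.minval"
    using w0L G0 by (auto simp: is_minimizer_def a_def)
  then have BV: "w_min l Q \<omega> m s \<in> BV_on a 1"
    by (auto simp: scG_eq_energy a_def top_unique split: if_splits)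
  then have "energy a 1 ?\<theta> ?\<omega> ?\<sigma> s (w_min l Q \<omega> m s) \<le> ennreal C.minval" using Gw by (simp add: scG_eq_energy a_def)
  from C.energy_lower_bound(2)[OF BV this]
  have dens: "AE t in lborel. t \<in> {a<..<1} \<longrightarrow> ac_density a 1 (w_min l Q \<omega> m s) t = H \<nu> (m + \<bar>t - m\<bar>)"
    and W: "w_min l Q \<omega> m s \<in> W11_on a 1 \<longleftrightarrow> s - 2 * halfmass m \<nu> = 0"
    by (auto simp: C.p_def Hm)
  have "\<mu> = \<nu>" unfolding \<mu>_def lam_def Hm a_def[symmetric]
  proof (rule the_equality)
    show "\<nu> \<in> {0<..sqrt (\<theta> m)} \<and>
      (AE t in lborel. t \<in> {a<..<1} \<longrightarrow> ac_density a 1 (w_min l Q \<omega> m s) t = H \<nu> (m + \<bar>t - m\<bar>))"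
      using dens \<nu> by (auto intro: real_le_rsqrt)
    fix r assume r: "r \<in> {0<..sqrt (\<theta> m)} \<and>
      (AE t in lborel. t \<in> {a<..<1} \<longrightarrow> ac_density a 1 (w_min l Q \<omega> m s) t = H r (m + \<bar>t - m\<bar>))"
    from r dens have "AE t in lborel. t \<in> {a<..<1} \<longrightarrow> H r (m + \<bar>t - m\<bar>) = H \<nu> (m + \<bar>t - m\<bar>)"
      by (auto elim: AE_mp)
    \<comment> \<open>One common point suffices: at fixed \<open>t\<close> the density is an
      injective function of the positive multiplier.\<close>
    from AE_lborel_interval_witness[OF this, of m 1] obtain t where t: "m < t" "t < 1" "H r t = H \<nu> t"
      using m by (auto simp: a_def)
    have r2: "r\<^sup>2 \<le> \<theta> m" using r real_sqrt_le_iff[of "r\<^sup>2" "\<theta> m"] by auto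
    have pos: "0 < \<theta> t" "r\<^sup>2 < \<theta> t" "\<nu>\<^sup>2 < \<theta> t" "0 < \<omega> (1 - t)"
      using \<theta>_pos[of t] lt_\<theta>[OF m(1) r2 t(1,2)] lt_\<theta>[OF m(1) \<nu>(2) t(1,2)] \<rho>_pos[of t] m t by auto
    have "r\<^sup>2 * \<omega> (1 - t) / (\<theta> t * (\<theta> t - r\<^sup>2)) = \<nu>\<^sup>2 * \<omega> (1 - t) / (\<theta> t * (\<theta> t - \<nu>\<^sup>2))"
      using t(3) by (simp add: H_def)
    then have "r\<^sup>2 * (\<theta> t - \<nu>\<^sup>2) = \<nu>\<^sup>2 * (\<theta> t - r\<^sup>2)" using pos by (simp add: frac_eq_eq)
    then have "\<theta> t * r\<^sup>2 = \<theta> t * \<nu>\<^sup>2" by (simp add: algebra_simps)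
    then show "r = \<nu>" using pos r \<nu>(1) by (simp add: power2_eq_iff_nonneg)
  qed
  then show "0 < \<mu>" "\<mu>\<^sup>2 \<le> \<theta> m" "2 * halfmass m \<mu> \<le> s" "\<mu>\<^sup>2 < \<theta> m \<Longrightarrow> 2 * halfmass m \<mu> = s"
    "w_min l Q \<omega> m s \<in> W11_on (2 * m - 1) 1 \<longleftrightarrow> 2 * halfmass m \<mu> = s"
    using \<nu> W by (auto simp: a_def)
  show "frakG l Q \<omega> s m = ennreal (optval s m \<mu>)"
    unfolding frakG_def \<open>\<mu> = \<nu>\<close> minval[symmetric] using Gw low by (intro antisym)
  have "0 \<le> (LBINT t:{m<..<1}. dual \<nu> t)"
    unfolding set_lebesgue_integral_def
  proof (rule Bochner_Integration.integral_nonneg)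
    fix t show "0 \<le> indicator {m<..<1} t *\<^sub>R dual \<nu> t"
      using cosine_nonneg[of t \<nu>] lt_\<theta>[OF m(1) \<nu>(2), of t] \<rho>_pos[of t] m by (auto simp: indicator_def dual_def)
  qed
  then show "0 \<le> optval s m \<mu>" unfolding \<open>\<mu> = \<nu>\<close> optval_def using \<nu> s by simp
qed

end

section \<open>Divided differences\<close>

text \<open>The majorant for the saturated case, in which \<open>1 / cosine\<close> grows at most
  like the inverse square root of the distance to the end point.\<close>

lemma integrable_rsqrt: "set_integrable lborel {0<..<1} (\<lambda>u::real. C / sqrt u)"
proof -
  have "((\<lambda>x::real. x powr (-1/2)) has_integral (1 powr (-1/2 + 1) / (-1/2 + 1))) {0..1}"
    using has_integral_powr_from_0[of "-1/2" 1] by simp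
  then have "(\<lambda>x::real. x powr (-1/2)) absolutely_integrable_on {0..1}"
    by (intro nonnegative_absolutely_integrable_1) (auto simp: has_integral_iff)
  then have "set_integrable lebesgue {0<..<1} (\<lambda>x::real. x powr (-1/2))"
    by (rule set_integrable_subset) auto
  then have "set_integrable lborel {0<..<1} (\<lambda>x::real. x powr (-1/2))"
    unfolding set_integrable_def by (subst (asm) integrable_completion) auto
  then have "set_integrable lborel {0<..<1} (\<lambda>u::real. C * u powr (-1/2))"
    by (intro set_integrable_mult_right) auto
  moreover have "C / sqrt u = C * u powr (-1/2)" if "u \<in> {0<..<1}" for u :: real
    using powr_minus_divide[of u "1/2"] powr_half_sqrt[of u] that by simp
  ultimately show ?thesis by (subst set_integrable_cong[OF refl refl]) auto
qed

text \<open>The interval shrinks to \<open>z\<close> and the parameter tends to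
  \<open>lam z\<close>, so joint continuity at one point controls the average. The parameter is
  taken at the left end of the interval, where it is admissible for all \<open>t\<close> to the
  right.\<close>

lemma average_tendsto:
  fixes g :: "real \<Rightarrow> real \<Rightarrow> real" and lam :: "real \<Rightarrow> real"
  assumes g: "isCont (\<lambda>(\<mu>, t). g \<mu> t) (lam z, z)" and lam: "isCont lam z" and M: "open M" "z \<in> M"
    and int: "\<And>x y. x \<in> M \<Longrightarrow> y \<in> M \<Longrightarrow> x < y \<Longrightarrow> set_integrable lborel {x<..<y} (g (lam x))"
  shows "((\<lambda>y. (LBINT t:{min y z<..<max y z}. g (lam (min y z)) t) / (max y z - min y z)) \<longlongrightarrow> g (lam z) z) (at z)"
proof (unfold tendsto_iff, intro allI impI)
  fix e :: real assume "0 < e"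
  then have e2: "0 < e / 2" by simp
  obtain d1 where d1: "0 < d1" "\<And>p. dist p (lam z, z) < d1 \<Longrightarrow> \<bar>(case p of (\<mu>, t) \<Rightarrow> g \<mu> t) - g (lam z) z\<bar> < e / 2"
  proof -
    have "\<exists>d>0. \<forall>p. dist p (lam z, z) < d \<longrightarrow>
        dist (case p of (\<mu>, t) \<Rightarrow> g \<mu> t) (case (lam z, z) of (\<mu>, t) \<Rightarrow> g \<mu> t) < e / 2"
      using g e2 unfolding continuous_at_eps_delta by blast
    then show ?thesis using that unfolding dist_real_def prod.case by blast
  qed
  obtain d2 where d2: "0 < d2" "\<And>y. \<bar>y - z\<bar> < d2 \<Longrightarrow> \<bar>lam y - lam z\<bar> < d1 / 2"
  proof -
    have "\<exists>d>0. \<forall>y. dist y z < d \<longrightarrow> dist (lam y) (lam z) < d1 / 2"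
      using lam half_gt_zero[OF d1(1)] unfolding continuous_at_eps_delta by blast
    then show ?thesis using that unfolding dist_real_def by blast
  qed
  obtain d3 where d3: "0 < d3" "\<And>y. \<bar>y - z\<bar> < d3 \<Longrightarrow> y \<in> M"
    using M unfolding open_dist by (auto simp: dist_real_def)
  define d where "d = min (d1 / 2) (min d2 d3)"
  have "\<bar>(LBINT t:{min y z<..<max y z}. g (lam (min y z)) t) / (max y z - min y z) - g (lam z) z\<bar> < e"
    if y: "y \<noteq> z" "\<bar>y - z\<bar> < d" for y
  proof -
    define x w where "x = min y z" and "w = max y z"
    have xw: "x < w" "w - x = \<bar>y - z\<bar>" "x \<in> M" "w \<in> M"
    proof -
      have "y \<in> M" using d3(2)[of y] y(2) by (simp add: d_def)
      then show "x \<in> M" "w \<in> M" using M(2) by (simp_all add: x_def w_def min_def max_def)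
    qed (use y(1) in \<open>auto simp: x_def w_def min_def max_def\<close>)
    have cl: "\<bar>g (lam x) t - g (lam z) z\<bar> \<le> e / 2" if "t \<in> {x<..<w}" for t
    proof -
      have "\<bar>t - z\<bar> < d1 / 2" "\<bar>x - z\<bar> < d2" using that y d2(1) d1(1) by (auto simp: x_def w_def d_def min_def max_def split: if_splits)
      then have "dist (lam x, t) (lam z, z) < d1"
        using sqrt_sum_squares_le_sum_abs[of "lam x - lam z" "t - z"] d2(2)[of x]
        by (auto simp: dist_Pair_Pair dist_real_def)
      from d1(2)[OF this] show ?thesis by simp
    qed
    note gi = int[OF xw(3,4,1)]
    have ci: "set_integrable lborel {x<..<w} (\<lambda>t. g (lam z) z)" "set_integrable lborel {x<..<w} (\<lambda>t. e / 2)"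
      using xw(1) unfolding set_integrable_def by (auto intro!: integrable_scaleR_left integrable_real_indicator)
    have c: "(LBINT t:{x<..<w}. r) = r * (w - x)" for r :: real
      using xw(1) by (simp add: set_lebesgue_integral_def)
    have "\<bar>(LBINT t:{x<..<w}. g (lam x) t) - g (lam z) z * (w - x)\<bar> = \<bar>LBINT t:{x<..<w}. g (lam x) t - g (lam z) z\<bar>"
      using set_integral_diff(2)[OF gi ci(1)] c by simp
    also have "\<dots> \<le> (LBINT t:{x<..<w}. \<bar>g (lam x) t - g (lam z) z\<bar>)"
      using set_integral_norm_bound[OF set_integral_diff(1)[OF gi ci(1)]] by simp
    also have "\<dots> \<le> (LBINT t:{x<..<w}. e / 2)"
      using set_integrable_abs[OF set_integral_diff(1)[OF gi ci(1)]] ci(2) cl by (intro set_integral_mono) auto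
    finally have "\<bar>(LBINT t:{x<..<w}. g (lam x) t) - g (lam z) z * (w - x)\<bar> \<le> e / 2 * (w - x)" unfolding c .
    then have "\<bar>(LBINT t:{x<..<w}. g (lam x) t) / (w - x) - g (lam z) z\<bar> \<le> e / 2"
      using xw(1) by (simp add: abs_le_iff field_simps)
    then show ?thesis using \<open>0 < e\<close> by (simp add: x_def w_def)
  qed
  moreover have "0 < d" using d1 d2 d3 by (simp add: d_def)
  ultimately show "\<forall>\<^sub>F y in at z. dist ((LBINT t:{min y z<..<max y z}. g (lam (min y z)) t) / (max y z - min y z)) (g (lam z) z) < e"
    unfolding eventually_at by (intro exI[of _ d]) (auto simp: dist_real_def)
qed

text \<open>Together with the symmetry of difference quotients, this turns a two-sided derivative at
  \<open>z\<close> into a limit over ordered pairs, for which the exact difference formulas are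
  available.\<close>

lemma filterlim_min_max_at:
  fixes z :: real
  assumes "\<forall>\<^sub>F y in at z. (min y z, max y z) \<in> S"
  shows "filterlim (\<lambda>y. (min y z, max y z)) (at (z, z) within S) (at z)"
proof -
  have "((\<lambda>y. (min y z, max y z)) \<longlongrightarrow> (min z z, max z z)) (at z)"
    by (intro tendsto_intros)
  moreover have "\<forall>\<^sub>F y in at z. (min y z, max y z) \<noteq> (z, z)"
    using eventually_neq_at_within[of z z UNIV] by eventually_elim (auto simp: min_def max_def split: if_splits)
  ultimately show ?thesis using assms by (auto simp: filterlim_at eventually_conj_iff)
qed

lemma filterlim_diagonal_at:
  fixes z :: real
  assumes "\<forall>\<^sub>F y in at z. (y, y) \<in> S"
  shows "filterlim (\<lambda>y. (y, y)) (at (z, z) within S) (at z)"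
proof -
  have "((\<lambda>y. (y, y)) \<longlongrightarrow> (z, z)) (at z)" by (intro tendsto_intros)
  moreover have "\<forall>\<^sub>F y in at z. (y, y) \<noteq> (z, z)"
    using eventually_neq_at_within[of z z UNIV] by eventually_elim auto
  ultimately show ?thesis using assms by (auto simp: filterlim_at eventually_conj_iff)
qed

lemma has_derivative_min_max_iff:
  fixes f :: "real \<Rightarrow> real"
  shows "(f has_real_derivative D) (at z) \<longleftrightarrow>
    ((\<lambda>y. (f (max y z) - f (min y z)) / (max y z - min y z)) \<longlongrightarrow> D) (at z)"
proof -
  have "(f y - f z) / (y - z) = (f (max y z) - f (min y z)) / (max y z - min y z)" for y
    using minus_divide_divide[of "f z - f y" "z - y"] by (simp add: max_def min_def)
  then show ?thesis by (simp add: has_field_derivative_iff)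
qed

lemma set_integral_Ioo_shift:
  fixes f :: "real \<Rightarrow> real"
  shows "(LBINT t:{w<..<b}. f t) = (\<integral>u. indicator {0<..<b - w} u * f (w + u) \<partial>lborel)"
proof -
  have "(LBINT t:{w<..<b}. f t) = (\<integral>u. indicator {w<..<b} (w + 1 * u) *\<^sub>R f (w + 1 * u) \<partial>lborel)"
    unfolding set_lebesgue_integral_def by (subst lborel_integral_real_affine[of 1 _ w]) auto
  also have "\<dots> = (\<integral>u. indicator {0<..<b - w} u * f (w + u) \<partial>lborel)"
    by (intro Bochner_Integration.integral_cong) (auto simp: indicator_def)
  finally show ?thesis .
qed

text \<open>Translating to a fixed left end point turns the moving singularity at \<open>snd p\<close> into one at \<open>0\<close>,
  where it can be dominated.\<close>

lemma tail_integral_tendsto: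
  fixes K :: "real \<times> real \<Rightarrow> real \<Rightarrow> real"
  assumes zS: "(z, z) \<in> S" and meas: "\<And>p. p \<in> S \<Longrightarrow> (\<lambda>t. indicator {snd p<..<1} t * K p t) \<in> borel_measurable borel"
    and W: "set_integrable lborel {0<..<1} W" "\<And>u. u \<in> {0<..<1} \<Longrightarrow> 0 \<le> W u" and pos: "\<And>p. p \<in> S \<Longrightarrow> 0 < snd p"
    and bound: "\<And>p u. p \<in> S \<Longrightarrow> 0 < u \<Longrightarrow> snd p + u < 1 \<Longrightarrow> \<bar>K p (snd p + u)\<bar> \<le> W u"
    and lim: "\<And>u. 0 < u \<Longrightarrow> z + u < 1 \<Longrightarrow> ((\<lambda>p. K p (snd p + u)) \<longlongrightarrow> K (z, z) (z + u)) (at (z, z) within S)"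
  shows "((\<lambda>p. LBINT t:{snd p<..<1}. K p t) \<longlongrightarrow> (LBINT t:{z<..<1}. K (z, z) t)) (at (z, z) within S)"
proof -
  define F where "F p u = indicator {0<..<1 - snd p} u * K p (snd p + u)" for p u
  have "((\<lambda>p. \<integral>u. F p u \<partial>lborel) \<longlongrightarrow> (\<integral>u. F (z, z) u \<partial>lborel)) (at (z, z) within S)"
  proof (rule tendsto_integral_dominated[OF zS, where w="\<lambda>u. indicator {0<..<1} u *\<^sub>R W u"])
    show "integrable lborel (\<lambda>u. indicator {0<..<1} u *\<^sub>R W u)" using W(1) by (simp add: set_integrable_def)
    fix p assume p: "p \<in> S"
    have "F p = (\<lambda>u. indicator {snd p<..<1} (snd p + u) * K p (snd p + u))"
      by (auto simp: F_def indicator_def fun_eq_iff)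
    then show "F p \<in> borel_measurable lborel"
      using measurable_compose[OF _ meas[OF p], of "\<lambda>u. snd p + u" borel] by simp
    have "\<bar>F p u\<bar> \<le> indicator {0<..<1} u *\<^sub>R W u" for u
      using bound[OF p, of u] W(2)[of u] pos[OF p] by (auto simp: F_def indicator_def)
    then show "AE u in lborel. \<bar>F p u\<bar> \<le> indicator {0<..<1} u *\<^sub>R W u" by simp
  next
    have l: "(snd \<longlongrightarrow> z) (at (z, z) within S)" using tendsto_snd[OF tendsto_ident_at[of "(z, z)" S]] by simp
    \<comment> \<open>At \<open>u = 1 - z\<close> the cut-off indicator is discontinuous in
      \<open>p\<close> at \<open>(z, z)\<close>; this single point is discarded.\<close>
    show "AE u in lborel. ((\<lambda>p. F p u) \<longlongrightarrow> F (z, z) u) (at (z, z) within S)"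
      using AE_lborel_singleton[of "1 - z"]
    proof eventually_elim
      case (elim u)
      consider "u \<le> 0" | "1 - u < z" | "0 < u" "z < 1 - u" using elim by linarith
      then show ?case
      proof cases
        case 1 then show ?thesis by (simp add: F_def)
      next
        case 2
        from order_tendstoD(1)[OF l this]
        have "\<forall>\<^sub>F p in at (z, z) within S. F p u = F (z, z) u"
          by eventually_elim (use 2 in \<open>auto simp: F_def\<close>)
        then show ?thesis by (rule tendsto_eventually)
      next
        case 3
        from order_tendstoD(2)[OF l 3(2)]
        have "\<forall>\<^sub>F p in at (z, z) within S. K p (snd p + u) = F p u"
          by eventually_elim (use 3 in \<open>auto simp: F_def\<close>)
        from Lim_transform_eventually[OF lim this] show ?thesis using 3 by (simp add: F_def)
      qed
    qed
  qed
  then show ?thesis by (simp add: F_def set_integral_Ioo_shift)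
qed

section \<open>Closed forms and bounds for difference quotients in the multiplier\<close>

context profile
begin

text \<open>With the divided differences of \<open>dual\<close> and \<open>slope\<close> in \<open>\<mu>\<close> in closed form, nothing has to be
  differentiated under the integral sign.\<close>

definition dual_quot :: "real \<Rightarrow> real \<Rightarrow> real \<Rightarrow> real" where
  "dual_quot \<mu> \<nu> t = \<rho> t / \<theta> t * ((\<mu> + \<nu>) / (cosine \<mu> t + cosine \<nu> t))"

definition slope_quot :: "real \<Rightarrow> real \<Rightarrow> real \<Rightarrow> real" where
  "slope_quot \<mu> \<nu> t = \<rho> t / \<theta> t * ((\<mu> + \<nu>) / (cosine \<mu> t * cosine \<nu> t * (\<nu> * cosine \<mu> t + \<mu> * cosine \<nu> t)))"

text \<open>Multiply by the sum of the cosines: the difference of their squares is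
  \<open>(\<nu>\<^sup>2 - \<mu>\<^sup>2) / \<theta> t\<close>, which contains the factor
  \<open>\<nu> - \<mu>\<close>.\<close>

lemma dual_quot:
  assumes "t \<in> {0<..<1}" "\<mu>\<^sup>2 < \<theta> t" "\<nu>\<^sup>2 < \<theta> t"
  shows "dual \<mu> t - dual \<nu> t = (\<nu> - \<mu>) * dual_quot \<mu> \<nu> t"
proof -
  let ?x = "cosine \<mu> t" and ?y = "cosine \<nu> t"
  have pos: "0 < ?x" "0 < ?y" "0 < \<theta> t" using cosine_pos assms \<theta>_pos by auto
  have "(?x - ?y) * (?x + ?y) = ?x\<^sup>2 - ?y\<^sup>2" by (simp add: power2_eq_square algebra_simps)
  also have "\<dots> = (\<nu> - \<mu>) * (\<mu> + \<nu>) / \<theta> t"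
    using cosine_power2[of t \<mu>] cosine_power2[of t \<nu>] assms pos by (simp add: field_simps power2_eq_square)
  finally have "?x - ?y = (\<nu> - \<mu>) * (\<mu> + \<nu>) / \<theta> t / (?x + ?y)"
    using pos by (simp add: nonzero_eq_divide_eq mult_ac)
  then have "\<rho> t * (?x - ?y) = (\<nu> - \<mu>) * dual_quot \<mu> \<nu> t" by (simp add: dual_quot_def)
  then show ?thesis by (simp add: dual_def right_diff_distrib)
qed

text \<open>So the derivative of \<open>dual\<close> in the multiplier is minus the slope, and that
  of \<open>optval\<close> is \<open>s - 2 * halfmass\<close>: a multiplier whose slopes have full
  mass is a stationary point of the dual problem.\<close>

lemma dual_quot_diag: "dual_quot \<mu> \<mu> t = slope \<mu> t"
proof -
  have "(\<mu> + \<mu>) / (cosine \<mu> t + cosine \<mu> t) = \<mu> / cosine \<mu> t"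
    using mult_divide_mult_cancel_left[of "2::real" \<mu> "cosine \<mu> t"] by (simp only: mult_2)
  then show ?thesis by (simp add: dual_quot_def slope_def)
qed

text \<open>Multiplying \<open>\<nu> * cosine \<mu> t - \<mu> * cosine \<nu> t\<close> by the
  corresponding sum, the terms with \<open>\<theta>\<close> cancel and
  \<open>\<nu>\<^sup>2 - \<mu>\<^sup>2\<close> remains.\<close>

lemma slope_quot:
  assumes "t \<in> {0<..<1}" "\<mu>\<^sup>2 < \<theta> t" "\<nu>\<^sup>2 < \<theta> t" "0 < \<mu>" "0 < \<nu>"
  shows "slope \<nu> t - slope \<mu> t = (\<nu> - \<mu>) * slope_quot \<mu> \<nu> t"
proof -
  let ?x = "cosine \<mu> t" and ?y = "cosine \<nu> t"
  have pos: "0 < ?x" "0 < ?y" "0 < \<theta> t" using cosine_pos assms \<theta>_pos by auto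
  have s: "0 < \<nu> * ?x + \<mu> * ?y" using pos assms by (intro add_pos_pos mult_pos_pos)
  have "(\<nu> * ?x - \<mu> * ?y) * (\<nu> * ?x + \<mu> * ?y) = \<nu>\<^sup>2 * ?x\<^sup>2 - \<mu>\<^sup>2 * ?y\<^sup>2" by (simp add: power2_eq_square algebra_simps)
  also have "\<dots> = \<nu>\<^sup>2 * (1 - \<mu>\<^sup>2 / \<theta> t) - \<mu>\<^sup>2 * (1 - \<nu>\<^sup>2 / \<theta> t)"
    using cosine_power2[of t \<mu>] cosine_power2[of t \<nu>] assms by simp
  also have "\<dots> = (\<nu> - \<mu>) * (\<mu> + \<nu>)" by (simp add: algebra_simps power2_eq_square)
  finally have "\<nu> * ?x - \<mu> * ?y = (\<nu> - \<mu>) * (\<mu> + \<nu>) / (\<nu> * ?x + \<mu> * ?y)"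
    using s by (simp add: nonzero_eq_divide_eq)
  moreover have "\<nu> / ?y - \<mu> / ?x = (\<nu> * ?x - \<mu> * ?y) / (?x * ?y)" using pos by (simp add: field_simps)
  ultimately have "\<nu> / ?y - \<mu> / ?x = (\<nu> - \<mu>) * ((\<mu> + \<nu>) / (?x * ?y * (\<nu> * ?x + \<mu> * ?y)))" by (simp add: mult.commute)
  then have "\<rho> t / \<theta> t * (\<nu> / ?y - \<mu> / ?x) = (\<nu> - \<mu>) * slope_quot \<mu> \<nu> t" by (simp add: slope_quot_def)
  then show ?thesis by (simp add: slope_def right_diff_distrib)
qed

text \<open>Cosines are at most 1, which gives a lower bound free of the multipliers; the three
  cosine factors in the denominator produce the cube of \<open>\<eta>\<close> in the upper
  bound.\<close>

lemma slope_quot_bounds: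
  assumes "t \<in> {0<..<1}" "0 < \<mu>" "\<mu> \<le> \<nu>" "0 < \<eta>" "\<eta> \<le> cosine \<nu> t"
  shows "\<rho> t / \<theta> t \<le> slope_quot \<mu> \<nu> t" "slope_quot \<mu> \<nu> t \<le> \<rho> t / \<theta> t / \<eta> ^ 3"
proof -
  let ?x = "cosine \<mu> t" and ?y = "cosine \<nu> t"
  have b: "\<eta> \<le> ?x" "\<eta> \<le> ?y" "?x \<le> 1" "?y \<le> 1" using cosine_antimono[of t \<mu> \<nu>] cosine_le_1[of t] assms by auto
  have r: "0 \<le> \<rho> t / \<theta> t" using \<rho>_pos[OF assms(1)] \<theta>_pos[OF assms(1)] by simp
  define D where "D = ?x * ?y * (\<nu> * ?x + \<mu> * ?y)"
  have D1: "D \<le> \<mu> + \<nu>"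
  proof -
    have "?x * ?y \<le> 1" using b assms by (intro mult_le_one) auto
    moreover have "\<nu> * ?x + \<mu> * ?y \<le> \<nu> * 1 + \<mu> * 1" using b assms by (intro add_mono mult_left_mono) auto
    moreover have "0 \<le> \<nu> * ?x + \<mu> * ?y" using b assms by auto
    ultimately show ?thesis unfolding D_def
      using mult_mono[of "?x * ?y" 1 "\<nu> * ?x + \<mu> * ?y" "\<nu> + \<mu>"] by simp
  qed
  have D2: "\<eta> ^ 3 * (\<mu> + \<nu>) \<le> D"
  proof -
    have "\<eta> * \<eta> \<le> ?x * ?y" using b assms by (intro mult_mono) auto
    moreover have "\<nu> * \<eta> + \<mu> * \<eta> \<le> \<nu> * ?x + \<mu> * ?y" using b assms by (intro add_mono mult_left_mono) auto
    ultimately have "(\<eta> * \<eta>) * (\<nu> * \<eta> + \<mu> * \<eta>) \<le> D" unfolding D_def using b assms by (intro mult_mono) auto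
    then show ?thesis by (simp add: power3_eq_cube algebra_simps)
  qed
  have p: "0 < \<mu> + \<nu>" "0 < \<eta> ^ 3" using assms by auto
  then have D0: "0 < D" using D2 mult_pos_pos[OF p(2,1)] by linarith
  have "1 \<le> (\<mu> + \<nu>) / D" using D0 D1 by simp
  moreover have "(\<mu> + \<nu>) / D \<le> 1 / \<eta> ^ 3" using D0 D2 p by (simp add: field_simps)
  ultimately have "\<rho> t / \<theta> t * 1 \<le> \<rho> t / \<theta> t * ((\<mu> + \<nu>) / D)" "\<rho> t / \<theta> t * ((\<mu> + \<nu>) / D) \<le> \<rho> t / \<theta> t * (1 / \<eta> ^ 3)"
    using r by (intro mult_left_mono; simp)+
  then show "\<rho> t / \<theta> t \<le> slope_quot \<mu> \<nu> t" "slope_quot \<mu> \<nu> t \<le> \<rho> t / \<theta> t / \<eta> ^ 3"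
    by (simp_all add: slope_quot_def D_def)
qed

lemma isCont_\<theta>: "t \<in> {0<..<1} \<Longrightarrow> isCont \<theta> t"
  using \<theta>_cont by (simp add: continuous_on_eq_continuous_at)

lemma isCont_\<rho>: "t \<in> {0<..<1} \<Longrightarrow> isCont \<rho> t"
  using \<rho>_cont by (simp add: continuous_on_eq_continuous_at)

lemma tendsto_cosine:
  assumes "t \<in> {0<..<1}" "(f \<longlongrightarrow> \<mu>) F" "(g \<longlongrightarrow> t) F"
  shows "((\<lambda>y. cosine (f y) (g y)) \<longlongrightarrow> cosine \<mu> t) F"
  unfolding cosine_def using assms(2) isCont_tendsto_compose[OF isCont_\<theta>[OF assms(1)] assms(3)] \<theta>_pos[OF assms(1)]
  by (intro tendsto_intros) auto

lemma tendsto_dual: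
  assumes "t \<in> {0<..<1}" "(f \<longlongrightarrow> \<mu>) F" "(g \<longlongrightarrow> t) F"
  shows "((\<lambda>y. dual (f y) (g y)) \<longlongrightarrow> dual \<mu> t) F"
  unfolding dual_def
  by (intro tendsto_mult tendsto_cosine[OF assms] isCont_tendsto_compose[OF isCont_\<rho>[OF assms(1)] assms(3)])

lemma tendsto_\<rho>_\<theta>:
  assumes "t \<in> {0<..<1}" "(g \<longlongrightarrow> t) F"
  shows "((\<lambda>y. \<rho> (g y) / \<theta> (g y)) \<longlongrightarrow> \<rho> t / \<theta> t) F"
  using \<theta>_pos[OF assms(1)]
  by (intro tendsto_divide isCont_tendsto_compose[OF isCont_\<rho>[OF assms(1)] assms(2)]
      isCont_tendsto_compose[OF isCont_\<theta>[OF assms(1)] assms(2)]) auto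

lemma tendsto_slope:
  assumes "t \<in> {0<..<1}" "(f \<longlongrightarrow> \<mu>) F" "(g \<longlongrightarrow> t) F" "\<mu>\<^sup>2 < \<theta> t"
  shows "((\<lambda>y. slope (f y) (g y)) \<longlongrightarrow> slope \<mu> t) F"
  unfolding slope_def using cosine_pos[OF assms(1,4)]
  by (intro tendsto_mult tendsto_divide assms(2) tendsto_cosine[OF assms(1-3)] tendsto_\<rho>_\<theta>[OF assms(1,3)]) auto

lemma tendsto_dual_quot:
  assumes "t \<in> {0<..<1}" "(f \<longlongrightarrow> \<mu>) F" "(f' \<longlongrightarrow> \<nu>) F" "(g \<longlongrightarrow> t) F" "\<mu>\<^sup>2 < \<theta> t" "\<nu>\<^sup>2 < \<theta> t"
  shows "((\<lambda>y. dual_quot (f y) (f' y) (g y)) \<longlongrightarrow> dual_quot \<mu> \<nu> t) F"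
  unfolding dual_quot_def using cosine_pos[OF assms(1,5)] cosine_pos[OF assms(1,6)]
  by (intro tendsto_mult tendsto_divide tendsto_add assms(2,3) tendsto_cosine[OF assms(1)] assms(4) tendsto_\<rho>_\<theta>[OF assms(1,4)]) auto

lemma tendsto_slope_quot:
  assumes "t \<in> {0<..<1}" "(f \<longlongrightarrow> \<mu>) F" "(f' \<longlongrightarrow> \<nu>) F" "(g \<longlongrightarrow> t) F" "\<mu>\<^sup>2 < \<theta> t" "\<nu>\<^sup>2 < \<theta> t" "0 < \<mu>" "0 < \<nu>"
  shows "((\<lambda>y. slope_quot (f y) (f' y) (g y)) \<longlongrightarrow> slope_quot \<mu> \<nu> t) F"
proof -
  note c = cosine_pos[OF assms(1,5)] cosine_pos[OF assms(1,6)]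
  have "0 < \<nu> * cosine \<mu> t + \<mu> * cosine \<nu> t" using c assms(7,8) by (intro add_pos_pos mult_pos_pos)
  then show ?thesis
    unfolding slope_quot_def using c
    by (intro tendsto_mult tendsto_divide tendsto_add assms(2,3) tendsto_cosine[OF assms(1)] assms(4) tendsto_\<rho>_\<theta>[OF assms(1,4)]) auto
qed

lemma measurable_dual_quot:
  assumes "0 < w" "\<mu>\<^sup>2 \<le> \<theta> w" "\<nu>\<^sup>2 \<le> \<theta> w"
  shows "(\<lambda>t. indicator {w<..<1} t * dual_quot \<mu> \<nu> t) \<in> borel_measurable borel"
proof -
  have "continuous_on {w<..<1} (dual_quot \<mu> \<nu>)"
    unfolding continuous_on_def
  proof
    fix t assume "t \<in> {w<..<1}"
    then show "(dual_quot \<mu> \<nu> \<longlongrightarrow> dual_quot \<mu> \<nu> t) (at t within {w<..<1})"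
      using lt_\<theta>[OF assms(1,2)] lt_\<theta>[OF assms(1,3)] assms(1)
      by (intro tendsto_dual_quot tendsto_const tendsto_ident_at) auto
  qed
  then show ?thesis using borel_measurable_continuous_on_indicator[of "{w<..<1}" "dual_quot \<mu> \<nu>"] by simp
qed

lemma continuous_on_slope_quot:
  assumes "0 < w" "\<mu>\<^sup>2 \<le> \<theta> w" "\<nu>\<^sup>2 \<le> \<theta> w" "0 < \<mu>" "0 < \<nu>"
  shows "continuous_on {w<..<1} (slope_quot \<mu> \<nu>)"
  unfolding continuous_on_def
proof
  fix t assume "t \<in> {w<..<1}"
  then show "(slope_quot \<mu> \<nu> \<longlongrightarrow> slope_quot \<mu> \<nu> t) (at t within {w<..<1})"
    using lt_\<theta>[OF assms(1,2)] lt_\<theta>[OF assms(1,3)] assms(1,4,5)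
    by (intro tendsto_slope_quot tendsto_const tendsto_ident_at) auto
qed

end

section \<open>The optimal value along a curve of multipliers\<close>

lemma set_integral_Ioo_split:
  fixes f :: "real \<Rightarrow> real"
  assumes f: "set_integrable lborel {x<..<y} f" and w: "x < w" "w < y"
  shows "(LBINT t:{x<..<y}. f t) = (LBINT t:{x<..<w}. f t) + (LBINT t:{w<..<y}. f t)"
proof -
  have i: "set_integrable lborel {x<..<w} f" "set_integrable lborel {w<..<y} f"
    by (rule set_integrable_subset[OF f]; use w in auto)+
  have "(LBINT t:{x<..<y}. f t) = (\<integral>t. indicator {x<..<w} t *\<^sub>R f t + indicator {w<..<y} t *\<^sub>R f t \<partial>lborel)"
    unfolding set_lebesgue_integral_def
  proof (rule integral_cong_AE)
    show "AE t in lborel. indicator {x<..<y} t *\<^sub>R f t = indicator {x<..<w} t *\<^sub>R f t + indicator {w<..<y} t *\<^sub>R f t"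
      using AE_lborel_singleton[of w] by eventually_elim (use w in \<open>auto simp: indicator_def\<close>)
  qed (use f i in \<open>auto simp: set_integrable_def\<close>)
  then show ?thesis using i by (simp add: set_integrable_def set_lebesgue_integral_def)
qed

lemma open_neighbours:
  fixes M :: "real set"
  assumes "open M" "z \<in> M"
  obtains d where "0 < d" "\<And>y. \<bar>y - z\<bar> \<le> d \<Longrightarrow> y \<in> M"
proof -
  obtain e where e: "0 < e" "cball z e \<subseteq> M" using assms open_contains_cball by blast
  then have "y \<in> M" if "\<bar>y - z\<bar> \<le> e" for y using that by (auto simp: dist_real_def subset_iff)
  then show ?thesis using that e(1) by blast
qed

context profile
begin

text \<open>The quotient is at most its diagonal value at the larger multiplier, i.e. the slope for
  \<open>\<nu>\<close>; one gap condition thus controls both multipliers.\<close>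

lemma dual_quot_bounds:
  assumes "t \<in> {0<..<1}" "0 < \<mu>" "\<mu> \<le> \<nu>" "\<nu>\<^sup>2 < \<theta> t"
  shows "0 \<le> dual_quot \<mu> \<nu> t" "dual_quot \<mu> \<nu> t \<le> \<rho> t / \<theta> t * (\<nu> / cosine \<nu> t)"
proof -
  have c: "0 < cosine \<nu> t" "cosine \<nu> t \<le> cosine \<mu> t" using cosine_pos cosine_antimono assms by auto
  have r: "0 \<le> \<rho> t / \<theta> t" using \<rho>_pos[OF assms(1)] \<theta>_pos[OF assms(1)] by simp
  show "0 \<le> dual_quot \<mu> \<nu> t" unfolding dual_quot_def by (rule mult_nonneg_nonneg[OF r], rule divide_nonneg_nonneg) (use c assms in auto)
  have "(\<mu> + \<nu>) / (cosine \<mu> t + cosine \<nu> t) \<le> (\<nu> + \<nu>) / (cosine \<nu> t + cosine \<nu> t)"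
    using c assms by (intro frac_le) auto
  also have "\<dots> = \<nu> / cosine \<nu> t"
    using mult_divide_mult_cancel_left[of "2::real" \<nu> "cosine \<nu> t"] by (simp only: mult_2)
  finally show "dual_quot \<mu> \<nu> t \<le> \<rho> t / \<theta> t * (\<nu> / cosine \<nu> t)"
    unfolding dual_quot_def by (intro mult_left_mono r)
qed

end

text \<open>The quantitative gap between \<open>(lam w)\<^sup>2\<close> and \<open>\<theta>\<close> keeps the slopes, translated to start at \<open>0\<close>,
  below a fixed multiple of \<open>1 / sqrt u\<close>.\<close>

locale multiplier_curve = profile +
  fixes M :: "real set" and lam :: "real \<Rightarrow> real"
  assumes M_open: "open M" and M_sub: "M \<subseteq> {0<..<1}"
    and lam_pos: "\<And>x. x \<in> M \<Longrightarrow> 0 < lam x" and lam_le: "\<And>x. x \<in> M \<Longrightarrow> (lam x)\<^sup>2 \<le> \<theta> x"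
    and lam_mono: "\<And>x y. x \<in> M \<Longrightarrow> y \<in> M \<Longrightarrow> x \<le> y \<Longrightarrow> lam x \<le> lam y"
    and lam_cont: "\<And>x. x \<in> M \<Longrightarrow> isCont lam x"
    and gap: "\<And>z. z \<in> M \<Longrightarrow> \<exists>C>0. \<exists>d>0. \<forall>w\<in>M. \<bar>w - z\<bar> < d \<longrightarrow>
      (\<forall>t. w < t \<longrightarrow> t < 1 \<longrightarrow> C * (t - w) \<le> 1 - (lam w)\<^sup>2 / \<theta> t)"
begin

text \<open>For \<open>x \<le> w\<close> the integral starts at the later point \<open>w\<close>, to
  the right of which both multipliers are admissible. It is the difference quotient of the
  integrated \<open>dual\<close>, up to sign.\<close>

definition mean_slope :: "real \<Rightarrow> real \<Rightarrow> real" where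
  "mean_slope x w = (LBINT t:{w<..<1}. dual_quot (lam x) (lam w) t)"

lemma mean_slope_diag: "mean_slope x x = halfmass x (lam x)"
  by (simp add: mean_slope_def halfmass_def dual_quot_diag)

text \<open>By \<open>gap\<close> the cosine at distance \<open>u\<close> from the end point is at
  least \<open>sqrt C * sqrt u\<close>, uniformly for \<open>w\<close> near \<open>z\<close>. This
  supplies the majorant.\<close>

lemma mean_slope_tendsto:
  assumes z: "z \<in> M"
  obtains d where "0 < d" "((\<lambda>p. mean_slope (fst p) (snd p)) \<longlongrightarrow> halfmass z (lam z))
      (at (z, z) within {p. fst p \<in> M \<and> snd p \<in> M \<and> fst p \<le> snd p \<and> \<bar>snd p - z\<bar> < d})"
proof -
  obtain C d1 where C: "0 < C" "0 < d1" "\<And>w t. w \<in> M \<Longrightarrow> \<bar>w - z\<bar> < d1 \<Longrightarrow> w < t \<Longrightarrow> t < 1 \<Longrightarrow> C * (t - w) \<le> 1 - (lam w)\<^sup>2 / \<theta> t"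
    using gap[OF z] by blast
  obtain d2 where d2: "0 < d2" "\<And>y. \<bar>y - z\<bar> \<le> d2 \<Longrightarrow> y \<in> M" using open_neighbours[OF M_open z] by blast
  define d where "d = min d1 d2"
  have z0: "z - d2 \<in> M" "z + d2 \<in> M" using d2 by auto
  define S where "S = {p. fst p \<in> M \<and> snd p \<in> M \<and> fst p \<le> snd p \<and> \<bar>snd p - z\<bar> < d}"
  have zS: "(z, z) \<in> S" using z C(2) d2(1) by (simp add: S_def d_def)
  \<comment> \<open>The worst case on the box around \<open>z\<close>: smallest
    \<open>\<theta>\<close> at its left end, largest multiplier at its right end.\<close>
  define C' where "C' = B / \<theta> (z - d2) * (lam (z + d2) / sqrt C)"
  have C'0: "0 \<le> C'" unfolding C'_def using B_pos \<theta>_pos[of "z - d2"] z0 M_sub lam_pos[OF z0(2)] C(1)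
    by (intro mult_nonneg_nonneg divide_nonneg_nonneg) (auto simp: less_imp_le subset_iff)
  have SM: "fst p \<in> M" "snd p \<in> M" "fst p \<le> snd p" "\<bar>snd p - z\<bar> < d1" "\<bar>snd p - z\<bar> \<le> d2" "0 < snd p" if "p \<in> S" for p
    using that M_sub by (auto simp: S_def d_def subset_iff)
  have lx: "0 < lam (fst p)" "lam (fst p) \<le> lam (snd p)" "(lam (snd p))\<^sup>2 \<le> \<theta> (snd p)" if "p \<in> S" for p
    using lam_pos lam_mono lam_le SM[OF that] by auto
  have "((\<lambda>p. LBINT t:{snd p<..<1}. dual_quot (lam (fst p)) (lam (snd p)) t) \<longlongrightarrow>
      (LBINT t:{z<..<1}. dual_quot (lam (fst (z, z))) (lam (snd (z, z))) t)) (at (z, z) within S)"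
  proof (rule tail_integral_tendsto[OF zS _ integrable_rsqrt[of C'] _ SM(6)])
    fix p assume p: "p \<in> S"
    note x = SM[OF p] note l = lx[OF p]
    have "(lam (fst p))\<^sup>2 \<le> (lam (snd p))\<^sup>2" using l by (intro power_mono) auto
    then have "(lam (fst p))\<^sup>2 \<le> \<theta> (snd p)" using l(3) by (rule order_trans)
    then show "(\<lambda>t. indicator {snd p<..<1} t * dual_quot (lam (fst p)) (lam (snd p)) t) \<in> borel_measurable borel"
      by (rule measurable_dual_quot[OF x(6) _ l(3)])
    fix u :: real assume u: "0 < u" "snd p + u < 1"
    have t: "snd p + u \<in> {0<..<1}" "snd p < snd p + u" using u x(6) by auto
    have lt: "(lam (snd p))\<^sup>2 < \<theta> (snd p + u)" using lt_\<theta>[OF x(6) l(3) t(2) u(2)] .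
    have \<theta>: "0 < \<theta> (z - d2)" "\<theta> (z - d2) \<le> \<theta> (snd p + u)"
      using \<theta>_pos[of "z - d2"] \<theta>_less[of "z - d2" "snd p + u"] z0(1) M_sub u x(5) by (force simp: subset_iff)+
    have cos: "sqrt C * sqrt u \<le> cosine (lam (snd p)) (snd p + u)"
      using C(3)[OF x(2,4) t(2) u(2)] by (simp add: cosine_def real_sqrt_mult[symmetric])
    have lz: "lam (snd p) \<le> lam (z + d2)" using lam_mono[OF x(2) z0(2)] x(5) by auto
    have pos: "0 < sqrt C * sqrt u" using C(1) u by simp
    have "dual_quot (lam (fst p)) (lam (snd p)) (snd p + u)
        \<le> \<rho> (snd p + u) / \<theta> (snd p + u) * (lam (snd p) / cosine (lam (snd p)) (snd p + u))"
      by (rule dual_quot_bounds(2)[OF t(1) l(1,2) lt])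
    also have "\<dots> \<le> B / \<theta> (z - d2) * (lam (z + d2) / (sqrt C * sqrt u))"
      using \<theta> l lz cos pos \<rho>_le[OF t(1)] \<rho>_pos[OF t(1)] B_pos
      by (intro mult_mono frac_le divide_nonneg_nonneg) auto
    also have "\<dots> = C' / sqrt u" by (simp add: C'_def)
    finally show "\<bar>dual_quot (lam (fst p)) (lam (snd p)) (snd p + u)\<bar> \<le> C' / sqrt u"
      using dual_quot_bounds(1)[OF t(1) l(1,2) lt] by simp
  next
    fix u :: real assume u: "0 < u" "z + u < 1"
    have l: "(fst \<longlongrightarrow> z) (at (z, z) within S)" "(snd \<longlongrightarrow> z) (at (z, z) within S)"
      using tendsto_fst[OF tendsto_ident_at[of "(z, z)" S]] tendsto_snd[OF tendsto_ident_at[of "(z, z)" S]] by auto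
    have z01: "0 < z" using z M_sub by auto
    have lt: "(lam z)\<^sup>2 < \<theta> (z + u)" using lt_\<theta>[OF z01 lam_le[OF z], of "z + u"] u by simp
    have "((\<lambda>p. dual_quot (lam (fst p)) (lam (snd p)) (snd p + u)) \<longlongrightarrow> dual_quot (lam z) (lam z) (z + u)) (at (z, z) within S)"
      using u z01
      by (intro tendsto_dual_quot isCont_tendsto_compose[OF lam_cont[OF z]] l tendsto_add tendsto_const lt) auto
    then show "((\<lambda>p. dual_quot (lam (fst p)) (lam (snd p)) (snd p + u)) \<longlongrightarrow>
        dual_quot (lam (fst (z, z))) (lam (snd (z, z))) (z + u)) (at (z, z) within S)" by simp
  qed (use C'0 in auto)
  then have "((\<lambda>p. mean_slope (fst p) (snd p)) \<longlongrightarrow> halfmass z (lam z)) (at (z, z) within S)"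
    by (simp add: mean_slope_def halfmass_def dual_quot_diag)
  moreover have "0 < d" using C(2) d2(1) by (simp add: d_def)
  ultimately show ?thesis using that unfolding S_def by blast
qed

lemma halfmass_curve_isCont: assumes z: "z \<in> M" shows "isCont (\<lambda>x. halfmass x (lam x)) z"
proof -
  obtain d where d: "0 < d" "((\<lambda>p. mean_slope (fst p) (snd p)) \<longlongrightarrow> halfmass z (lam z))
      (at (z, z) within {p. fst p \<in> M \<and> snd p \<in> M \<and> fst p \<le> snd p \<and> \<bar>snd p - z\<bar> < d})"
    using mean_slope_tendsto[OF z] by blast
  have "\<forall>\<^sub>F y in at z. y \<in> M" using M_open z by (rule eventually_at_in_open')
  moreover have "\<forall>\<^sub>F y in at z. \<bar>y - z\<bar> < d"
    using d(1) by (auto simp: eventually_at dist_real_def)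
  ultimately have "\<forall>\<^sub>F y in at z. (y, y) \<in> {p. fst p \<in> M \<and> snd p \<in> M \<and> fst p \<le> snd p \<and> \<bar>snd p - z\<bar> < d}"
    by eventually_elim auto
  from filterlim_compose[OF d(2) filterlim_diagonal_at[OF this]]
  show ?thesis by (simp add: isCont_def mean_slope_diag)
qed

text \<open>The change splits into an effect of the multiplier on the common tail
  \<open>{w<..<1}\<close> and the loss of the piece \<open>{x<..<w}\<close>, evaluated with the old
  multiplier.\<close>

lemma optval_curve_diff:
  assumes x: "x \<in> M" and w: "w \<in> M" and xw: "x < w"
  shows "optval s w (lam w) - optval s x (lam x) =
    (lam w - lam x) * (s - 2 * mean_slope x w) - 2 * (LBINT t:{x<..<w}. dual (lam x) t)"
proof -
  have 01: "0 < x" "0 < w" "w < 1" using x w M_sub by auto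
  have lx2: "(lam x)\<^sup>2 \<le> \<theta> w" using lam_le[OF x] \<theta>_less[OF 01(1) xw 01(3)] by simp
  have i: "set_integrable lborel {x<..<1} (dual (lam x))" "set_integrable lborel {w<..<1} (dual (lam x))"
    "set_integrable lborel {w<..<1} (dual (lam w))"
    using dual_integrable[OF 01(1) _ lam_le[OF x], of 1] dual_integrable[OF 01(2) _ lx2, of 1]
      dual_integrable[OF 01(2) _ lam_le[OF w], of 1] by auto
  have "(LBINT t:{w<..<1}. dual (lam x) t) - (LBINT t:{w<..<1}. dual (lam w) t) = (LBINT t:{w<..<1}. dual (lam x) t - dual (lam w) t)"
    using set_integral_diff(2)[OF i(2,3)] by simp
  also have "\<dots> = (LBINT t:{w<..<1}. (lam w - lam x) * dual_quot (lam x) (lam w) t)"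
    using lt_\<theta>[OF 01(2) lx2] lt_\<theta>[OF 01(2) lam_le[OF w]] 01
    by (intro set_lebesgue_integral_cong) (auto intro!: dual_quot)
  also have "\<dots> = (lam w - lam x) * mean_slope x w" by (simp add: mean_slope_def)
  finally have "(LBINT t:{w<..<1}. dual (lam w) t) = (LBINT t:{w<..<1}. dual (lam x) t) - (lam w - lam x) * mean_slope x w" by simp
  then show ?thesis
    unfolding optval_def using set_integral_Ioo_split[OF i(1) xw 01(3)] by (simp add: algebra_simps)
qed

lemma optval_curve_has_derivative:
  assumes z: "z \<in> M" and l': "(lam has_real_derivative l') (at z)"
  shows "((\<lambda>x. optval s x (lam x)) has_real_derivative
    l' * (s - 2 * halfmass z (lam z)) - 2 * dual (lam z) z) (at z)"
proof -
  obtain d where d: "0 < d" "((\<lambda>p. mean_slope (fst p) (snd p)) \<longlongrightarrow> halfmass z (lam z))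
      (at (z, z) within {p. fst p \<in> M \<and> snd p \<in> M \<and> fst p \<le> snd p \<and> \<bar>snd p - z\<bar> < d})"
    using mean_slope_tendsto[OF z] by blast
  have evM: "\<forall>\<^sub>F y in at z. y \<in> M" using M_open z by (rule eventually_at_in_open')
  have "\<forall>\<^sub>F y in at z. \<bar>y - z\<bar> < d"
    using d(1) by (auto simp: eventually_at dist_real_def)
  with evM have "\<forall>\<^sub>F y in at z. (min y z, max y z) \<in> {p. fst p \<in> M \<and> snd p \<in> M \<and> fst p \<le> snd p \<and> \<bar>snd p - z\<bar> < d}"
    by eventually_elim (use z d(1) in \<open>auto simp: min_def max_def\<close>)
  from filterlim_compose[OF d(2) filterlim_min_max_at[OF this]]
  have ms: "((\<lambda>y. mean_slope (min y z) (max y z)) \<longlongrightarrow> halfmass z (lam z)) (at z)" by simp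
  have z01: "z \<in> {0<..<1}" using z M_sub by auto
  have "(fst \<longlongrightarrow> lam z) (at (lam z, z))" "(snd \<longlongrightarrow> z) (at (lam z, z))"
    using tendsto_fst[OF tendsto_ident_at[of "(lam z, z)" UNIV]] tendsto_snd[OF tendsto_ident_at[of "(lam z, z)" UNIV]] by auto
  from tendsto_dual[OF z01 this] have "isCont (\<lambda>(\<mu>, t). dual \<mu> t) (lam z, z)"
    by (simp add: isCont_def case_prod_unfold)
  then have avg: "((\<lambda>y. (LBINT t:{min y z<..<max y z}. dual (lam (min y z)) t) / (max y z - min y z)) \<longlongrightarrow> dual (lam z) z) (at z)"
    using M_sub lam_le by (intro average_tendsto[where M=M] lam_cont[OF z] M_open z dual_integrable) (auto simp: less_imp_le)
  have split: "(L * S - 2 * D) / h = L / h * S - 2 * (D / h)" for L S D h :: real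
    by (simp add: diff_divide_distrib)
  have "((\<lambda>y. (lam (max y z) - lam (min y z)) / (max y z - min y z) * (s - 2 * mean_slope (min y z) (max y z))
      - 2 * ((LBINT t:{min y z<..<max y z}. dual (lam (min y z)) t) / (max y z - min y z)))
     \<longlongrightarrow> l' * (s - 2 * halfmass z (lam z)) - 2 * dual (lam z) z) (at z)"
    using l' unfolding has_derivative_min_max_iff by (intro tendsto_intros ms avg)
  moreover have "\<forall>\<^sub>F y in at z. (lam (max y z) - lam (min y z)) / (max y z - min y z) * (s - 2 * mean_slope (min y z) (max y z))
      - 2 * ((LBINT t:{min y z<..<max y z}. dual (lam (min y z)) t) / (max y z - min y z)) =
      (optval s (max y z) (lam (max y z)) - optval s (min y z) (lam (min y z))) / (max y z - min y z)"
    using evM eventually_neq_at_within[of z z UNIV]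
  proof eventually_elim
    case (elim y)
    then have "min y z \<in> M" "max y z \<in> M" "min y z < max y z" using z by (auto simp: min_def max_def)
    then show ?case by (simp add: optval_curve_diff split)
  qed
  ultimately show ?thesis unfolding has_derivative_min_max_iff[of "\<lambda>x. optval s x (lam x)"]
    by (rule Lim_transform_eventually)
qed

end

section \<open>Stationary and saturated multipliers\<close>

lemma set_integral_Ioo_pos:
  fixes f :: "real \<Rightarrow> real"
  assumes f: "set_integrable lborel {x<..<y} f" and xy: "x < y" and pos: "\<And>t. t \<in> {x<..<y} \<Longrightarrow> 0 < f t"
  shows "0 < (LBINT t:{x<..<y}. f t)"
proof -
  have nn: "AE t in lborel. 0 \<le> indicator {x<..<y} t *\<^sub>R f t"
    using pos by (intro AE_I2) (auto simp: indicator_def less_imp_le)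
  have i: "integrable lborel (\<lambda>t. indicator {x<..<y} t *\<^sub>R f t)" using f by (simp add: set_integrable_def)
  have "0 \<le> (LBINT t:{x<..<y}. f t)" unfolding set_lebesgue_integral_def by (rule integral_nonneg_AE[OF nn])
  moreover have "(LBINT t:{x<..<y}. f t) \<noteq> 0"
  proof
    assume "(LBINT t:{x<..<y}. f t) = 0"
    then have "AE t in lborel. indicator {x<..<y} t *\<^sub>R f t = 0"
      using integral_nonneg_eq_0_iff_AE[OF i nn] by (simp add: set_lebesgue_integral_def)
    from AE_lborel_interval_witness[OF this xy] obtain t where "t \<in> {x<..<y}" "f t = 0" by auto
    then show False using pos[of t] by simp
  qed
  ultimately show ?thesis by simp
qed

lemma eventually_close: "0 < d \<Longrightarrow> \<forall>\<^sub>F y::real in at z. \<bar>y - z\<bar> < d"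
  by (auto simp: eventually_at dist_real_def)

text \<open>No regularity of \<open>lam\<close> is put in: monotonicity, continuity and
  differentiability all follow from the constancy of the mass.\<close>

locale stationary_curve = profile +
  fixes m0 m1 s :: real and lam :: "real \<Rightarrow> real"
  assumes m0: "0 < m0" and m1: "m1 < 1"
    and lam_pos: "\<And>x. x \<in> {m0<..<m1} \<Longrightarrow> 0 < lam x"
    and lam_less: "\<And>x. x \<in> {m0<..<m1} \<Longrightarrow> (lam x)\<^sup>2 < \<theta> x"
    and stationary: "\<And>x. x \<in> {m0<..<m1} \<Longrightarrow> 2 * halfmass x (lam x) = s"
begin

abbreviation "M \<equiv> {m0<..<m1}"

lemma M01: "x \<in> M \<Longrightarrow> x \<in> {0<..<1}" using m0 m1 by auto

definition mean_quot :: "real \<Rightarrow> real \<Rightarrow> real" where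
  "mean_quot x w = (LBINT t:{w<..<1}. slope_quot (lam x) (lam w) t)"

lemma lam_less_later: assumes "x \<in> M" "w \<in> M" "x \<le> w" shows "(lam x)\<^sup>2 < \<theta> w"
  using lam_less[OF assms(1)] \<theta>_less[of x w] M01[OF assms(1)] M01[OF assms(2)] assms(3) by (cases "x = w") auto

lemma halfmass_split:
  assumes x: "x \<in> M" and w: "w \<in> M" and xw: "x < w"
  shows "halfmass x (lam x) = (LBINT t:{x<..<w}. slope (lam x) t) + halfmass w (lam x)"
  unfolding halfmass_def
  by (rule set_integral_Ioo_split[OF slope_integrable])
    (use lam_less[OF x] lam_pos[OF x] M01[OF x] M01[OF w] xw in auto)

text \<open>A multiplier at \<open>w\<close> no larger than that at \<open>x\<close> would give no
  more mass on \<open>{w<..<1}\<close>, and the positive mass on \<open>{x<..<w}\<close> would be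
  missing.\<close>

lemma lam_strict_mono: assumes x: "x \<in> M" and w: "w \<in> M" and xw: "x < w" shows "lam x < lam w"
proof (rule ccontr)
  assume "\<not> lam x < lam w"
  then have le: "lam w \<le> lam x" by simp
  note l = lam_less_later[OF x w less_imp_le[OF xw]]
  have 01: "0 < x" "0 < w" "w < 1" using M01 x w by auto
  have i: "set_integrable lborel {w<..<1} (slope (lam x))" "set_integrable lborel {w<..<1} (slope (lam w))"
    using slope_integrable[OF 01(2) _ l, of 1] slope_integrable[OF 01(2) _ lam_less[OF w], of 1] lam_pos[OF x] lam_pos[OF w] by auto
  have "halfmass w (lam w) \<le> halfmass w (lam x)"
    unfolding halfmass_def
    by (rule set_integral_mono[OF i(2,1)])
      (use 01 lam_pos[OF w] le lt_\<theta>[OF 01(2) less_imp_le[OF l]] in \<open>auto intro!: slope_mono\<close>)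
  moreover have "0 < (LBINT t:{x<..<w}. slope (lam x) t)"
    using slope_integrable[OF 01(1) _ lam_less[OF x], of w] lam_pos[OF x] 01 xw lt_\<theta>[OF 01(1) less_imp_le[OF lam_less[OF x]]]
    by (intro set_integral_Ioo_pos slope_pos) auto
  ultimately show False using halfmass_split[OF x w xw] stationary[OF x] stationary[OF w] by simp
qed

lemma lam_mono: "x \<in> M \<Longrightarrow> w \<in> M \<Longrightarrow> x \<le> w \<Longrightarrow> lam x \<le> lam w"
  using lam_strict_mono[of x w] by (cases "x = w") auto

lemma slope_quot_integrable:
  assumes x: "x \<in> M" and w: "w \<in> M" and xw: "x \<le> w"
  shows "set_integrable lborel {w<..<1} (slope_quot (lam x) (lam w))"
    "\<And>t. t \<in> {w<..<1} \<Longrightarrow> \<rho> t / \<theta> t \<le> slope_quot (lam x) (lam w) t"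
proof -
  have 01: "0 < w" "w < 1" using M01 w by auto
  define \<eta> where "\<eta> = cosine (lam w) w"
  have \<eta>: "0 < \<eta>" using cosine_pos[of w "lam w"] lam_less[OF w] 01 by (simp add: \<eta>_def)
  have b: "\<rho> t / \<theta> t \<le> slope_quot (lam x) (lam w) t" "slope_quot (lam x) (lam w) t \<le> \<rho> t / \<theta> t / \<eta> ^ 3"
    if "t \<in> {w<..<1}" for t
    by (rule slope_quot_bounds; use that 01 lam_pos[OF x] lam_mono[OF x w xw] \<eta> cosine_lower[OF 01(1) lam_less[OF w], of t] in \<open>auto simp: \<eta>_def\<close>)+
  then show "\<And>t. t \<in> {w<..<1} \<Longrightarrow> \<rho> t / \<theta> t \<le> slope_quot (lam x) (lam w) t" by blast
  show "set_integrable lborel {w<..<1} (slope_quot (lam x) (lam w))"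
  proof (rule set_integrable_continuous_bounded[where C="B / \<theta> w / \<eta> ^ 3"])
    show "continuous_on {w<..<1} (slope_quot (lam x) (lam w))"
      using continuous_on_slope_quot[OF 01(1)] lam_less[OF w] lam_less_later[OF x w xw] lam_pos[OF x] lam_pos[OF w] by simp
    fix t assume t: "t \<in> {w<..<1}"
    have "0 \<le> \<rho> t / \<theta> t" "\<rho> t / \<theta> t \<le> B / \<theta> w"
      using t 01 \<rho>_pos[of t] \<rho>_le[of t] \<theta>_pos[of t] \<theta>_pos[of w] \<theta>_less[of w t] by (auto intro!: frac_le less_imp_le[of 0 "\<rho> t"] divide_nonneg_nonneg)
    then have "0 \<le> slope_quot (lam x) (lam w) t" "\<rho> t / \<theta> t / \<eta> ^ 3 \<le> B / \<theta> w / \<eta> ^ 3"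
      using b(1)[OF t] divide_right_mono[of "\<rho> t / \<theta> t" "B / \<theta> w" "\<eta> ^ 3"] zero_less_power[OF \<eta>, of 3]
      by linarith+
    then show "\<bar>slope_quot (lam x) (lam w) t\<bar> \<le> B / \<theta> w / \<eta> ^ 3" using b[OF t] by simp
  qed
qed

text \<open>With both masses equal to \<open>s\<close>, the gain on \<open>{w<..<1}\<close> from
  raising the multiplier balances the lost piece \<open>{x<..<w}\<close>. This exact form replaces
  the implicit function theorem.\<close>

lemma lam_diff:
  assumes x: "x \<in> M" and w: "w \<in> M" and xw: "x < w"
  shows "(lam w - lam x) * mean_quot x w = (LBINT t:{x<..<w}. slope (lam x) t)"
proof -
  note l = lam_less_later[OF x w less_imp_le[OF xw]]
  have 01: "0 < x" "0 < w" "w < 1" using M01 x w by auto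
  have i: "set_integrable lborel {w<..<1} (slope (lam x))" "set_integrable lborel {w<..<1} (slope (lam w))"
    using slope_integrable[OF 01(2) _ l, of 1] slope_integrable[OF 01(2) _ lam_less[OF w], of 1] lam_pos[OF x] lam_pos[OF w] by auto
  have "halfmass w (lam w) - halfmass w (lam x) = (LBINT t:{w<..<1}. slope (lam w) t - slope (lam x) t)"
    unfolding halfmass_def using set_integral_diff(2)[OF i(2,1)] by simp
  also have "\<dots> = (LBINT t:{w<..<1}. (lam w - lam x) * slope_quot (lam x) (lam w) t)"
    using lt_\<theta>[OF 01(2) less_imp_le[OF l]] lt_\<theta>[OF 01(2) less_imp_le[OF lam_less[OF w]]] 01 lam_pos[OF x] lam_pos[OF w]
    by (intro set_lebesgue_integral_cong) (auto intro!: slope_quot)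
  also have "\<dots> = (lam w - lam x) * mean_quot x w" by (simp add: mean_quot_def)
  finally show ?thesis using halfmass_split[OF x w xw] stationary[OF x] stationary[OF w] by simp
qed

lemma ratio_integrable:
  assumes "w \<in> {0<..<1}" shows "set_integrable lborel {w<..<1} (\<lambda>t. \<rho> t / \<theta> t)"
proof (rule set_integrable_continuous_bounded[where C="B / \<theta> w"])
  have "\<theta> t \<noteq> 0" if "t \<in> {w<..<1}" for t using \<theta>_pos[of t] that assms by auto
  then show "continuous_on {w<..<1} (\<lambda>t. \<rho> t / \<theta> t)"
    using continuous_on_\<theta>_\<rho>[of w 1] assms by (intro continuous_intros) auto
  fix t assume "t \<in> {w<..<1}"
  then show "\<bar>\<rho> t / \<theta> t\<bar> \<le> B / \<theta> w"
    using assms \<rho>_pos[of t] \<rho>_le[of t] \<theta>_pos[of t] \<theta>_pos[of w] \<theta>_less[of w t] by (auto intro!: frac_le)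
qed

text \<open>The bound depends only on \<open>v\<close>, hence is uniform in all pairs to the left of
  \<open>v\<close>; this permits division by \<open>mean_quot\<close>.\<close>

lemma mean_quot_lower:
  assumes x: "x \<in> M" and w: "w \<in> M" and xw: "x \<le> w" and v: "w \<le> v" "v < 1"
  shows "(LBINT t:{v<..<1}. \<rho> t / \<theta> t) \<le> mean_quot x w" "0 < (LBINT t:{v<..<1}. \<rho> t / \<theta> t)"
proof -
  have 01: "w \<in> {0<..<1}" "v \<in> {0<..<1}" using M01[OF w] v by auto
  have "(LBINT t:{v<..<1}. \<rho> t / \<theta> t) \<le> (LBINT t:{w<..<1}. \<rho> t / \<theta> t)"
    unfolding set_lebesgue_integral_def
  proof (rule integral_mono)
    fix t show "indicator {v<..<1} t *\<^sub>R (\<rho> t / \<theta> t) \<le> indicator {w<..<1} t *\<^sub>R (\<rho> t / \<theta> t)"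
      using v 01 \<rho>_pos[of t] \<theta>_pos[of t] by (auto simp: indicator_def intro!: divide_nonneg_nonneg less_imp_le)
  qed (use ratio_integrable[OF 01(1)] ratio_integrable[OF 01(2)] in \<open>auto simp: set_integrable_def\<close>)
  also have "\<dots> \<le> mean_quot x w"
    unfolding mean_quot_def
    by (rule set_integral_mono[OF ratio_integrable[OF 01(1)] slope_quot_integrable[OF x w xw]])
  finally show "(LBINT t:{v<..<1}. \<rho> t / \<theta> t) \<le> mean_quot x w" .
  show "0 < (LBINT t:{v<..<1}. \<rho> t / \<theta> t)"
    using 01 \<rho>_pos \<theta>_pos v by (intro set_integral_Ioo_pos ratio_integrable) auto
qed

lemma mean_quot_pos: "x \<in> M \<Longrightarrow> 0 < mean_quot x x"
  using mean_quot_lower[of x x x] M01[of x] by auto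

text \<open>\<open>lam_diff\<close> is turned into a Lipschitz estimate at \<open>z\<close>, by a
  lower bound \<open>k\<close> for \<open>mean_quot\<close> and an upper bound \<open>C\<close> for
  the slopes.\<close>

lemma lam_isCont: assumes z: "z \<in> M" shows "isCont lam z"
proof -
  have "(\<theta> \<longlongrightarrow> \<theta> z) (at z)" using isCont_\<theta>[OF M01[OF z]] by (simp add: isCont_def)
  from order_tendstoD(1)[OF this lam_less[OF z]]
  have "\<forall>\<^sub>F y in at z. (lam z)\<^sup>2 < \<theta> y \<and> y \<in> M"
    using eventually_at_in_open'[of M z] z by (auto simp: eventually_conj_iff)
  then obtain d where d: "0 < d" "\<And>y. y \<noteq> z \<Longrightarrow> \<bar>y - z\<bar> < d \<Longrightarrow> (lam z)\<^sup>2 < \<theta> y \<and> y \<in> M"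
    by (auto simp: eventually_at dist_real_def)
  \<comment> \<open>At \<open>x0\<close> the multiplier \<open>lam z\<close> is still admissible, so
    its slope dominates those for the smaller multipliers left of \<open>z\<close>; the tail beyond
    \<open>v\<close> bounds \<open>mean_quot\<close> from below.\<close>
  define x0 v where "x0 = z - d / 2" and "v = z + d / 2"
  have x0: "x0 \<in> M" "(lam z)\<^sup>2 < \<theta> x0" "x0 < z" and v: "v \<in> M" "z < v" using d(2)[of x0] d(2)[of v] d(1) by (auto simp: x0_def v_def)
  define k where "k = (LBINT t:{v<..<1}. \<rho> t / \<theta> t)"
  define C where "C = B / \<theta> x0 * (lam z / cosine (lam z) x0)"
  have k: "0 < k" using mean_quot_lower(2)[OF z z _ _ , of v] v M01[OF v(1)] by (simp add: k_def)
  have key: "lam w - lam x \<le> C / k * (w - x)" if "x \<in> M" "w \<in> M" "x < w" "x \<le> z" "x0 \<le> x" "w \<le> v" for x w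
  proof -
    have "(lam w - lam x) * k \<le> (lam w - lam x) * mean_quot x w"
      using mean_quot_lower(1)[of x w v] that v(1) m1 lam_mono[of x w] by (intro mult_left_mono) (auto simp: k_def)
    also have "\<dots> = (LBINT t:{x<..<w}. slope (lam x) t)" using lam_diff that by simp
    also have "\<dots> \<le> (LBINT t:{x<..<w}. C)"
    proof (rule set_integral_mono)
      show "set_integrable lborel {x<..<w} (slope (lam x))"
        using M01[of x] M01[of w] that lam_less[of x] lam_pos[of x] by (intro slope_integrable) auto
      show "set_integrable lborel {x<..<w} (\<lambda>t. C)"
        using that unfolding set_integrable_def by (intro integrable_scaleR_left integrable_real_indicator) auto
      fix t assume t: "t \<in> {x<..<w}"
      have t01: "t \<in> {0<..<1}" "x0 \<le> t" "t < 1" "0 < x0" using t that M01[of x] M01[of w] M01[OF x0(1)] by auto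
      have "\<theta> x0 \<le> \<theta> t" using \<theta>_less[of x0 t] t01 by (cases "x0 = t") auto
      then have "slope (lam x) t \<le> slope (lam z) t"
        using lam_mono[of x z] lam_pos[of x] that z x0(2) by (intro slope_mono[OF t01(1)]) auto
      also have "\<dots> \<le> C"
        using slope_bound[OF t01(4) x0(2) _ t01(2,3)] lam_pos[OF z] by (simp add: C_def)
      finally show "slope (lam x) t \<le> C" .
    qed
    also have "\<dots> = C * (w - x)" using that by (simp add: set_lebesgue_integral_def)
    finally show ?thesis using k by (simp add: field_simps)
  qed
  have "((\<lambda>y. lam y - lam z) \<longlongrightarrow> 0) (at z)"
  proof (rule Lim_null_comparison)
    have "\<forall>\<^sub>F y in at z. y \<noteq> z \<and> \<bar>y - z\<bar> < d / 2"
      using d(1) by (auto simp: eventually_at dist_real_def intro!: exI[of _ "d/2"])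
    then show "\<forall>\<^sub>F y in at z. norm (lam y - lam z) \<le> C / k * \<bar>y - z\<bar>"
    proof eventually_elim
      case (elim y)
      then have y: "y \<in> M" using d by auto
      show ?case
      proof (cases "y < z")
        case True
        then show ?thesis using key[OF y z True] lam_mono[OF y z] elim v by (auto simp: x0_def)
      next
        case False
        then have "z < y" using elim by auto
        then show ?thesis using key[OF z y] lam_mono[OF z y] elim x0 by (auto simp: v_def)
      qed
    qed
    have "((\<lambda>y. C / k * \<bar>y - z\<bar>) \<longlongrightarrow> C / k * \<bar>z - z\<bar>) (at z)" by (intro tendsto_intros)
    then show "((\<lambda>y. C / k * \<bar>y - z\<bar>) \<longlongrightarrow> 0) (at z)" by simp
  qed
  then show ?thesis by (simp add: isCont_def LIM_zero_iff)
qed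

text \<open>The largest multiplier on the box stays below the smallest value of
  \<open>sqrt \<theta>\<close> there. Hence all cosines are bounded away from zero and constant
  majorants suffice.\<close>

lemma box:
  assumes z: "z \<in> M"
  obtains d where "0 < d" "z - d \<in> M" "z + d \<in> M" "(lam (z + d))\<^sup>2 < \<theta> (z - d)"
proof -
  obtain c where c: "(lam z)\<^sup>2 < c" "c < \<theta> z" using dense lam_less[OF z] by blast
  have "(\<theta> \<longlongrightarrow> \<theta> z) (at z)" "((\<lambda>y. (lam y)\<^sup>2) \<longlongrightarrow> (lam z)\<^sup>2) (at z)"
    using isCont_\<theta>[OF M01[OF z]] lam_isCont[OF z] by (auto simp: isCont_def intro!: tendsto_power)
  then have "\<forall>\<^sub>F y in at z. c < \<theta> y \<and> (lam y)\<^sup>2 < c \<and> y \<in> M"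
    using order_tendstoD c eventually_at_in_open'[of M z] z by (auto simp: eventually_conj_iff)
  then obtain d where d: "0 < d" "\<And>y. y \<noteq> z \<Longrightarrow> \<bar>y - z\<bar> < d \<Longrightarrow> c < \<theta> y \<and> (lam y)\<^sup>2 < c \<and> y \<in> M"
    by (auto simp: eventually_at dist_real_def)
  show ?thesis using that[of "d/2"] d(1) d(2)[of "z - d/2"] d(2)[of "z + d/2"] by auto
qed

lemma mean_quot_tendsto:
  assumes z: "z \<in> M"
  obtains d where "0 < d" "((\<lambda>p. mean_quot (fst p) (snd p)) \<longlongrightarrow> mean_quot z z)
      (at (z, z) within {p. z - d < fst p \<and> fst p \<le> snd p \<and> snd p < z + d})"
proof -
  obtain d where d: "0 < d" "z - d \<in> M" "z + d \<in> M" "(lam (z + d))\<^sup>2 < \<theta> (z - d)" using box[OF z] by blast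
  define S where "S = {p. z - d < fst p \<and> fst p \<le> snd p \<and> snd p < z + d}"
  have zS: "(z, z) \<in> S" using d(1) by (simp add: S_def)
  define \<eta> where "\<eta> = cosine (lam (z + d)) (z - d)"
  have \<eta>: "0 < \<eta>" using cosine_pos M01[OF d(2)] d(4) by (simp add: \<eta>_def)
  have 0: "0 < z - d" using M01[OF d(2)] by simp
  have \<theta>0: "0 < \<theta> (z - d)" using \<theta>_pos[OF M01[OF d(2)]] .
  define C where "C = B / \<theta> (z - d) / \<eta> ^ 3"
  have SM: "fst p \<in> M" "snd p \<in> M" "fst p \<le> snd p" "z - d < snd p" "snd p < z + d" "0 < snd p" if "p \<in> S" for p
    using that d(2,3) 0 by (auto simp: S_def)
  have "((\<lambda>p. LBINT t:{snd p<..<1}. slope_quot (lam (fst p)) (lam (snd p)) t) \<longlongrightarrow>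
      (LBINT t:{z<..<1}. slope_quot (lam (fst (z, z))) (lam (snd (z, z))) t)) (at (z, z) within S)"
  proof (rule tail_integral_tendsto[OF zS _ _ _ SM(6), where W="\<lambda>_. C"])
    show "set_integrable lborel {0<..<1} (\<lambda>_::real. C)" by (simp add: set_integrable_def)
    show "0 \<le> C" using B_pos \<theta>0 \<eta> by (simp add: C_def)
    fix p assume p: "p \<in> S"
    note x = SM[OF p]
    show "(\<lambda>t. indicator {snd p<..<1} t * slope_quot (lam (fst p)) (lam (snd p)) t) \<in> borel_measurable borel"
      using slope_quot_integrable(1)[OF x(1-3)] by (auto simp: set_integrable_def)
    fix u :: real assume u: "0 < u" "snd p + u < 1"
    define t where "t = snd p + u"
    have t: "t \<in> {0<..<1}" "z - d \<le> t" "t < 1" "z - d < t" using u x(4,6) by (auto simp: t_def)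
    have "\<eta> \<le> cosine (lam (z + d)) t" unfolding \<eta>_def by (rule cosine_lower[OF 0 d(4) t(2,3)])
    also have "\<dots> \<le> cosine (lam (snd p)) t"
      using lam_mono[OF x(2) d(3)] x(5) lam_pos[OF x(2)] by (intro cosine_antimono[OF t(1)]) auto
    finally have "\<eta> \<le> cosine (lam (snd p)) t" .
    note b = slope_quot_bounds[OF t(1) lam_pos[OF x(1)] lam_mono[OF x(1-3)] \<eta> this]
    have "0 \<le> \<rho> t / \<theta> t" using \<rho>_pos[OF t(1)] \<theta>_pos[OF t(1)] by simp
    moreover have "\<rho> t / \<theta> t \<le> B / \<theta> (z - d)"
      using \<rho>_pos[OF t(1)] \<rho>_le[OF t(1)] \<theta>_less[OF 0 t(4,3)] \<theta>0 by (intro frac_le) auto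
    then have "\<rho> t / \<theta> t / \<eta> ^ 3 \<le> C" unfolding C_def using \<eta> by (intro divide_right_mono) auto
    ultimately show "\<bar>slope_quot (lam (fst p)) (lam (snd p)) (snd p + u)\<bar> \<le> C" using b by (simp add: t_def)
  next
    fix u :: real assume u: "0 < u" "z + u < 1"
    have l: "(fst \<longlongrightarrow> z) (at (z, z) within S)" "(snd \<longlongrightarrow> z) (at (z, z) within S)"
      using tendsto_fst[OF tendsto_ident_at[of "(z, z)" S]] tendsto_snd[OF tendsto_ident_at[of "(z, z)" S]] by auto
    have z01: "0 < z" using M01[OF z] by simp
    have lt: "(lam z)\<^sup>2 < \<theta> (z + u)" using lt_\<theta>[OF z01 less_imp_le[OF lam_less[OF z]], of "z + u"] u by simp
    have "((\<lambda>p. slope_quot (lam (fst p)) (lam (snd p)) (snd p + u)) \<longlongrightarrow> slope_quot (lam z) (lam z) (z + u)) (at (z, z) within S)"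
      using u z01
      by (intro tendsto_slope_quot isCont_tendsto_compose[OF lam_isCont[OF z]] l tendsto_add tendsto_const lt lam_pos[OF z]) auto
    then show "((\<lambda>p. slope_quot (lam (fst p)) (lam (snd p)) (snd p + u)) \<longlongrightarrow>
        slope_quot (lam (fst (z, z))) (lam (snd (z, z))) (z + u)) (at (z, z) within S)" by simp
  qed
  then show ?thesis using that[OF d(1)] by (simp add: mean_quot_def S_def)
qed

lemma mean_quot_min_max_tendsto: assumes z: "z \<in> M" shows "((\<lambda>y. mean_quot (min y z) (max y z)) \<longlongrightarrow> mean_quot z z) (at z)"
proof -
  obtain d where d: "0 < d" "((\<lambda>p. mean_quot (fst p) (snd p)) \<longlongrightarrow> mean_quot z z)
      (at (z, z) within {p. z - d < fst p \<and> fst p \<le> snd p \<and> snd p < z + d})" using mean_quot_tendsto[OF z] by blast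
  have "\<forall>\<^sub>F y in at z. (min y z, max y z) \<in> {p. z - d < fst p \<and> fst p \<le> snd p \<and> snd p < z + d}"
    using eventually_close[OF d(1), of z] by eventually_elim (use d(1) in \<open>auto simp: min_def max_def\<close>)
  from filterlim_compose[OF d(2) filterlim_min_max_at[OF this]] show ?thesis by simp
qed

lemma mean_quot_diag_isCont: assumes z: "z \<in> M" shows "isCont (\<lambda>y. mean_quot y y) z"
proof -
  obtain d where d: "0 < d" "((\<lambda>p. mean_quot (fst p) (snd p)) \<longlongrightarrow> mean_quot z z)
      (at (z, z) within {p. z - d < fst p \<and> fst p \<le> snd p \<and> snd p < z + d})" using mean_quot_tendsto[OF z] by blast
  have "\<forall>\<^sub>F y in at z. (y, y) \<in> {p. z - d < fst p \<and> fst p \<le> snd p \<and> snd p < z + d}"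
    using eventually_close[OF d(1), of z] by eventually_elim auto
  from filterlim_compose[OF d(2) filterlim_diagonal_at[OF this]] show ?thesis by (simp add: isCont_def)
qed

text \<open>The formula of the implicit function theorem: minus the derivative of the half mass in
  its lower end, divided by its derivative in the multiplier.\<close>

definition lam' :: "real \<Rightarrow> real" where "lam' z = slope (lam z) z / mean_quot z z"

lemma lam_has_derivative: assumes z: "z \<in> M" shows "(lam has_real_derivative lam' z) (at z)"
proof -
  have "(fst \<longlongrightarrow> lam z) (at (lam z, z))" "(snd \<longlongrightarrow> z) (at (lam z, z))"
    using tendsto_fst[OF tendsto_ident_at[of "(lam z, z)" UNIV]] tendsto_snd[OF tendsto_ident_at[of "(lam z, z)" UNIV]] by auto
  from tendsto_slope[OF M01[OF z] this lam_less[OF z]] have "isCont (\<lambda>(\<mu>, t). slope \<mu> t) (lam z, z)"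
    by (simp add: isCont_def case_prod_unfold)
  then have avg: "((\<lambda>y. (LBINT t:{min y z<..<max y z}. slope (lam (min y z)) t) / (max y z - min y z)) \<longlongrightarrow> slope (lam z) z) (at z)"
    using m0 m1 lam_less lam_pos
    by (intro average_tendsto[where M=M] lam_isCont[OF z] z slope_integrable) (auto simp: less_imp_le)
  have evM: "\<forall>\<^sub>F y in at z. y \<in> M" using z by (intro eventually_at_in_open') auto
  have "((\<lambda>y. (LBINT t:{min y z<..<max y z}. slope (lam (min y z)) t) / (max y z - min y z) / mean_quot (min y z) (max y z)) \<longlongrightarrow> lam' z) (at z)"
    unfolding lam'_def using mean_quot_pos[OF z] by (intro tendsto_divide avg mean_quot_min_max_tendsto[OF z]) auto
  moreover have "\<forall>\<^sub>F y in at z. (LBINT t:{min y z<..<max y z}. slope (lam (min y z)) t) / (max y z - min y z) / mean_quot (min y z) (max y z)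
      = (lam (max y z) - lam (min y z)) / (max y z - min y z)"
    using evM eventually_neq_at_within[of z z UNIV]
  proof eventually_elim
    case (elim y)
    then have xw: "min y z \<in> M" "max y z \<in> M" "min y z < max y z" using z by (auto simp: min_def max_def)
    have "0 < mean_quot (min y z) (max y z)"
      using mean_quot_lower[OF xw(1,2) less_imp_le[OF xw(3)] order_refl] M01[OF xw(2)] by simp
    then show ?case using lam_diff[OF xw, symmetric] by simp
  qed
  ultimately show ?thesis unfolding has_derivative_min_max_iff by (rule Lim_transform_eventually)
qed

lemma lam'_isCont: assumes z: "z \<in> M" shows "isCont lam' z"
  unfolding isCont_def lam'_def
  using mean_quot_pos[OF z] mean_quot_diag_isCont[OF z, unfolded isCont_def] lam_isCont[OF z, unfolded isCont_def]
  by (intro tendsto_divide tendsto_slope[OF M01[OF z]] tendsto_ident_at lam_less[OF z]) auto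

text \<open>The gap condition is easy here: on a \<open>box\<close> the right-hand side has a
  positive lower bound \<open>C\<close>, and \<open>t - w\<close> is at most 1.\<close>

sublocale multiplier_curve \<theta> \<rho> B M lam
proof
  show "open M" by simp
  show "M \<subseteq> {0<..<1}" using M01 by blast
  show "0 < lam x" if "x \<in> M" for x using that by (rule lam_pos)
  show "(lam x)\<^sup>2 \<le> \<theta> x" if "x \<in> M" for x using lam_less[OF that] by simp
  show "lam x \<le> lam y" if "x \<in> M" "y \<in> M" "x \<le> y" for x y using that by (rule lam_mono)
  show "isCont lam x" if "x \<in> M" for x using that by (rule lam_isCont)
  fix z assume z: "z \<in> M"
  obtain d where d: "0 < d" "z - d \<in> M" "z + d \<in> M" "(lam (z + d))\<^sup>2 < \<theta> (z - d)" using box[OF z] by blast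
  define C where "C = 1 - (lam (z + d))\<^sup>2 / \<theta> (z - d)"
  have \<theta>0: "0 < \<theta> (z - d)" using \<theta>_pos[OF M01[OF d(2)]] .
  have C: "0 < C" using d(4) \<theta>0 by (simp add: C_def)
  have "C * (t - w) \<le> 1 - (lam w)\<^sup>2 / \<theta> t" if "w \<in> M" "\<bar>w - z\<bar> < d" "w < t" "t < 1" for w t
  proof -
    have "z - d < t" "0 < z - d" using that M01[OF d(2)] by auto
    then have "\<theta> (z - d) \<le> \<theta> t" using \<theta>_less[of "z - d" t] that by auto
    moreover have "(lam w)\<^sup>2 \<le> (lam (z + d))\<^sup>2" using lam_mono[OF that(1) d(3)] that lam_pos[OF that(1)] by (intro power_mono) auto
    ultimately have "(lam w)\<^sup>2 / \<theta> t \<le> (lam (z + d))\<^sup>2 / \<theta> (z - d)" using \<theta>0 by (intro frac_le) auto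
    then have "C \<le> 1 - (lam w)\<^sup>2 / \<theta> t" by (simp add: C_def)
    moreover have "C * (t - w) \<le> C * 1" using C that M01[OF that(1)] by (intro mult_left_mono) auto
    ultimately show ?thesis by simp
  qed
  then show "\<exists>C>0. \<exists>d>0. \<forall>w\<in>M. \<bar>w - z\<bar> < d \<longrightarrow> (\<forall>t. w < t \<longrightarrow> t < 1 \<longrightarrow> C * (t - w) \<le> 1 - (lam w)\<^sup>2 / \<theta> t)"
    using C d(1) by blast
qed

text \<open>An envelope argument: stationarity removes the contribution of the moving
  multiplier.\<close>

lemma optval_has_derivative:
  assumes z: "z \<in> M"
  shows "((\<lambda>x. optval s x (lam x)) has_real_derivative - 2 * dual (lam z) z) (at z)"
  using optval_curve_has_derivative[OF z lam_has_derivative[OF z], of s] stationary[OF z] by simp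

end

section \<open>Saturated multipliers, whose slopes are singular at the left end point\<close>

context profile
begin

text \<open>Here the cosine vanishes at the end point, and the positive derivative of
  \<open>\<theta>\<close> supplies the linear gap: by the mean value theorem near \<open>z\<close>,
  and by monotonicity farther to the right.\<close>

lemma saturated_curve:
  assumes m: "0 < m0" "m1 < 1"
    and \<theta>': "\<And>x. x \<in> {m0<..<m1} \<Longrightarrow> (\<theta> has_real_derivative \<theta>' x) (at x)" "continuous_on {m0<..<m1} \<theta>'"
    "\<And>x. x \<in> {m0<..<m1} \<Longrightarrow> 0 < \<theta>' x"
  shows "multiplier_curve \<theta> \<rho> B {m0<..<m1} (\<lambda>x. sqrt (\<theta> x))"
proof
  let ?M = "{m0<..<m1}"
  have M01: "x \<in> {0<..<1}" if "x \<in> ?M" for x using that m by auto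
  show "open ?M" by simp
  show "?M \<subseteq> {0<..<1}" using M01 by blast
  show "0 < sqrt (\<theta> x)" "(sqrt (\<theta> x))\<^sup>2 \<le> \<theta> x" if "x \<in> ?M" for x using \<theta>_pos[OF M01[OF that]] by auto
  show "sqrt (\<theta> x) \<le> sqrt (\<theta> y)" if "x \<in> ?M" "y \<in> ?M" "x \<le> y" for x y
    using \<theta>_less[of x y] M01 that by (cases "x = y") auto
  show "isCont (\<lambda>x. sqrt (\<theta> x)) x" if "x \<in> ?M" for x using isCont_\<theta>[OF M01[OF that]] by (intro continuous_intros)
  fix z assume z: "z \<in> ?M"
  obtain d where d: "0 < d" "\<And>y. \<bar>y - z\<bar> \<le> d \<Longrightarrow> y \<in> ?M" using open_neighbours[of ?M z] z by auto
  have sub: "{z - d..z + d} \<subseteq> ?M" using d(2) by (auto simp: abs_le_iff)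
  have "compact (\<theta>' ` {z - d..z + d})" using continuous_on_subset[OF \<theta>'(2) sub] by (intro compact_continuous_image) auto
  from compact_attains_inf[OF this] obtain x0 where x0: "x0 \<in> {z - d..z + d}" "\<And>x. x \<in> {z - d..z + d} \<Longrightarrow> \<theta>' x0 \<le> \<theta>' x"
    using d(1) by auto
  \<comment> \<open>The least value of \<open>\<theta>'\<close> on a compact interval around
    \<open>z\<close>; it is attained, hence positive.\<close>
  define c where "c = \<theta>' x0"
  have c: "0 < c" using \<theta>'(3)[of x0] x0(1) sub by (auto simp: c_def)
  have q: "z + d \<in> ?M" "0 < z + d" "z + d < 1" using d M01[of "z + d"] by auto
  have \<theta>q: "0 < \<theta> (z + d)" using \<theta>_pos q by simp
  have mvt: "c * (t - w) \<le> \<theta> t - \<theta> w" if "z - d \<le> w" "w < t" "t \<le> z + d" for w t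
  proof -
    have "\<exists>\<xi>>w. \<xi> < t \<and> \<theta> t - \<theta> w = (t - w) * \<theta>' \<xi>"
    proof (rule MVT2[OF that(2)])
      fix x assume "w \<le> x" "x \<le> t"
      then have "x \<in> {z - d..z + d}" using that by auto
      then show "(\<theta> has_real_derivative \<theta>' x) (at x)" using sub \<theta>'(1) by blast
    qed
    then obtain \<xi> where \<xi>: "w < \<xi>" "\<xi> < t" "\<theta> t - \<theta> w = (t - w) * \<theta>' \<xi>" by blast
    have "c \<le> \<theta>' \<xi>" unfolding c_def using \<xi> that by (intro x0(2)) auto
    then show ?thesis using \<xi> that by (simp add: mult.commute mult_left_mono)
  qed
  \<comment> \<open>One constant for both ranges of \<open>t\<close>: up to \<open>z + d\<close> the
    estimate \<open>mvt\<close> applies and \<open>d / 2 \<le> 1\<close> is absorbed; beyond it,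
    \<open>t - w \<le> 1\<close> while \<open>w\<close> keeps the distance \<open>d / 2\<close> from
    \<open>z + d\<close>.\<close>
  define C where "C = c * (d / 2) / \<theta> (z + d)"
  have C: "0 < C" using c d(1) \<theta>q by (simp add: C_def)
  have d1: "d / 2 \<le> 1" using d(2)[of "z - d"] d(1) q m by auto
  have "C * (t - w) \<le> 1 - (sqrt (\<theta> w))\<^sup>2 / \<theta> t" if w: "w \<in> ?M" "\<bar>w - z\<bar> < d / 2" "w < t" "t < 1" for w t
  proof -
    have w01: "0 < w" "w < 1" using M01[OF w(1)] by auto
    have wd: "z - d \<le> w" "w < z + d" using w(2) d(1) by linarith+
    have \<theta>w: "0 < \<theta> w" using \<theta>_pos w01 by simp
    show ?thesis
    proof (cases "t \<le> z + d")
      case True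
      have \<theta>t: "0 < \<theta> t" "\<theta> t \<le> \<theta> (z + d)" using \<theta>_pos[of t] \<theta>_less[of t "z + d"] True w w01 q by (cases "t = z + d"; auto)+
      have "C * (t - w) = c * (t - w) * (d / 2) / \<theta> (z + d)" by (simp add: C_def)
      also have "\<dots> \<le> c * (t - w) * 1 / \<theta> t"
        using c w d1 d(1) \<theta>t by (intro frac_le mult_left_mono) auto
      also have "\<dots> \<le> (\<theta> t - \<theta> w) / \<theta> t" using mvt[OF wd(1) w(3) True] \<theta>t by (simp add: divide_right_mono)
      also have "\<dots> = 1 - (sqrt (\<theta> w))\<^sup>2 / \<theta> t" using \<theta>t \<theta>w by (simp add: diff_divide_distrib)
      finally show ?thesis .
    next
      case False
      have \<theta>t: "\<theta> (z + d) \<le> \<theta> t" using \<theta>_less[of "z + d" t] False w q by auto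
      have "C * (t - w) \<le> C * 1" using C w w01 by (intro mult_left_mono) auto
      also have "\<dots> \<le> c * (z + d - w) / \<theta> (z + d)"
      proof -
        have "d / 2 \<le> z + d - w" using w(2) by linarith
        then have "c * (d / 2) \<le> c * (z + d - w)" using c by (intro mult_left_mono) auto
        then show ?thesis unfolding C_def using \<theta>q by (simp only: mult_1_right) (rule divide_right_mono, auto)
      qed
      also have "\<dots> \<le> (\<theta> (z + d) - \<theta> w) / \<theta> (z + d)" using mvt[of w "z + d"] wd \<theta>q by (simp add: divide_right_mono)
      also have "\<dots> = 1 - \<theta> w / \<theta> (z + d)" using \<theta>q by (simp add: diff_divide_distrib)
      also have "\<dots> \<le> 1 - \<theta> w / \<theta> t" using \<theta>t \<theta>q \<theta>w by (simp add: frac_le)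
      finally show ?thesis using \<theta>w by simp
    qed
  qed
  then show "\<exists>C>0. \<exists>d>0. \<forall>w\<in>?M. \<bar>w - z\<bar> < d \<longrightarrow> (\<forall>t. w < t \<longrightarrow> t < 1 \<longrightarrow> C * (t - w) \<le> 1 - (sqrt (\<theta> w))\<^sup>2 / \<theta> t)"
    using C d(1) half_gt_zero by blast
qed

end

section \<open>Monotonicity of the minimal energy\<close>

lemma ennreal_transfer_derivative:
  assumes "open S" "\<And>x. x \<in> S \<Longrightarrow> F x = ennreal (g x) \<and> 0 \<le> g x" "x \<in> S" "(g has_real_derivative D) (at x)"
  shows "((\<lambda>x. enn2real (F x)) has_real_derivative D) (at x)"
  by (rule has_field_derivative_transform_within_open[OF assms(4,1,3)]) (use assms(2) in auto)

lemma ennreal_C1_onI: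
  assumes "open S" "\<And>x. x \<in> S \<Longrightarrow> F x = ennreal (g x) \<and> 0 \<le> g x"
    and "\<And>x. x \<in> S \<Longrightarrow> (g has_real_derivative g' x) (at x)" "continuous_on S g'"
  shows "ennreal_C1_on F S"
  unfolding ennreal_C1_on_def
  using C1_differentiable_on_I[OF ennreal_transfer_derivative[OF assms(1,2) _ assms(3)] assms(4)] assms(2)
  by auto

theorem lemma2p13:
  fixes l Q \<omega> \<phi> :: "real \<Rightarrow> real" and s m\<^sub>0 m\<^sub>1 :: real
  assumes "admissible_data l Q \<omega> \<phi>"
    and "0 < s"
    and "0 < m\<^sub>0" and "m\<^sub>0 < m\<^sub>1" and "m\<^sub>1 < 1"
  shows
    "((\<forall>m \<in> {m\<^sub>0<..<m\<^sub>1}. lam l Q \<omega> m s \<in> {0<..<sqrt (theta l Q \<omega> m)}) \<longrightarrow>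
        ennreal_C1_on (frakG l Q \<omega> s) {m\<^sub>0<..<m\<^sub>1} \<and>
        strict_antimono_on {m\<^sub>0<..<m\<^sub>1} (frakG l Q \<omega> s) \<and>
        (\<lambda>m. lam l Q \<omega> m s) C1_differentiable_on {m\<^sub>0<..<m\<^sub>1} \<and>
        strict_mono_on {m\<^sub>0<..<m\<^sub>1} (\<lambda>m. lam l Q \<omega> m s))
     \<and>
     ((\<forall>m \<in> {m\<^sub>0<..<m\<^sub>1}. lam l Q \<omega> m s = sqrt (theta l Q \<omega> m)) \<and>
      theta l Q \<omega> C1_differentiable_on {m\<^sub>0<..<m\<^sub>1} \<and>
      (\<forall>t \<in> {0<..<1}. \<exists>d>0. (theta l Q \<omega> has_real_derivative d) (at t)) \<longrightarrow>
        ennreal_C1_on (frakG l Q \<omega> s) {m\<^sub>0<..<m\<^sub>1} \<and>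
        mono_on {m\<^sub>0<..<m\<^sub>1} (frakG l Q \<omega> s) \<and>
        ((\<forall>m \<in> {m\<^sub>0<..<m\<^sub>1}.
            w_min l Q \<omega> m s \<in> SBV_on (2 * m - 1) 1 - W11_on (2 * m - 1) 1) \<longrightarrow>
          strict_mono_on {m\<^sub>0<..<m\<^sub>1} (frakG l Q \<omega> s)) \<and>
        (\<forall>m \<in> {m\<^sub>0<..<m\<^sub>1}. w_min l Q \<omega> m s \<in> W11_on (2 * m - 1) 1 \<longrightarrow>
          ((\<lambda>x. enn2real (frakG l Q \<omega> s x)) has_real_derivative 0) (at m)))"
proof -
  interpret A: admissible_data l Q \<omega> \<phi> by fact
  obtain B where "profile A.\<theta> A.\<rho> B" by (rule A.profile)
  then interpret profile A.\<theta> A.\<rho> B .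
  let ?M = "{m\<^sub>0<..<m\<^sub>1}" let ?\<theta> = A.\<theta> let ?\<rho> = A.\<rho>
  define lm where "lm m = lam l Q \<omega> m s" for m
  have M01: "0 < x" "x < 1" if "x \<in> ?M" for x using that assms by auto
  note struct = A.minimizer_structure[OF M01 assms(2), folded lm_def]
  have G: "frakG l Q \<omega> s x = ennreal (optval s x (lm x)) \<and> 0 \<le> optval s x (lm x)" if "x \<in> ?M" for x
    using struct(5,6) that by blast
  have part1: "ennreal_C1_on (frakG l Q \<omega> s) ?M \<and> strict_antimono_on ?M (frakG l Q \<omega> s) \<and>
        lm C1_differentiable_on ?M \<and> strict_mono_on ?M lm"
    if *: "\<forall>m \<in> ?M. lm m \<in> {0<..<sqrt (?\<theta> m)}"
  proof -
    interpret S: stationary_curve ?\<theta> ?\<rho> B m\<^sub>0 m\<^sub>1 s lm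
    proof
      fix x assume x: "x \<in> ?M"
      then show "0 < lm x" using * by auto
      have "(lm x)\<^sup>2 < (sqrt (?\<theta> x))\<^sup>2" using bspec[OF * x] by (intro power_strict_mono) auto
      then show lt: "(lm x)\<^sup>2 < ?\<theta> x" using \<theta>_pos[of x] M01[OF x] by simp
      show "2 * halfmass x (lm x) = s" using struct(4)[OF x x lt] .
    qed (use assms in auto)
    have c: "continuous_on ?M (\<lambda>z. - 2 * dual (lm z) z)"
      unfolding continuous_on_eq_continuous_at[OF open_greaterThanLessThan] isCont_def
      using S.lam_isCont S.M01
      by (auto intro!: tendsto_mult_left tendsto_minus tendsto_dual simp: isCont_def)
    \<comment> \<open>As the gap is strict, the cosine is still positive at \<open>z\<close>
      itself.\<close>
    have neg: "- 2 * dual (lm z) z < 0" if z: "z \<in> ?M" for z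
      using \<rho>_pos[OF S.M01[OF z]] cosine_pos[OF S.M01[OF z] S.lam_less[OF z]] by (simp add: dual_def)
    have "frakG l Q \<omega> s y < frakG l Q \<omega> s x" if "x \<in> ?M" "y \<in> ?M" "x < y" for x y
    proof -
      have "optval s y (lm y) < optval s x (lm x)"
      proof (rule DERIV_neg_imp_decreasing[OF that(3)])
        fix t assume "x \<le> t" "t \<le> y"
        then have "t \<in> ?M" using that by auto
        then show "\<exists>D. ((\<lambda>x. optval s x (lm x)) has_real_derivative D) (at t) \<and> D < 0"
          using S.optval_has_derivative neg by blast
      qed
      then show ?thesis using G that by (simp add: ennreal_lessI ennreal_less_iff)
    qed
    then have "strict_antimono_on ?M (frakG l Q \<omega> s)" by (simp add: monotone_on_def)
    moreover have "strict_mono_on ?M lm" using S.lam_strict_mono by (simp add: strict_mono_on_def)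
    moreover have "lm C1_differentiable_on ?M"
      using S.lam_has_derivative S.lam'_isCont
      by (intro C1_differentiable_on_I[where g=S.lam']) (auto intro: continuous_at_imp_continuous_on)
    moreover have "ennreal_C1_on (frakG l Q \<omega> s) ?M"
      by (rule ennreal_C1_onI[OF _ G S.optval_has_derivative c]) auto
    ultimately show ?thesis by blast
  qed
  have part2: "ennreal_C1_on (frakG l Q \<omega> s) ?M \<and> mono_on ?M (frakG l Q \<omega> s) \<and>
        ((\<forall>m \<in> ?M. w_min l Q \<omega> m s \<in> SBV_on (2 * m - 1) 1 - W11_on (2 * m - 1) 1) \<longrightarrow>
          strict_mono_on ?M (frakG l Q \<omega> s)) \<and>
        (\<forall>m \<in> ?M. w_min l Q \<omega> m s \<in> W11_on (2 * m - 1) 1 \<longrightarrow>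
          ((\<lambda>x. enn2real (frakG l Q \<omega> s x)) has_real_derivative 0) (at m))"
    if *: "\<forall>m \<in> ?M. lm m = sqrt (?\<theta> m)" and C1: "?\<theta> C1_differentiable_on ?M"
      and d: "\<forall>t \<in> {0<..<1}. \<exists>d>0. (?\<theta> has_real_derivative d) (at t)"
  proof -
    obtain \<theta>' where \<theta>': "\<And>x. x \<in> ?M \<Longrightarrow> (?\<theta> has_real_derivative \<theta>' x) (at x)" "continuous_on ?M \<theta>'"
      using C1 unfolding C1_differentiable_on_def has_real_derivative_iff_has_vector_derivative by blast
    have \<theta>'_pos: "0 < \<theta>' x" if "x \<in> ?M" for x
      using d DERIV_unique[OF \<theta>'(1)[OF that]] M01[OF that] by (metis greaterThanLessThan_iff)
    define \<kappa> where "\<kappa> x = sqrt (?\<theta> x)" for x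
    have lm: "lm x = \<kappa> x" if "x \<in> ?M" for x using * that by (simp add: \<kappa>_def)
    interpret C: multiplier_curve ?\<theta> ?\<rho> B ?M \<kappa>
      unfolding \<kappa>_def by (rule saturated_curve[OF assms(3,5) \<theta>' \<theta>'_pos])
    define G' where "G' z = \<theta>' z / (2 * \<kappa> z) * (s - 2 * halfmass z (\<kappa> z))" for z
    have \<kappa>': "(\<kappa> has_real_derivative \<theta>' z / (2 * \<kappa> z)) (at z)" if z: "z \<in> ?M" for z
    proof -
      have "((\<lambda>x. sqrt (?\<theta> x)) has_real_derivative (inverse (sqrt (?\<theta> z)) / 2) * \<theta>' z) (at z)"
        by (rule DERIV_chain2[OF DERIV_real_sqrt \<theta>'(1)[OF z]]) (use \<theta>_pos M01[OF z] in auto)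
      then show ?thesis unfolding \<kappa>_def by (simp add: field_simps)
    qed
    \<comment> \<open>At saturation the cosine vanishes at \<open>z\<close>, so the moving end point
      contributes nothing.\<close>
    have dual0: "dual (\<kappa> z) z = 0" if z: "z \<in> ?M" for z
      using \<theta>_pos[of z] M01[OF z] by (simp add: dual_def cosine_def \<kappa>_def)
    have G'': "((\<lambda>x. optval s x (\<kappa> x)) has_real_derivative G' z) (at z)" if z: "z \<in> ?M" for z
      using C.optval_curve_has_derivative[OF z \<kappa>'[OF z], of s] by (simp add: G'_def dual0[OF z])
    have G\<kappa>: "frakG l Q \<omega> s x = ennreal (optval s x (\<kappa> x)) \<and> 0 \<le> optval s x (\<kappa> x)" if "x \<in> ?M" for x
      using G[OF that] lm[OF that] by simp
    have hm: "2 * halfmass z (\<kappa> z) \<le> s" "w_min l Q \<omega> z s \<in> W11_on (2 * z - 1) 1 \<longleftrightarrow> 2 * halfmass z (\<kappa> z) = s"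
      if "z \<in> ?M" for z
      using struct(3,7)[OF that that] lm[OF that] by auto
    have \<kappa>_pos: "0 < \<theta>' z / (2 * \<kappa> z)" if "z \<in> ?M" for z
      using \<theta>'_pos[OF that] C.lam_pos[OF that] by simp
    have "continuous_on ?M G'"
    proof -
      have "continuous_on ?M \<kappa>" "continuous_on ?M (\<lambda>x. halfmass x (\<kappa> x))"
        using C.lam_cont C.halfmass_curve_isCont by (auto intro: continuous_at_imp_continuous_on)
      moreover have "\<kappa> z \<noteq> 0" if "z \<in> ?M" for z using C.lam_pos[OF that] by simp
      ultimately show ?thesis unfolding G'_def using \<theta>'(2) by (intro continuous_intros) auto
    qed
    then have "ennreal_C1_on (frakG l Q \<omega> s) ?M"
      using ennreal_C1_onI[OF open_greaterThanLessThan G\<kappa> G''] by blast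
    moreover have "mono_on ?M (frakG l Q \<omega> s)"
    proof (rule mono_onI)
      fix x y assume xy: "x \<in> ?M" "y \<in> ?M" "x \<le> y"
      have "optval s x (\<kappa> x) \<le> optval s y (\<kappa> y)"
      proof (rule DERIV_nonneg_imp_nondecreasing[OF xy(3)])
        fix t assume "x \<le> t" "t \<le> y"
        then have t: "t \<in> ?M" using xy by auto
        have "0 \<le> G' t" unfolding G'_def using \<kappa>_pos[OF t] hm(1)[OF t] by (intro mult_nonneg_nonneg) auto
        then show "\<exists>D. ((\<lambda>x. optval s x (\<kappa> x)) has_real_derivative D) (at t) \<and> 0 \<le> D" using G''[OF t] by blast
      qed
      then show "frakG l Q \<omega> s x \<le> frakG l Q \<omega> s y" using G\<kappa> xy by (simp add: ennreal_leI)
    qed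
    moreover have "strict_mono_on ?M (frakG l Q \<omega> s)"
      if nW: "\<forall>m \<in> ?M. w_min l Q \<omega> m s \<in> SBV_on (2 * m - 1) 1 - W11_on (2 * m - 1) 1"
    proof (rule strict_mono_onI)
      fix x y assume xy: "x \<in> ?M" "y \<in> ?M" "x < y"
      have "optval s x (\<kappa> x) < optval s y (\<kappa> y)"
      proof (rule DERIV_pos_imp_increasing[OF xy(3)])
        fix t assume "x \<le> t" "t \<le> y"
        then have t: "t \<in> ?M" using xy by auto
        \<comment> \<open>Not being in \<open>W11_on\<close> excludes full mass, so the inequality
          in \<open>hm\<close> is strict.\<close>
        have "2 * halfmass t (\<kappa> t) < s" using hm[OF t] nW t by force
        then have "0 < G' t" unfolding G'_def using \<kappa>_pos[OF t] by (intro mult_pos_pos) auto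
        then show "\<exists>D. ((\<lambda>x. optval s x (\<kappa> x)) has_real_derivative D) (at t) \<and> 0 < D" using G''[OF t] by blast
      qed
      then show "frakG l Q \<omega> s x < frakG l Q \<omega> s y" using G\<kappa> xy by (simp add: ennreal_lessI ennreal_less_iff)
    qed
    moreover have "((\<lambda>x. enn2real (frakG l Q \<omega> s x)) has_real_derivative 0) (at m)"
      if m: "m \<in> ?M" "w_min l Q \<omega> m s \<in> W11_on (2 * m - 1) 1" for m
    proof -
      have "G' m = 0" using hm(2)[OF m(1)] m(2) by (simp add: G'_def)
      then show ?thesis
        using ennreal_transfer_derivative[OF open_greaterThanLessThan G\<kappa> m(1) G''[OF m(1)]] by simp
    qed
    ultimately show ?thesis by blast
  qed
  show ?thesis using part1 part2 unfolding lm_def by blast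
qed

end
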